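(* Let $\kappa_\rho\in\frac12\mathbb N$ and $s_{\kappa_\rho}=\frac{1-4\kappa_\rho^2}{9}$. For $r,s\in\mathbb C$ let $$Q_1(z;r,s)=\pi^2\left(rE_4(z)+s\frac{E_6(z)^2}{E_4(z)^2}\right).$$ (a) Assume $3\nmid 2\kappa_\rho$. Then $Q_1(z;r,s)$ is apparent if $s=s_{\kappa_\rho}$ and any $r\in\mathbb C$. (b) Assume $3\mid 2\kappa_\rho$. Then there exists a polynomial $P(x)\in\mathbb Q[x]$ of degree $2\kappa_\rho/3$ such that $Q_1(z;r,s)$ with $s=s_{\kappa_\rho}$ is apparent if and only if $r$ is a root of $P(x)$. Moreover, $r$ satisfies $$r+s_{\kappa_\rho}=-\left(\ell+\frac12\right)^2,\qquad\text{where }\ell=0,1,2,\ldots,\frac{2\kappa_\rho}{3}-1.$$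
   Context: $\mathbb N=\{1,2,\dots\}$, $q=e^{2\pi iz}$, and $E_4=1+240\sum_{m\ge1}\frac{m^3q^m}{1-q^m}$, $E_6=1-504\sum_{m\ge1}\frac{m^5q^m}{1-q^m}$ are the Eisenstein series of weights $4$ and $6$ on $\mathrm{SL}(2,\mathbb Z)$, viewed as functions on the upper half-plane $\mathbb H$. A function $Q$ is called apparent if for the equation $y''=Q(z)y$ ($'=d/dz$) on $\mathbb H$, at every pole of $Q$ in $\mathbb H$ the local exponents are $\frac12\pm\kappa$ with $\kappa\in\frac12\mathbb Z_{\ge0}$ and no solution has a logarithmic singularity there. *)

theory Defs
  imports "HOL-Complex_Analysis.Complex_Analysis"
begin

definition upper_half_plane :: "complex set" where
  "upper_half_plane = {z. Im z > 0}"

definition nome :: "complex \<Rightarrow> complex" where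
  "nome z = exp (2 * of_real pi * \<i> * z)"

text \<open>The series below converge on the upper half-plane; elsewhere the values are irrelevant.\<close>

definition E4 :: "complex \<Rightarrow> complex" where
  "E4 z = 1 + 240 * (\<Sum>m. of_nat (Suc m) ^ 3 * nome z ^ Suc m / (1 - nome z ^ Suc m))"

definition E6 :: "complex \<Rightarrow> complex" where
  "E6 z = 1 - 504 * (\<Sum>m. of_nat (Suc m) ^ 5 * nome z ^ Suc m / (1 - nome z ^ Suc m))"

definition Q1 :: "complex \<Rightarrow> complex \<Rightarrow> complex \<Rightarrow> complex" where
  "Q1 r s z = of_real pi ^ 2 * (r * E4 z + s * (E6 z ^ 2 / E4 z ^ 2))"

definition s_exp :: "real \<Rightarrow> complex" where
  "s_exp \<kappa> = of_real ((1 - 4 * \<kappa>\<^sup>2) / 9)"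

definition solves_on :: "(complex \<Rightarrow> complex) \<Rightarrow> (complex \<Rightarrow> complex) \<Rightarrow> complex set \<Rightarrow> bool" where
  "solves_on Q y S \<longleftrightarrow> y holomorphic_on S \<and> (\<forall>z\<in>S. deriv (deriv y) z = Q z * y z)"

text \<open>The disc cut along the ray to the left of its centre, so that the principal branches
  of \<open>Ln (z - z0)\<close> and \<open>(z - z0) powr a\<close> are holomorphic on it.\<close>

definition slit_disc :: "complex \<Rightarrow> real \<Rightarrow> complex set" where
  "slit_disc z0 \<epsilon> = {z \<in> ball z0 \<epsilon>. z - z0 \<notin> \<real>\<^sub>\<le>\<^sub>0}"

text \<open>\<open>z0\<close> is a singular point of \<open>y'' = Q y\<close> of Fuchsian type (\<open>Q\<close> has a pole of order at
  most two), and \<open>a\<close>, \<open>b\<close> are, with multiplicity, the roots of the indicial equation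
  \<open>\<alpha> (\<alpha> - 1) = c\<close>, where \<open>c\<close> is the coefficient of \<open>(z - z0)\<^sup>-\<^sup>2\<close> in \<open>Q\<close>.\<close>

definition has_local_exponents ::
    "(complex \<Rightarrow> complex) \<Rightarrow> complex \<Rightarrow> complex \<Rightarrow> complex \<Rightarrow> bool" where
  "has_local_exponents Q z0 a b \<longleftrightarrow>
     (\<exists>c. ((\<lambda>z. (z - z0)\<^sup>2 * Q z) \<longlongrightarrow> c) (at z0) \<and>
          (\<forall>\<alpha>. \<alpha> * (\<alpha> - 1) - c = (\<alpha> - a) * (\<alpha> - b)))"

text \<open>When the local exponents at \<open>z0\<close> differ by an integer, Frobenius' method writes every
  solution near \<open>z0\<close> as \<open>(z - z0)\<^sup>a (g(z) + h(z) log (z - z0))\<close> with \<open>g\<close>, \<open>h\<close> holomorphic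
  at \<open>z0\<close>. The singularity is logarithmic if the logarithm actually occurs, i.e. \<open>h\<close> is not
  identically zero (whether it is does not depend on the choice of the representation).\<close>

definition has_log_singularity :: "(complex \<Rightarrow> complex) \<Rightarrow> complex \<Rightarrow> bool" where
  "has_log_singularity y z0 \<longleftrightarrow>
     (\<exists>\<epsilon>>0. \<exists>a g h. g holomorphic_on ball z0 \<epsilon> \<and> h holomorphic_on ball z0 \<epsilon> \<and>
        (\<exists>z\<in>ball z0 \<epsilon>. h z \<noteq> 0) \<and>
        (\<forall>z\<in>slit_disc z0 \<epsilon>. y z = (z - z0) powr a * (g z + h z * Ln (z - z0))))"

text \<open>\<open>k\<close> stands for \<open>2 \<kappa>\<close>, a nonnegative integer that may vary from pole to pole. Solutions
  matter only as germs at \<open>z0\<close>, so \<open>\<epsilon>\<close> need not be bounded above.\<close>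

definition apparent :: "(complex \<Rightarrow> complex) \<Rightarrow> bool" where
  "apparent Q \<longleftrightarrow> Q meromorphic_on upper_half_plane \<and>
     (\<forall>z0\<in>upper_half_plane. is_pole Q z0 \<longrightarrow>
        (\<exists>k::nat. has_local_exponents Q z0 (1/2 + of_nat k / 2) (1/2 - of_nat k / 2)) \<and>
        (\<forall>\<epsilon>>0. \<forall>y. solves_on Q y (slit_disc z0 \<epsilon>) \<longrightarrow> \<not> has_log_singularity y z0))"

end

theory Submission
  imports Defs
begin

text \<open>Near a zero \<open>z0\<close> of \<open>E4\<close>, write a solution as \<open>y = E4\<^sup>\<alpha> \<Delta>\<^sup>\<gamma> \<phi>(J)\<close> with
  \<open>\<Delta> = E4\<^sup>3 - E6\<^sup>2\<close>, \<open>J = E4\<^sup>3 / \<Delta>\<close>, \<open>\<alpha> = (1 \<plusminus> n) / 2\<close> and \<open>4 \<alpha> + 12 \<gamma> = - 1\<close>. By Ramanujan's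
  differential equations for \<open>E2, E4, E6\<close>, which follow from an elementary identity of Liouville
  on the solutions of \<open>a x + b y = n\<close>, the equation for \<open>\<phi>\<close> is hypergeometric, with a two-term
  recursion \<open>b\<^sub>k\<^sub>+\<^sub>1 = b\<^sub>k N\<^sub>k / d\<^sub>k\<close> for the coefficients. For the lower exponent \<open>d\<^sub>k\<close> vanishes only
  if \<open>n = 3 (k + 1)\<close>. Otherwise there is a solution \<open>w\<^sup>\<alpha> g\<close> with \<open>g\<close> holomorphic, \<open>w = z - z0\<close>, and by
  reduction of order all solutions have this form. If \<open>n = 3 m\<close>, the same happens iff \<open>N\<^sub>k = 0\<close>
  for some \<open>k < m\<close>, and \<open>4 N\<^sub>k = (2 k + 1/2 - m)\<^sup>2 + (r + s)\<close>.\<close>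

section \<open>Liouville's identity and convolutions of divisor sums\<close>

text \<open>Solutions of \<open>y'' = Q1 y\<close> behave formally like objects of weight -1, hence
  the constraint \<open>4 \<alpha> + 12 \<gamma> = - 1\<close>. The two exponents at
  \<open>z0\<close> differ by \<open>n\<close>, so in the coordinate \<open>w\<close> a resonance is
  to be expected for every \<open>n\<close>. But zeros of \<open>E4\<close> are simple,
  \<open>J\<close> vanishes there to order 3, and in the variable \<open>J\<close> the exponents
  differ by \<open>n / 3\<close>: a resonance is met only if this is an integer. That is the source
  of the dichotomy. All facts about Eisenstein series are drawn from q-expansions: Ramanujan's
  equations are coefficient identities, \<open>Delta\<close> has no zero because of its first-order
  equation, and both together make the zeros of \<open>E4\<close> simple. A zero of
  \<open>E4\<close> has to be exhibited, since otherwise apparentness would hold vacuously and no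
  condition on \<open>r\<close> could be extracted. A logarithmic singularity is defined by the
  existence of some representation, so excluding it means comparing representations with unrelated
  exponents; this is the purpose of the monodromy argument.\<close>

definition quadruples :: "nat \<Rightarrow> (nat \<times> nat \<times> nat \<times> nat) set" where
  "quadruples n = {(a, b, x, y). a > 0 \<and> b > 0 \<and> x > 0 \<and> y > 0 \<and> a * x + b * y = n}"

lemma finite_quadruples: "finite (quadruples n)"
proof (rule finite_subset)
  show "quadruples n \<subseteq> {..n} \<times> {..n} \<times> {..n} \<times> {..n}"
  proof
    fix p assume "p \<in> quadruples n"
    then obtain a b x y where p: "p = (a, b, x, y)"
      and *: "a > 0" "b > 0" "x > 0" "y > 0" "a * x + b * y = n"
      by (auto simp: quadruples_def)
    then have "a * 1 \<le> a * x" "1 * x \<le> a * x" "b * 1 \<le> b * y" "1 * y \<le> b * y"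
      by (intro mult_le_mono; simp)+
    with *(5) have "a \<le> n" "b \<le> n" "x \<le> n" "y \<le> n"
      by linarith+
    then show "p \<in> {..n} \<times> {..n} \<times> {..n} \<times> {..n}"
      by (simp add: p)
  qed
qed auto

text \<open>Interchanging the two products folds \<open>y < x\<close> onto \<open>x < y\<close>.
  Applied to both sums of Liouville's identity, it leaves off-diagonal parts that the involution
  equates, so only the diagonal \<open>x = y\<close> survives.\<close>

lemma quadruples_split_sum:
  fixes F :: "nat \<Rightarrow> nat \<Rightarrow> nat \<Rightarrow> nat \<Rightarrow> 'a :: comm_ring_1"
  assumes "\<And>a b x y. F a b x y = F b a y x"
  shows "(\<Sum>(a, b, x, y)\<in>quadruples n. F a b x y) =
    2 * (\<Sum>(a, b, x, y)\<in>{(a, b, x, y)\<in>quadruples n. x < y}. F a b x y) +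
    (\<Sum>(a, b, x, y)\<in>{(a, b, x, y)\<in>quadruples n. x = y}. F a b x y)"
proof -
  let ?S = "quadruples n"
  let ?F = "\<lambda>(a, b, x, y). F a b x y"
  have swap: "sum ?F {(a, b, x, y)\<in>?S. y < x} = sum ?F {(a, b, x, y)\<in>?S. x < y}"
    by (rule sum.reindex_bij_witness[of _ "\<lambda>(a, b, x, y). (b, a, y, x)" "\<lambda>(a, b, x, y). (b, a, y, x)"])
      (auto simp: quadruples_def assms add.commute)
  have "?S = ({(a, b, x, y)\<in>?S. x < y} \<union> {(a, b, x, y)\<in>?S. y < x}) \<union> {(a, b, x, y)\<in>?S. x = y}"
    by auto
  then have "sum ?F ?S = sum ?F (({(a, b, x, y)\<in>?S. x < y} \<union> {(a, b, x, y)\<in>?S. y < x}) \<union> {(a, b, x, y)\<in>?S. x = y})"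
    by simp
  also have "\<dots> = sum ?F ({(a, b, x, y)\<in>?S. x < y} \<union> {(a, b, x, y)\<in>?S. y < x}) + sum ?F {(a, b, x, y)\<in>?S. x = y}"
    by (rule sum.union_disjoint) (auto intro: finite_subset[OF _ finite_quadruples])
  also have "sum ?F ({(a, b, x, y)\<in>?S. x < y} \<union> {(a, b, x, y)\<in>?S. y < x}) =
      sum ?F {(a, b, x, y)\<in>?S. x < y} + sum ?F {(a, b, x, y)\<in>?S. y < x}"
    by (rule sum.union_disjoint) (auto intro: finite_subset[OF _ finite_quadruples])
  finally show ?thesis by (simp add: swap)
qed

text \<open>The identity \<open>a x + b y = (y - x) b + x (a + b)\<close> gives an involution of the quadruples
  with \<open>x < y\<close>, which exchanges \<open>{a, b}\<close> and \<open>{x, y - x}\<close>. The hypotheses say that \<open>f x y\<close> is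
  an even symmetric function of the triple \<open>(x, y, - x - y)\<close>.\<close>
lemma liouville_identity:
  fixes f :: "int \<Rightarrow> int \<Rightarrow> 'a :: comm_ring_1"
  assumes sym: "\<And>x y. f x y = f y x"
    and even: "\<And>x y. f (- x) (- y) = f x y"
    and refl: "\<And>x y. f x (y - x) = f (- x) y"
  shows "(\<Sum>(a, b, x, y)\<in>quadruples n. f (int a) (int b) - f (- int a) (int b)) =
    (\<Sum>(a, b, x, y)\<in>{(a, b, x, y)\<in>quadruples n. x = y}. f (int a) (int b) - f (- int x) (int y))"
proof -
  let ?S = "quadruples n"
  have flip: "f (- x) y = f (- y) x" for x y
    using even[of x "- y"] sym by simp
  \<comment> \<open>Each product may be read backwards, so \<open>(a, b)\<close> and
    \<open>(x, y)\<close> can trade places; this moves the reflected term into the variables on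
    which the involution acts.\<close>
  have transpose: "(\<Sum>(a, b, x, y)\<in>?S. f (- int a) (int b)) = (\<Sum>(a, b, x, y)\<in>?S. f (- int x) (int y))"
    by (rule sum.reindex_bij_witness[of _ "\<lambda>(a, b, x, y). (x, y, a, b)" "\<lambda>(a, b, x, y). (x, y, a, b)"])
      (auto simp: quadruples_def mult.commute)
  have involution: "(\<Sum>(a, b, x, y)\<in>{(a, b, x, y)\<in>?S. x < y}. f (int a) (int b)) =
      (\<Sum>(a, b, x, y)\<in>{(a, b, x, y)\<in>?S. x < y}. f (- int x) (int y))"
  proof -
    have mem: "(y - x, x, b, a + b) \<in> ?S" "a > 0"
      if "(a, b, x, y) \<in> ?S" "x < y" for a b x y
    proof -
      obtain d where "y = x + d" using \<open>x < y\<close> less_imp_add_positive by blast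
      with that show "(y - x, x, b, a + b) \<in> ?S" "a > 0"
        by (auto simp: quadruples_def algebra_simps)
    qed
    have "f (- int b) (int (a + b)) = f (int a) (int b)" for a b
      using refl[of "int b" "int a + int b"] sym by simp
    then show ?thesis
      by (intro sum.reindex_bij_witness[of _ "\<lambda>(a, b, x, y). (y - x, x, b, a + b)"
            "\<lambda>(a, b, x, y). (y - x, x, b, a + b)"]) (auto simp: mem simp del: of_nat_add)
  qed
  have "(\<Sum>(a, b, x, y)\<in>?S. f (int a) (int b)) =
      2 * (\<Sum>(a, b, x, y)\<in>{(a, b, x, y)\<in>?S. x < y}. f (int a) (int b)) +
      (\<Sum>(a, b, x, y)\<in>{(a, b, x, y)\<in>?S. x = y}. f (int a) (int b))"
    by (rule quadruples_split_sum) (rule sym)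
  moreover have "(\<Sum>(a, b, x, y)\<in>?S. f (- int x) (int y)) =
      2 * (\<Sum>(a, b, x, y)\<in>{(a, b, x, y)\<in>?S. x < y}. f (- int x) (int y)) +
      (\<Sum>(a, b, x, y)\<in>{(a, b, x, y)\<in>?S. x = y}. f (- int x) (int y))"
    by (rule quadruples_split_sum) (rule flip)
  ultimately show ?thesis
    using transpose involution by (simp add: sum_subtractf case_prod_unfold)
qed

section \<open>Divisor power sums and their convolutions\<close>

definition sigma :: "nat \<Rightarrow> nat \<Rightarrow> complex" where
  "sigma k n = (\<Sum>d | d dvd n. of_nat d ^ k)"

text \<open>Group the quadruples by \<open>i = a * x\<close>: then \<open>a\<close> runs over the
  divisors of \<open>i\<close>, \<open>b\<close> over those of \<open>n - i\<close>, and
  \<open>x\<close>, \<open>y\<close> are the cofactors.\<close>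

lemma quadruples_convolution:
  "(\<Sum>(a, b, x, y)\<in>quadruples n. of_nat a ^ j * of_nat b ^ k) =
    (\<Sum>i\<in>{0<..<n}. sigma j i * sigma k (n - i))"
proof -
  have "(\<Sum>i\<in>{0<..<n}. sigma j i * sigma k (n - i)) =
      (\<Sum>i\<in>{0<..<n}. \<Sum>(a, b)\<in>{a. a dvd i} \<times> {b. b dvd n - i}. of_nat a ^ j * of_nat b ^ k)"
    by (simp add: sigma_def sum_product sum.cartesian_product)
  also have "\<dots> = (\<Sum>(i, a, b)\<in>(SIGMA i:{0<..<n}. {a. a dvd i} \<times> {b. b dvd n - i}). of_nat a ^ j * of_nat b ^ k)"
    by (subst sum.Sigma) (auto simp: split_def)
  also have "\<dots> = (\<Sum>(a, b, x, y)\<in>quadruples n. of_nat a ^ j * of_nat b ^ k)"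
  proof (rule sum.reindex_bij_witness[of _ "\<lambda>(a, b, x, y). (a * x, a, b)"
        "\<lambda>(i, a, b). (a, b, i div a, (n - i) div b)"]; clarify)
    fix i a b assume *: "i \<in> {0<..<n}" "a dvd i" "b dvd n - i"
    then have "0 < i" "0 < n - i" by auto
    with * have "0 < a" "0 < b" by (blast intro: dvd_pos_nat)+
    with * \<open>0 < i\<close> show "(a, b, i div a, (n - i) div b) \<in> quadruples n"
      by (auto simp: quadruples_def dvd_imp_le div_greater_zero_iff)
  qed (auto simp: quadruples_def)
  finally show ?thesis by simp
qed

text \<open>On the diagonal the equation reads \<open>(a + b) * x = n\<close>, so
  \<open>d = a + b\<close> is a divisor of \<open>n\<close> and \<open>x\<close> its
  cofactor.\<close>

lemma quadruples_diagonal: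
  fixes g :: "nat \<Rightarrow> nat \<Rightarrow> nat \<Rightarrow> complex"
  assumes "n > 0"
  shows "(\<Sum>(a, b, x, y)\<in>{(a, b, x, y)\<in>quadruples n. x = y}. g a b x) =
    (\<Sum>d | d dvd n. \<Sum>a\<in>{0<..<d}. g a (d - a) (n div d))"
proof -
  have "(\<Sum>d | d dvd n. \<Sum>a\<in>{0<..<d}. g a (d - a) (n div d)) =
      (\<Sum>(d, a)\<in>(SIGMA d:{d. d dvd n}. {0<..<d}). g a (d - a) (n div d))"
    using assms by (subst sum.Sigma) (auto simp: split_def)
  also have "\<dots> = (\<Sum>(a, b, x, y)\<in>{(a, b, x, y)\<in>quadruples n. x = y}. g a b x)"
    using assms
    by (intro sum.reindex_bij_witness[of _ "\<lambda>(a, b, x, y). (a + b, a)"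
          "\<lambda>(d, a). (a, d - a, n div d, n div d)"])
      (auto simp: quadruples_def add_mult_distrib[symmetric] elim!: dvdE)
  finally show ?thesis by simp
qed

text \<open>On the diagonal the term \<open>f (- x) y\<close> depends only on the cofactor
  \<open>n div d\<close>, so it is counted once for each of the \<open>d - 1\<close> ways to write
  \<open>d = a + b\<close>.\<close>

lemma liouville_identity_divisors:
  fixes f :: "int \<Rightarrow> int \<Rightarrow> complex"
  assumes "\<And>x y. f x y = f y x" "\<And>x y. f (- x) (- y) = f x y" "\<And>x y. f x (y - x) = f (- x) y"
    and "n > 0"
  shows "(\<Sum>(a, b, x, y)\<in>quadruples n. f (int a) (int b) - f (- int a) (int b)) =
    (\<Sum>d | d dvd n. (\<Sum>a\<in>{0<..<d}. f (int a) (int d - int a)) - of_nat (d - 1) * f (- int (n div d)) (int (n div d)))"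
proof -
  have "(\<Sum>(a, b, x, y)\<in>{(a, b, x, y)\<in>quadruples n. x = y}. f (int a) (int b) - f (- int x) (int y)) =
    (\<Sum>(a, b, x, y)\<in>{(a, b, x, y)\<in>quadruples n. x = y}. f (int a) (int b) - f (- int x) (int x))"
    by (rule sum.cong) auto
  also have "\<dots> = (\<Sum>d | d dvd n. \<Sum>a\<in>{0<..<d}. f (int a) (int (d - a)) - f (- int (n div d)) (int (n div d)))"
    by (rule quadruples_diagonal) fact
  also have "\<dots> = (\<Sum>d | d dvd n. (\<Sum>a\<in>{0<..<d}. f (int a) (int d - int a)) - of_nat (d - 1) * f (- int (n div d)) (int (n div d)))"
    by (intro sum.cong refl) (auto simp: sum_subtractf of_nat_diff intro!: sum.cong)
  finally show ?thesis
    using liouville_identity[of f n] assms by simp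
qed

lemma sum_dvd_power_reflect:
  assumes "n > 0"
  shows "(\<Sum>d | d dvd n. of_nat (n div d) ^ k) = sigma k n"
  unfolding sigma_def using assms
  by (intro sum.reindex_bij_witness[of _ "\<lambda>d. n div d" "\<lambda>d. n div d"]) (auto elim!: dvdE)

text \<open>Since \<open>d * (n div d) = n\<close>, one power of the cofactor turns into the factor
  \<open>n\<close>. These are the terms that later become derivatives with respect to
  \<open>log q\<close>.\<close>

lemma sum_dvd_power_reflect_Suc:
  assumes "n > 0"
  shows "(\<Sum>d | d dvd n. of_nat d * of_nat (n div d) ^ Suc k) = of_nat n * sigma k n"
proof -
  have "of_nat d * of_nat (n div d) ^ Suc k = (of_nat n * of_nat (n div d) ^ k :: complex)" if "d dvd n" for d
  proof -
    have "of_nat d * of_nat (n div d) = (of_nat n :: complex)"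
      using that by (metis dvd_mult_div_cancel of_nat_mult)
    then show ?thesis by (metis mult.assoc power_Suc)
  qed
  then show ?thesis
    using sum_dvd_power_reflect[OF assms, of k] by (simp add: sum_distrib_left[symmetric] del: power_Suc)
qed

text \<open>Faulhaber's formulas. In the last sum the summand depends on \<open>d\<close>, so it is
  expanded into power sums instead of being treated by induction; only two terms survive because
  \<open>x^2 (d - x)^2\<close> vanishes doubly at both ends.\<close>

lemma sum_power_below:
  fixes d :: nat
  assumes "d > 0"
  shows "(\<Sum>a\<in>{0<..<d}. (of_nat a :: complex) ^ 2) = of_nat d ^ 3 / 3 - of_nat d ^ 2 / 2 + of_nat d / 6"
    and "(\<Sum>a\<in>{0<..<d}. (of_nat a :: complex) ^ 4) =
      of_nat d ^ 5 / 5 - of_nat d ^ 4 / 2 + of_nat d ^ 3 / 3 - of_nat d / 30"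
    and "(\<Sum>a\<in>{0<..<d}. (of_nat a :: complex) ^ 6) =
      of_nat d ^ 7 / 7 - of_nat d ^ 6 / 2 + of_nat d ^ 5 / 2 - of_nat d ^ 3 / 6 + of_nat d / 42"
    and "(\<Sum>a\<in>{0<..<d}. (of_nat a :: complex) ^ 2 * (of_nat d - of_nat a) ^ 2) =
      (of_nat d ^ 5 - of_nat d) / 30"
proof -
  have step: "{0<..<Suc d} = insert d {0<..<d}" if "d > 0" for d :: nat
    using that by auto
  show 2: "(\<Sum>a\<in>{0<..<d}. (of_nat a :: complex) ^ 2) = of_nat d ^ 3 / 3 - of_nat d ^ 2 / 2 + of_nat d / 6"
    using assms by (induction rule: nat_induct_non_zero) (simp_all add: step field_simps, algebra?)
  show 4: "(\<Sum>a\<in>{0<..<d}. (of_nat a :: complex) ^ 4) =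
      of_nat d ^ 5 / 5 - of_nat d ^ 4 / 2 + of_nat d ^ 3 / 3 - of_nat d / 30"
    using assms by (induction rule: nat_induct_non_zero) (simp_all add: step field_simps, algebra?)
  show "(\<Sum>a\<in>{0<..<d}. (of_nat a :: complex) ^ 6) =
      of_nat d ^ 7 / 7 - of_nat d ^ 6 / 2 + of_nat d ^ 5 / 2 - of_nat d ^ 3 / 6 + of_nat d / 42"
    using assms by (induction rule: nat_induct_non_zero) (simp_all add: step field_simps, algebra?)
  have 3: "(\<Sum>a\<in>{0<..<d}. (of_nat a :: complex) ^ 3) =
      of_nat d ^ 4 / 4 - of_nat d ^ 3 / 2 + of_nat d ^ 2 / 4"
    using assms by (induction rule: nat_induct_non_zero) (simp_all add: step field_simps, algebra?)
  have "(of_nat a :: complex) ^ 2 * (of_nat d - of_nat a) ^ 2 =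
      of_nat d ^ 2 * of_nat a ^ 2 - 2 * of_nat d * of_nat a ^ 3 + of_nat a ^ 4" for a
    by algebra
  then show "(\<Sum>a\<in>{0<..<d}. (of_nat a :: complex) ^ 2 * (of_nat d - of_nat a) ^ 2) =
      (of_nat d ^ 5 - of_nat d) / 30"
    by (simp add: sum.distrib sum_subtractf sum_distrib_left[symmetric] 2 3 4)
      (simp add: field_simps power_numeral_reduce)
qed

lemma of_nat_sum_reflect:
  "(\<Sum>a\<in>{0<..<d}. F (of_nat d - of_nat a :: complex)) = (\<Sum>a\<in>{0<..<d}. F (of_nat a))"
  by (rule sum.reindex_bij_witness[of _ "\<lambda>a. d - a" "\<lambda>a. d - a"]) (auto simp: of_nat_diff)

text \<open>Liouville's identity for the k-th power sum of the triple
  \<open>(x, y, - x - y)\<close>, with \<open>k\<close> even. The left side contains only odd powers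
  of \<open>a\<close> and of \<open>b\<close>, hence only convolutions of \<open>sigma\<close> with
  odd index.\<close>

lemma sigma_convolution_power:
  assumes "n > 0" "even k" "k > 0"
  shows "(\<Sum>(a, b, x, y)\<in>quadruples n. (of_nat a + of_nat b) ^ k - (of_nat a - of_nat b) ^ k) =
    (\<Sum>d | d dvd n. 2 * (\<Sum>a\<in>{0<..<d}. (of_nat a :: complex) ^ k) + (of_nat d - 1) * of_nat d ^ k) -
    2 * (of_nat n * sigma (k - 1) n - sigma k n)"
proof -
  define f :: "int \<Rightarrow> int \<Rightarrow> complex" where
    "f = (\<lambda>x y. of_int x ^ k + of_int y ^ k + (of_int x + of_int y) ^ k)"
  have f: "f x y = f y x" "f (- x) (- y) = f x y" "f x (y - x) = f (- x) y" for x y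
  proof -
    have "(- of_int x - of_int y :: complex) = - (of_int x + of_int y)" by simp
    then show "f (- x) (- y) = f x y"
      unfolding f_def of_int_minus by (simp only: power_minus_even[OF \<open>even k\<close>] diff_conv_add_uminus)
    have "(of_int y - of_int x :: complex) = - of_int x + of_int y" by simp
    then show "f x (y - x) = f (- x) y"
      using \<open>even k\<close> by (simp add: f_def)
  qed (simp add: f_def add_ac)
  have d: "(\<Sum>a\<in>{0<..<d}. f (int a) (int d - int a)) - of_nat (d - 1) * f (- int e) (int e) =
      2 * (\<Sum>a\<in>{0<..<d}. (of_nat a :: complex) ^ k) + (of_nat d - 1) * of_nat d ^ k
      - 2 * (of_nat d * of_nat e ^ Suc (k - 1)) + 2 * of_nat e ^ k" if "d > 0" for d e
  proof -
    have s1: "(\<Sum>a\<in>{0<..<d}. f (int a) (int d - int a)) =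
        2 * (\<Sum>a\<in>{0<..<d}. (of_nat a :: complex) ^ k) + of_nat (d - 1) * of_nat d ^ k"
      by (simp add: f_def sum.distrib of_nat_sum_reflect[of "\<lambda>x. x ^ k"])
    have s2: "(of_nat (d - 1) :: complex) = of_nat d - 1"
      using that by (simp add: of_nat_diff)
    have s3: "f (- int e) (int e) = 2 * of_nat e ^ k"
      using assms by (simp add: f_def)
    have s4: "Suc (k - 1) = k" using assms by simp
    show ?thesis unfolding s1 s2 s3 s4 by (simp add: algebra_simps)
  qed
  have "f (int a) (int b) - f (- int a) (int b) = (of_nat a + of_nat b) ^ k - (of_nat a - of_nat b) ^ k" for a b
  proof -
    have "(- of_nat a + of_nat b :: complex) = - (of_nat a - of_nat b)" by simp
    then show ?thesis
      using \<open>even k\<close> by (simp only: f_def of_int_minus power_minus_even of_int_of_nat_eq) simp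
  qed
  then have "(\<Sum>(a, b, x, y)\<in>quadruples n. (of_nat a + of_nat b) ^ k - (of_nat a - of_nat b) ^ k) =
      (\<Sum>(a, b, x, y)\<in>quadruples n. f (int a) (int b) - f (- int a) (int b))"
    by simp
  also have "\<dots> = (\<Sum>d | d dvd n. (\<Sum>a\<in>{0<..<d}. f (int a) (int d - int a)) - of_nat (d - 1) * f (- int (n div d)) (int (n div d)))"
    by (rule liouville_identity_divisors[OF f \<open>n > 0\<close>])
  also have "\<dots> = (\<Sum>d | d dvd n. 2 * (\<Sum>a\<in>{0<..<d}. (of_nat a :: complex) ^ k) + (of_nat d - 1) * of_nat d ^ k
      - 2 * (of_nat d * of_nat (n div d) ^ Suc (k - 1)) + 2 * of_nat (n div d) ^ k)"
    using \<open>n > 0\<close> by (intro sum.cong refl d) (auto intro: dvd_pos_nat)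
  also have "\<dots> = (\<Sum>d | d dvd n. 2 * (\<Sum>a\<in>{0<..<d}. (of_nat a :: complex) ^ k) + (of_nat d - 1) * of_nat d ^ k)
      - 2 * (\<Sum>d | d dvd n. of_nat d * of_nat (n div d) ^ Suc (k - 1)) + 2 * (\<Sum>d | d dvd n. of_nat (n div d) ^ k)"
    by (simp only: sum.distrib sum_subtractf sum_distrib_left)
  also have "\<dots> = (\<Sum>d | d dvd n. 2 * (\<Sum>a\<in>{0<..<d}. (of_nat a :: complex) ^ k) + (of_nat d - 1) * of_nat d ^ k) -
    2 * (of_nat n * sigma (k - 1) n - sigma k n)"
    unfolding sum_dvd_power_reflect[OF \<open>n > 0\<close>] sum_dvd_power_reflect_Suc[OF \<open>n > 0\<close>]
    by (simp add: algebra_simps)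
  finally show ?thesis .
qed

definition conv :: "nat \<Rightarrow> nat \<Rightarrow> nat \<Rightarrow> complex" where
  "conv j k n = (\<Sum>i\<in>{0<..<n}. sigma j i * sigma k (n - i))"

lemma conv_commute: "conv j k n = conv k j n"
  unfolding conv_def
  by (rule sum.reindex_bij_witness[of _ "\<lambda>i. n - i" "\<lambda>i. n - i"]) (auto simp: mult.commute)

lemma conv_eq_quadruples:
  "(\<Sum>(a, b, x, y)\<in>quadruples n. of_nat a ^ j * of_nat b ^ k) = conv j k n"
  by (simp add: conv_def quadruples_convolution)

text \<open>Exponent 2, where the difference of squares is \<open>4 a b\<close>. The term
  \<open>- 2 d^2\<close> from the power sums is cancelled by \<open>2 * sigma 2 n\<close> from the
  cofactors; the even-index sums disappear in the same way for exponents 4 and 6.\<close>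

lemma conv_1_1:
  assumes "n > 0"
  shows "12 * conv 1 1 n = 5 * sigma 3 n + sigma 1 n - 6 * of_nat n * sigma 1 n"
proof -
  have "4 * conv 1 1 n = (\<Sum>(a, b, x, y)\<in>quadruples n. (of_nat a + of_nat b) ^ 2 - (of_nat a - of_nat b) ^ 2)"
    unfolding conv_eq_quadruples[symmetric] sum_distrib_left
    by (intro sum.cong refl) (auto, algebra)
  also have "\<dots> = (\<Sum>d | d dvd n. 5 / 3 * of_nat d ^ 3 - 2 * of_nat d ^ 2 + 1 / 3 * of_nat d ^ 1) -
      2 * (of_nat n * sigma 1 n - sigma 2 n)"
    unfolding sigma_convolution_power[OF assms, of 2, simplified]
  proof (intro arg_cong2[of _ _ _ _ "(-)"] sum.cong refl, unfold mem_Collect_eq)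
    fix d assume "d dvd n"
    then have "d > 0" using assms by (auto intro: dvd_pos_nat)
    then show "2 * (\<Sum>a\<in>{0<..<d}. (of_nat a :: complex) ^ 2) + (of_nat d - 1) * of_nat d ^ 2 =
      5 / 3 * of_nat d ^ 3 - 2 * of_nat d ^ 2 + 1 / 3 * of_nat d ^ 1"
      by (simp only: sum_power_below) (simp add: field_simps power_numeral_reduce)
  qed (simp_all add: algebra_simps)
  also have "\<dots> = 5 / 3 * sigma 3 n - 2 * sigma 2 n + 1 / 3 * sigma 1 n - 2 * (of_nat n * sigma 1 n - sigma 2 n)"
    by (simp only: sigma_def sum.distrib sum_subtractf sum_distrib_left)
  finally show ?thesis by (simp add: field_simps)
qed

text \<open>Liouville's identity for the squared product of the triple
  \<open>(x, y, - x - y)\<close>. It vanishes at \<open>(- x, x)\<close>, so no cofactor term and no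
  factor \<open>n\<close> appears. In terms of Eisenstein series this is
  \<open>E4^2 = E8\<close>.\<close>

lemma conv_3_3:
  assumes "n > 0"
  shows "120 * conv 3 3 n = sigma 7 n - sigma 3 n"
proof -
  define f :: "int \<Rightarrow> int \<Rightarrow> complex" where
    "f = (\<lambda>x y. of_int x ^ 2 * of_int y ^ 2 * (of_int x + of_int y) ^ 2)"
  have f: "f x y = f y x" "f (- x) (- y) = f x y" "f x (y - x) = f (- x) y" for x y
    unfolding f_def of_int_minus of_int_diff by algebra+
  have "4 * conv 3 3 n = (\<Sum>(a, b, x, y)\<in>quadruples n. f (int a) (int b) - f (- int a) (int b))"
    unfolding conv_eq_quadruples[symmetric] sum_distrib_left f_def
    by (intro sum.cong refl) (auto, algebra)
  also have "\<dots> = (\<Sum>d | d dvd n. 1 / 30 * of_nat d ^ 7 - 1 / 30 * of_nat d ^ 3)"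
    unfolding liouville_identity_divisors[OF f assms]
  proof (intro sum.cong refl, clarify)
    fix d assume "d dvd n"
    then have "d > 0" using assms by (auto intro: dvd_pos_nat)
    then show "(\<Sum>a\<in>{0<..<d}. f (int a) (int d - int a)) - of_nat (d - 1) * f (- int (n div d)) (int (n div d)) =
      1 / 30 * of_nat d ^ 7 - 1 / 30 * of_nat d ^ 3"
    proof -
      have "(\<Sum>a\<in>{0<..<d}. f (int a) (int d - int a)) =
          of_nat d ^ 2 * (\<Sum>a\<in>{0<..<d}. (of_nat a :: complex) ^ 2 * (of_nat d - of_nat a) ^ 2)"
        by (simp add: f_def sum_distrib_left mult_ac)
      then show ?thesis
        unfolding sum_power_below(4)[OF \<open>d > 0\<close>]
        by (simp add: f_def field_simps power_numeral_reduce)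
    qed
  qed
  also have "\<dots> = 1 / 30 * sigma 7 n - 1 / 30 * sigma 3 n"
    by (simp only: sigma_def sum.distrib sum_subtractf sum_distrib_left)
  finally show ?thesis by (simp add: field_simps)
qed

lemma conv_1_3:
  assumes "n > 0"
  shows "240 * conv 1 3 n = 21 * sigma 5 n + 10 * sigma 3 n - 30 * of_nat n * sigma 3 n - sigma 1 n"
proof -
  have "8 * conv 1 3 n + 8 * conv 3 1 n =
      (\<Sum>(a, b, x, y)\<in>quadruples n. (of_nat a + of_nat b) ^ 4 - (of_nat a - of_nat b) ^ 4)"
    unfolding conv_eq_quadruples[symmetric] sum_distrib_left sum.distrib[symmetric]
    by (intro sum.cong refl) (auto, algebra)
  also have "\<dots> = (\<Sum>d | d dvd n. 7 / 5 * of_nat d ^ 5 - 2 * of_nat d ^ 4 + 2 / 3 * of_nat d ^ 3 - 1 / 15 * of_nat d ^ 1) -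
      2 * (of_nat n * sigma 3 n - sigma 4 n)"
    unfolding sigma_convolution_power[OF assms, of 4, simplified]
  proof (intro arg_cong2[of _ _ _ _ "(-)"] sum.cong refl, unfold mem_Collect_eq)
    fix d assume "d dvd n"
    then have "d > 0" using assms by (auto intro: dvd_pos_nat)
    then show "2 * (\<Sum>a\<in>{0<..<d}. (of_nat a :: complex) ^ 4) + (of_nat d - 1) * of_nat d ^ 4 =
      7 / 5 * of_nat d ^ 5 - 2 * of_nat d ^ 4 + 2 / 3 * of_nat d ^ 3 - 1 / 15 * of_nat d ^ 1"
      by (simp only: sum_power_below) (simp add: field_simps power_numeral_reduce)
  qed (simp_all add: algebra_simps)
  also have "\<dots> = 7 / 5 * sigma 5 n - 2 * sigma 4 n + 2 / 3 * sigma 3 n - 1 / 15 * sigma 1 n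
      - 2 * (of_nat n * sigma 3 n - sigma 4 n)"
    by (simp only: sigma_def sum.distrib sum_subtractf sum_distrib_left)
  finally have *: "8 * conv 1 3 n + 8 * conv 3 1 n = \<dots>" .
  have **: "240 * conv 1 3 n = 15 * (8 * conv 1 3 n + 8 * conv 3 1 n)"
    by (simp add: conv_commute[of 3])
  show ?thesis unfolding ** * by (simp add: field_simps)
qed

text \<open>Exponent 6 yields \<open>12 a^5 b + 40 a^3 b^3 + 12 a b^5\<close>; the middle
  convolution is eliminated with \<open>conv_3_3\<close>.\<close>

lemma conv_1_5:
  assumes "n > 0"
  shows "504 * conv 1 5 n = 20 * sigma 7 n + 21 * sigma 5 n - 42 * of_nat n * sigma 5 n + sigma 1 n"
proof -
  have "12 * conv 1 5 n + 12 * conv 5 1 n + 40 * conv 3 3 n =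
      (\<Sum>(a, b, x, y)\<in>quadruples n. (of_nat a + of_nat b) ^ 6 - (of_nat a - of_nat b) ^ 6)"
    unfolding conv_eq_quadruples[symmetric] sum_distrib_left sum.distrib[symmetric]
    by (intro sum.cong refl) (auto, algebra)
  also have "\<dots> = (\<Sum>d | d dvd n. 9 / 7 * of_nat d ^ 7 - 2 * of_nat d ^ 6 + of_nat d ^ 5 - 1 / 3 * of_nat d ^ 3 + 1 / 21 * of_nat d ^ 1) -
      2 * (of_nat n * sigma 5 n - sigma 6 n)"
    unfolding sigma_convolution_power[OF assms, of 6, simplified]
  proof (intro arg_cong2[of _ _ _ _ "(-)"] sum.cong refl, unfold mem_Collect_eq)
    fix d assume "d dvd n"
    then have "d > 0" using assms by (auto intro: dvd_pos_nat)
    then show "2 * (\<Sum>a\<in>{0<..<d}. (of_nat a :: complex) ^ 6) + (of_nat d - 1) * of_nat d ^ 6 =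
      9 / 7 * of_nat d ^ 7 - 2 * of_nat d ^ 6 + of_nat d ^ 5 - 1 / 3 * of_nat d ^ 3 + 1 / 21 * of_nat d ^ 1"
      by (simp only: sum_power_below) (simp add: field_simps power_numeral_reduce)
  qed (simp_all add: algebra_simps)
  also have "\<dots> = 9 / 7 * sigma 7 n - 2 * sigma 6 n + sigma 5 n - 1 / 3 * sigma 3 n + 1 / 21 * sigma 1 n
      - 2 * (of_nat n * sigma 5 n - sigma 6 n)"
    by (simp only: sigma_def sum.distrib sum_subtractf sum_distrib_left)
  finally have *: "12 * conv 1 5 n + 12 * conv 5 1 n + 40 * conv 3 3 n = \<dots>" .
  have **: "504 * conv 1 5 n = 21 * (12 * conv 1 5 n + 12 * conv 5 1 n + 40 * conv 3 3 n) - 7 * (120 * conv 3 3 n)"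
    by (simp add: conv_commute[of 5])
  show ?thesis unfolding ** * conv_3_3[OF assms] by (simp add: field_simps)
qed

section \<open>Ramanujan's differential equations\<close>

definition e2 :: "complex fps" where "e2 = Abs_fps (\<lambda>n. if n = 0 then 1 else - 24 * sigma 1 n)"
definition e4 :: "complex fps" where "e4 = Abs_fps (\<lambda>n. if n = 0 then 1 else 240 * sigma 3 n)"
definition e6 :: "complex fps" where "e6 = Abs_fps (\<lambda>n. if n = 0 then 1 else - 504 * sigma 5 n)"

lemma eisenstein_fps_mult:
  fixes c d :: complex
  shows "Abs_fps (\<lambda>n. if n = 0 then 1 else c * sigma j n) * Abs_fps (\<lambda>n. if n = 0 then 1 else d * sigma k n) =
    Abs_fps (\<lambda>n. if n = 0 then 1 else c * sigma j n + d * sigma k n + c * d * conv j k n)"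
proof (rule fps_ext)
  fix n
  show "fps_nth (Abs_fps (\<lambda>n. if n = 0 then 1 else c * sigma j n) * Abs_fps (\<lambda>n. if n = 0 then 1 else d * sigma k n)) n =
    fps_nth (Abs_fps (\<lambda>n. if n = 0 then 1 else c * sigma j n + d * sigma k n + c * d * conv j k n)) n"
  proof (cases "n = 0")
    case False
    then have "{0..n} = insert 0 (insert n {0<..<n})" by auto
    with False show ?thesis
      by (simp add: fps_mult_nth conv_def sum_distrib_left mult_ac)
  qed (simp add: fps_mult_nth)
qed

lemma fps_nth_X_deriv: "fps_nth (fps_X * fps_deriv (f :: complex fps)) n = of_nat n * fps_nth f n"
  by (cases n) simp_all

text \<open>\<open>fps_X * fps_deriv\<close> is \<open>q d/dq\<close>, whose coefficients carry the
  factor \<open>n\<close>; it accounts exactly for the \<open>n * sigma\<close> term of the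
  convolution formula.\<close>

lemma ramanujan_e2: "fps_const 12 * (fps_X * fps_deriv e2) = e2 ^ 2 - e4"
  unfolding power2_eq_square e2_def e4_def eisenstein_fps_mult
proof (rule fps_ext)
  fix n
  show "fps_nth (fps_const 12 * (fps_X * fps_deriv (Abs_fps (\<lambda>n. if n = 0 then 1 else - 24 * sigma 1 n)))) n =
    fps_nth (Abs_fps (\<lambda>n. if n = 0 then 1 else - 24 * sigma 1 n + - 24 * sigma 1 n + - 24 * - 24 * conv 1 1 n) -
      Abs_fps (\<lambda>n. if n = 0 then 1 else 240 * sigma 3 n)) n"
  proof (cases "n = 0")
    case False
    then have "n > 0" by simp
    have "576 * conv 1 1 n = 48 * (5 * sigma 3 n + sigma 1 n - 6 * of_nat n * sigma 1 n)"
      unfolding conv_1_1[OF \<open>n > 0\<close>, symmetric] by simp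
    then show ?thesis
      using False by (simp add: fps_nth_X_deriv algebra_simps del: One_nat_def)
  qed simp
qed

lemma ramanujan_e4: "fps_const 3 * (fps_X * fps_deriv e4) = e2 * e4 - e6"
  unfolding e2_def e4_def e6_def eisenstein_fps_mult
proof (rule fps_ext)
  fix n
  show "fps_nth (fps_const 3 * (fps_X * fps_deriv (Abs_fps (\<lambda>n. if n = 0 then 1 else 240 * sigma 3 n)))) n =
    fps_nth (Abs_fps (\<lambda>n. if n = 0 then 1 else - 24 * sigma 1 n + 240 * sigma 3 n + - 24 * 240 * conv 1 3 n) -
      Abs_fps (\<lambda>n. if n = 0 then 1 else - 504 * sigma 5 n)) n"
  proof (cases "n = 0")
    case False
    then have "n > 0" by simp
    have "5760 * conv 1 3 n = 24 * (21 * sigma 5 n + 10 * sigma 3 n - 30 * of_nat n * sigma 3 n - sigma 1 n)"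
      unfolding conv_1_3[OF \<open>n > 0\<close>, symmetric] by simp
    then show ?thesis
      using False by (simp add: fps_nth_X_deriv algebra_simps del: One_nat_def)
  qed simp
qed

text \<open>Both \<open>e2 * e6\<close> and \<open>e4 ^ 2\<close> contribute
  \<open>480 * sigma 7 n\<close>, through \<open>conv_1_5\<close> and \<open>conv_3_3\<close>, and
  the difference removes it.\<close>

lemma ramanujan_e6: "fps_const 2 * (fps_X * fps_deriv e6) = e2 * e6 - e4 ^ 2"
  unfolding power2_eq_square e2_def e4_def e6_def eisenstein_fps_mult
proof (rule fps_ext)
  fix n
  show "fps_nth (fps_const 2 * (fps_X * fps_deriv (Abs_fps (\<lambda>n. if n = 0 then 1 else - 504 * sigma 5 n)))) n =
    fps_nth (Abs_fps (\<lambda>n. if n = 0 then 1 else - 24 * sigma 1 n + - 504 * sigma 5 n + - 24 * - 504 * conv 1 5 n) -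
      Abs_fps (\<lambda>n. if n = 0 then 1 else 240 * sigma 3 n + 240 * sigma 3 n + 240 * 240 * conv 3 3 n)) n"
  proof (cases "n = 0")
    case False
    then have "n > 0" by simp
    have "12096 * conv 1 5 n = 24 * (20 * sigma 7 n + 21 * sigma 5 n - 42 * of_nat n * sigma 5 n + sigma 1 n)"
      unfolding conv_1_5[OF \<open>n > 0\<close>, symmetric] by simp
    moreover have "57600 * conv 3 3 n = 480 * (sigma 7 n - sigma 3 n)"
      unfolding conv_3_3[OF \<open>n > 0\<close>, symmetric] by simp
    ultimately show ?thesis
      using False by (simp add: fps_nth_X_deriv algebra_simps del: One_nat_def)
  qed simp
qed

section \<open>Eisenstein series on the upper half-plane\<close>

lemma sigma_bound:
  assumes "n > 0" shows "norm (sigma k n) \<le> of_nat n ^ Suc k"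
proof -
  have "norm (sigma k n) \<le> (\<Sum>d | d dvd n. norm (of_nat d ^ k :: complex))"
    unfolding sigma_def by (rule norm_sum)
  also have "\<dots> \<le> (\<Sum>d | d dvd n. of_nat n ^ k)"
    using assms by (intro sum_mono) (auto simp: norm_power intro!: power_mono dvd_imp_le)
  also have "\<dots> \<le> of_nat n * of_nat n ^ k"
  proof -
    have "card {d. d dvd n} \<le> card {1..n}"
      using assms by (intro card_mono) (auto intro: dvd_imp_le dvd_pos_nat simp: Suc_le_eq)
    then show ?thesis by (simp add: mult_right_mono)
  qed
  finally show ?thesis by simp
qed

text \<open>Each power of \<open>n\<close> is one application of \<open>q d/dq\<close> to the
  geometric series, and differentiation does not shrink the radius of convergence.\<close>

lemma fps_conv_radius_power_coeff: "fps_conv_radius (Abs_fps (\<lambda>n. of_nat n ^ k :: complex)) \<ge> 1"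
proof (induction k)
  case 0
  show ?case
    unfolding fps_conv_radius_def
  proof (rule conv_radius_geI_ex)
    fix r :: real assume "0 < r" "ereal r < 1"
    then have "summable (\<lambda>n. complex_of_real r ^ n)"
      by (intro summable_geometric) simp
    with \<open>0 < r\<close> show "\<exists>z. norm z = r \<and> summable (\<lambda>n. fps_nth (Abs_fps (\<lambda>n. of_nat n ^ 0)) n * z ^ n :: complex)"
      by (intro exI[of _ "of_real r"]) simp
  qed
next
  case (Suc k)
  have "Abs_fps (\<lambda>n. of_nat n ^ Suc k :: complex) = fps_X * fps_deriv (Abs_fps (\<lambda>n. of_nat n ^ k))"
  proof (rule fps_ext)
    fix n show "fps_nth (Abs_fps (\<lambda>n. of_nat n ^ Suc k :: complex)) n =
        fps_nth (fps_X * fps_deriv (Abs_fps (\<lambda>n. of_nat n ^ k))) n"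
      by (cases n) simp_all
  qed
  moreover have "min (fps_conv_radius fps_X) (fps_conv_radius (fps_deriv (Abs_fps (\<lambda>n. of_nat n ^ k :: complex)))) \<ge> 1"
    using order.trans[OF Suc fps_conv_radius_deriv] by simp
  ultimately show ?case
    using fps_conv_radius_mult[of fps_X "fps_deriv (Abs_fps (\<lambda>n. of_nat n ^ k :: complex))"]
    by (simp only:) (rule order.trans)
qed

lemma summable_power_times_geometric:
  fixes q :: real
  assumes "0 \<le> q" "q < 1"
  shows "summable (\<lambda>n. of_nat n ^ k * q ^ n)"
proof -
  have "ereal (norm (complex_of_real q)) < 1"
    using assms by simp
  also note fps_conv_radius_power_coeff[of k]
  finally have "summable (\<lambda>n. norm (of_nat n ^ k * complex_of_real q ^ n))"
    using norm_summable_fps[of "complex_of_real q" "Abs_fps (\<lambda>n. of_nat n ^ k)"] by simp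
  moreover have "norm (of_nat n ^ k * complex_of_real q ^ n) = of_nat n ^ k * q ^ n" for n
    using assms by (simp add: norm_mult norm_power)
  ultimately show ?thesis by simp
qed

lemma fps_conv_radius_sigma:
  "fps_conv_radius (Abs_fps (\<lambda>n. if n = 0 then 1 else c * sigma k n)) \<ge> 1"
  unfolding fps_conv_radius_def
proof (rule conv_radius_geI_ex)
  fix r :: real assume r: "0 < r" "ereal r < 1"
  have "summable (\<lambda>n. (if n = 0 then 1 else c * sigma k n) * of_real r ^ n)"
  proof (rule summable_comparison_test_ev)
    show "summable (\<lambda>n. norm c * (of_nat n ^ Suc k * r ^ n))"
      by (rule summable_mult, rule summable_power_times_geometric) (use r in auto)
    show "\<forall>\<^sub>F n in sequentially. norm ((if n = 0 then 1 else c * sigma k n) * of_real r ^ n) \<le> norm c * (of_nat n ^ Suc k * r ^ n)"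
      using eventually_gt_at_top[of 0]
    proof eventually_elim
      case (elim n)
      then have "norm c * (norm (sigma k n) * r ^ n) \<le> norm c * (of_nat n ^ Suc k * r ^ n)"
        using r sigma_bound[OF elim, of k] by (intro mult_left_mono mult_right_mono) auto
      with elim r show ?case by (simp add: norm_mult norm_power mult.assoc del: power_Suc)
    qed
  qed
  with r show "\<exists>z. norm z = r \<and> summable (\<lambda>n. fps_nth (Abs_fps (\<lambda>n. if n = 0 then 1 else c * sigma k n)) n * z ^ n)"
    by (intro exI[of _ "of_real r"]) simp
qed

text \<open>Expand each fraction as a geometric series and regroup the pairs \<open>(m, j)\<close>
  by \<open>n = m * j\<close>. Absolute summability is verified on the divisor side, where the inner
  sums are finite, and carried over by the bijection; this justifies both iterated sums.\<close>

lemma lambert_series: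
  fixes q :: complex
  assumes "norm q < 1"
  shows "(\<Sum>m. of_nat (Suc m) ^ k * q ^ Suc m / (1 - q ^ Suc m)) = (\<Sum>n. sigma k (Suc n) * q ^ Suc n)"
proof -
  define F :: "nat \<times> nat \<Rightarrow> complex" where "F = (\<lambda>(m, j). of_nat m ^ k * q ^ (m * j))"
  define G :: "nat \<times> nat \<Rightarrow> complex" where "G = (\<lambda>(n, d). of_nat d ^ k * q ^ n)"
  let ?D = "SIGMA n:{0<..}. {d::nat. d dvd n}"
  let ?P = "{0<..} \<times> {0<..} :: (nat \<times> nat) set"
  have bij: "bij_betw (\<lambda>(m, j). (m * j, m)) ?P ?D"
  proof (rule bij_betw_imageI)
    show "inj_on (\<lambda>(m, j). (m * j, m)) ?P"
      by (auto simp: inj_on_def)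
    show "(\<lambda>(m, j). (m * j, m)) ` ?P = ?D"
    proof (intro equalityI subsetI)
      fix p assume "p \<in> ?D"
      then obtain m j where "p = (m * j, m)" "m * j > 0"
        by (auto elim!: dvdE)
      then show "p \<in> (\<lambda>(m, j). (m * j, m)) ` ?P"
        by (intro image_eqI[of _ _ "(m, j)"]) auto
    qed auto
  qed
  have sumG: "(\<lambda>p. norm (G p)) summable_on ?D"
    unfolding Infinite_Sum.abs_summable_on_Sigma_iff
  proof (intro conjI ballI)
    fix n :: nat assume "n \<in> {0<..}"
    then show "(\<lambda>d. norm (G (n, d))) summable_on {d. d dvd n}"
      by (intro summable_on_finite) auto
  next
    have "norm (\<Sum>\<^sub>\<infinity>d\<in>{d. d dvd n}. norm (G (n, d))) \<le> real n ^ Suc k * norm q ^ n" if "n > 0" for n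
    proof -
      have "(\<Sum>d | d dvd n. norm (G (n, d))) \<le> (\<Sum>d | d dvd n. real n ^ k * norm q ^ n)"
        unfolding G_def using that
        by (intro sum_mono) (auto simp: norm_mult norm_power intro!: mult_right_mono power_mono dvd_imp_le)
      also have "\<dots> \<le> real n * (real n ^ k * norm q ^ n)"
      proof -
        have "card {d. d dvd n} \<le> card {1..n}"
          using that by (intro card_mono) (auto intro: dvd_imp_le dvd_pos_nat simp: Suc_le_eq)
        then show ?thesis by (simp add: mult_right_mono)
      qed
      finally show ?thesis
        using that by (simp add: sum_nonneg mult.assoc)
    qed
    moreover have "(\<lambda>n. norm (real n ^ Suc k * norm q ^ n)) summable_on {0<..}"
    proof -
      have "(\<lambda>n. real n ^ Suc k * norm q ^ n) summable_on UNIV"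
        using assms by (intro norm_summable_imp_summable_on)
          (simp add: abs_mult summable_power_times_geometric del: power_Suc)
      then have "(\<lambda>n. real n ^ Suc k * norm q ^ n) summable_on {0<..}"
        by (rule summable_on_subset_banach) auto
      then show ?thesis
        by (simp add: abs_mult del: power_Suc)
    qed
    ultimately show "(\<lambda>n. norm (\<Sum>\<^sub>\<infinity>d\<in>{d. d dvd n}. norm (G (n, d)))) summable_on {0<..}"
      by (intro Infinite_Sum.abs_summable_on_comparison_test'[of "\<lambda>n. real n ^ Suc k * norm q ^ n"]) simp_all
  qed
  have FG: "F p = G (case p of (m, j) \<Rightarrow> (m * j, m))" for p
    by (auto simp: F_def G_def split: prod.splits)
  have sumF: "(\<lambda>p. norm (F p)) summable_on ?P"
    unfolding FG using sumG by (subst summable_on_reindex_bij_betw[OF bij])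
  \<comment> \<open>The rearrangement uses unordered sums over the positive integers; this converts
    them into ordered series with index shifted by one.\<close>
  have shift: "(\<Sum>\<^sub>\<infinity>n\<in>{0<..}. f n) = (\<Sum>n. f (Suc n))" if "f summable_on {0<..}"
    for f :: "nat \<Rightarrow> complex"
  proof -
    have b: "bij_betw Suc UNIV {0<..}"
      by (rule bij_betw_byWitness[of _ "\<lambda>n. n - 1"]) auto
    have "(\<lambda>n. f (Suc n)) summable_on UNIV"
      using that by (subst summable_on_reindex_bij_betw[OF b])
    from sums_unique[OF has_sum_imp_sums[OF has_sum_infsum[OF this]]] show ?thesis
      using infsum_reindex_bij_betw[OF b, of f] by simp
  qed
  have sF: "(\<lambda>(m, j). of_nat m ^ k * q ^ (m * j)) summable_on ?P"
    using Infinite_Sum.abs_summable_summable[OF sumF] unfolding F_def .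
  have sG: "(\<lambda>(n, d). of_nat d ^ k * q ^ n) summable_on ?D"
    using Infinite_Sum.abs_summable_summable[OF sumG] unfolding G_def .
  have geometric: "(\<Sum>\<^sub>\<infinity>j\<in>{0<..}. of_nat m ^ k * q ^ (m * j)) = of_nat m ^ k * q ^ m / (1 - q ^ m)" if "m > 0" for m
  proof -
    have "norm (q ^ m) < 1"
      using assms that by (simp add: norm_power power_less_one_iff)
    then have *: "(\<lambda>j. q ^ m * (q ^ m) ^ j) sums (q ^ m * (1 / (1 - q ^ m)))"
      by (intro sums_mult geometric_sums)
    have "(\<lambda>(m, j). of_nat m ^ k * q ^ (m * j)) summable_on Pair m ` {0<..}"
      using sF by (rule summable_on_subset_banach) (use that in auto)
    then have "(\<lambda>j. of_nat m ^ k * q ^ (m * j)) summable_on {0<..}"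
      by (subst (asm) summable_on_reindex) (auto simp: inj_on_def o_def)
    from shift[OF this] have "(\<Sum>\<^sub>\<infinity>j\<in>{0<..}. of_nat m ^ k * q ^ (m * j)) =
        (\<Sum>j. of_nat m ^ k * (q ^ m * (q ^ m) ^ j))"
      by (simp add: power_add power_mult)
    also have "\<dots> = of_nat m ^ k * (q ^ m * (1 / (1 - q ^ m)))"
      by (rule sums_unique[symmetric], rule sums_mult, rule *)
    finally show ?thesis by simp
  qed
  have "(\<Sum>m. of_nat (Suc m) ^ k * q ^ Suc m / (1 - q ^ Suc m)) =
      (\<Sum>\<^sub>\<infinity>m\<in>{0<..}. of_nat m ^ k * q ^ m / (1 - q ^ m))"
  proof (rule shift[symmetric])
    show "(\<lambda>m. of_nat m ^ k * q ^ m / (1 - q ^ m)) summable_on {0<..}"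
      using summable_on_Sigma_banach[OF sF]
      by (rule summable_on_cong[THEN iffD1, rotated]) (simp add: geometric)
  qed
  also have "\<dots> = (\<Sum>\<^sub>\<infinity>m\<in>{0<..}. \<Sum>\<^sub>\<infinity>j\<in>{0<..}. of_nat m ^ k * q ^ (m * j))"
    by (intro infsum_cong) (simp add: geometric)
  also have "\<dots> = infsum F ?P"
    unfolding F_def by (rule infsum_Sigma'_banach[OF sF])
  also have "\<dots> = infsum G ?D"
    unfolding FG by (rule infsum_reindex_bij_betw[OF bij])
  also have "\<dots> = (\<Sum>\<^sub>\<infinity>n\<in>{0<..}. \<Sum>\<^sub>\<infinity>d\<in>{d. d dvd n}. of_nat d ^ k * q ^ n)"
    unfolding G_def by (rule infsum_Sigma'_banach[OF sG, symmetric])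
  also have "\<dots> = (\<Sum>\<^sub>\<infinity>n\<in>{0<..}. sigma k n * q ^ n)"
    by (intro infsum_cong) (simp add: sigma_def sum_distrib_right)
  also have "\<dots> = (\<Sum>n. sigma k (Suc n) * q ^ Suc n)"
  proof (rule shift)
    show "(\<lambda>n. sigma k n * q ^ n) summable_on {0<..}"
      using summable_on_Sigma_banach[OF sG]
      by (rule summable_on_cong[THEN iffD1, rotated]) (simp add: sigma_def sum_distrib_right)
  qed
  finally show ?thesis .
qed

definition E2 :: "complex \<Rightarrow> complex" where "E2 z = eval_fps e2 (nome z)"

lemma open_upper_half_plane: "open upper_half_plane"
  unfolding upper_half_plane_def by (rule open_halfspace_Im_gt)

lemma convex_upper_half_plane: "convex upper_half_plane"
  unfolding upper_half_plane_def by (rule convex_halfspace_Im_gt)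

lemma norm_nome_less_1: "z \<in> upper_half_plane \<Longrightarrow> norm (nome z) < 1"
  by (simp add: nome_def upper_half_plane_def)

lemma fps_conv_radius_eisenstein:
  "fps_conv_radius e2 \<ge> 1" "fps_conv_radius e4 \<ge> 1" "fps_conv_radius e6 \<ge> 1"
  unfolding e2_def e4_def e6_def by (rule fps_conv_radius_sigma)+

lemma less_fps_conv_radius:
  "norm q < 1 \<Longrightarrow> fps_conv_radius f \<ge> 1 \<Longrightarrow> ereal (norm q) < fps_conv_radius f"
  using less_le_trans[of "ereal (norm q)" 1] by simp

lemma eval_fps_eisenstein:
  assumes "norm q < 1"
  shows "eval_fps (Abs_fps (\<lambda>n. if n = 0 then 1 else c * sigma k n)) q =
    1 + c * (\<Sum>m. of_nat (Suc m) ^ k * q ^ Suc m / (1 - q ^ Suc m))"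
\<comment> \<open>Summability of the bare \<open>sigma\<close> series is obtained below by dividing
  by \<open>c\<close>.\<close>
proof (cases "c = 0")
  case True
  have "Abs_fps (\<lambda>n. if n = 0 then 1 else 0) = (1 :: complex fps)"
    by (rule fps_ext) simp
  with True show ?thesis by (simp cong: if_cong)
next
  case False
  let ?f = "\<lambda>n. (if n = 0 then 1 else c * sigma k n) * q ^ n"
  have summable: "summable ?f"
    using summable_fps[OF less_fps_conv_radius[OF assms fps_conv_radius_sigma[of c k]]] by simp
  then have "(\<Sum>n. ?f n) = (\<Sum>n. ?f (Suc n)) + 1"
    by (subst suminf_split_head) simp_all
  also have "(\<Sum>n. ?f (Suc n)) = (\<Sum>n. c * (sigma k (Suc n) * q ^ Suc n))"
    by (simp add: mult.assoc)
  also have "\<dots> = c * (\<Sum>n. sigma k (Suc n) * q ^ Suc n)"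
  proof (rule suminf_mult)
    have "summable (\<lambda>n. c * (sigma k (Suc n) * q ^ Suc n))"
      using summable_Suc_iff[THEN iffD2, OF summable] by (simp add: mult.assoc)
    from summable_mult[OF this, of "inverse c"] False show "summable (\<lambda>n. sigma k (Suc n) * q ^ Suc n)"
      by (simp add: mult.assoc[symmetric])
  qed
  finally show ?thesis
    unfolding lambert_series[OF assms] by (simp add: eval_fps_def)
qed

lemma E4_eq: "z \<in> upper_half_plane \<Longrightarrow> E4 z = eval_fps e4 (nome z)"
  by (simp only: E4_def e4_def eval_fps_eisenstein norm_nome_less_1)

lemma E6_eq: "z \<in> upper_half_plane \<Longrightarrow> E6 z = eval_fps e6 (nome z)"
  by (simp only: E6_def e6_def eval_fps_eisenstein norm_nome_less_1) simp

lemma nome_has_field_derivative: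
  "(nome has_field_derivative 2 * of_real pi * \<i> * nome z) (at z)"
  unfolding nome_def by (auto intro!: derivative_eq_intros)

lemma eval_fps_nome_has_field_derivative:
  assumes "z \<in> upper_half_plane" "fps_conv_radius f \<ge> 1"
  shows "((\<lambda>z. eval_fps f (nome z)) has_field_derivative
    2 * of_real pi * \<i> * eval_fps (fps_X * fps_deriv f) (nome z)) (at z)"
proof -
  have q: "norm (nome z) < 1" using norm_nome_less_1[OF assms(1)] .
  have r: "ereal (norm (nome z)) < fps_conv_radius f"
    by (rule less_fps_conv_radius[OF q assms(2)])
  then have "ereal (norm (nome z)) < fps_conv_radius (fps_deriv f)"
    using fps_conv_radius_deriv less_le_trans by blast
  then have "eval_fps (fps_X * fps_deriv f) (nome z) = nome z * eval_fps (fps_deriv f) (nome z)"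
    by (subst eval_fps_mult) simp_all
  moreover have "((\<lambda>z. eval_fps f (nome z)) has_field_derivative
      eval_fps (fps_deriv f) (nome z) * (2 * of_real pi * \<i> * nome z)) (at z)"
    using DERIV_chain2[OF has_field_derivative_eval_fps[OF r, of UNIV] nome_has_field_derivative] by simp
  ultimately show ?thesis by (simp add: mult_ac)
qed

lemma fps_conv_radius_ge_1:
  fixes f g :: "complex fps"
  assumes "fps_conv_radius f \<ge> 1" "fps_conv_radius g \<ge> 1"
  shows "fps_conv_radius (f * g) \<ge> 1" "fps_conv_radius (f - g) \<ge> 1"
  by (rule order.trans[OF _ fps_conv_radius_mult], use assms in simp)
    (rule order.trans[OF _ fps_conv_radius_diff], use assms in simp)

lemma eval_fps_unit_disc:
  fixes f g :: "complex fps"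
  assumes "norm q < 1" "fps_conv_radius f \<ge> 1" "fps_conv_radius g \<ge> 1"
  shows "eval_fps (f * g) q = eval_fps f q * eval_fps g q" "eval_fps (f - g) q = eval_fps f q - eval_fps g q"
  by (intro eval_fps_mult eval_fps_diff less_fps_conv_radius assms)+

lemma ramanujan_eval:
  assumes "z \<in> upper_half_plane"
  shows "eval_fps (fps_X * fps_deriv e2) (nome z) = (E2 z ^ 2 - E4 z) / 12"
    and "eval_fps (fps_X * fps_deriv e4) (nome z) = (E2 z * E4 z - E6 z) / 3"
    and "eval_fps (fps_X * fps_deriv e6) (nome z) = (E2 z * E6 z - E4 z ^ 2) / 2"
proof -
  have q: "norm (nome z) < 1" using norm_nome_less_1[OF assms] .
  have const: "c * eval_fps (fps_X * fps_deriv f) (nome z) = eval_fps (fps_const c * (fps_X * fps_deriv f)) (nome z)"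
    if "fps_conv_radius f \<ge> 1" for c and f :: "complex fps"
    using that order.trans[OF that fps_conv_radius_deriv]
    by (subst (2) eval_fps_unit_disc[OF q]) (auto intro: fps_conv_radius_ge_1)
  note facts = eval_fps_unit_disc[OF q] fps_conv_radius_ge_1 fps_conv_radius_eisenstein
    E2_def E4_eq[OF assms] E6_eq[OF assms] power2_eq_square
  have "12 * eval_fps (fps_X * fps_deriv e2) (nome z) = E2 z ^ 2 - E4 z"
    "3 * eval_fps (fps_X * fps_deriv e4) (nome z) = E2 z * E4 z - E6 z"
    "2 * eval_fps (fps_X * fps_deriv e6) (nome z) = E2 z * E6 z - E4 z ^ 2"
    by (simp_all only: const[OF fps_conv_radius_eisenstein(1)] const[OF fps_conv_radius_eisenstein(2)]
        const[OF fps_conv_radius_eisenstein(3)] ramanujan_e2 ramanujan_e4 ramanujan_e6 facts)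
  then show "eval_fps (fps_X * fps_deriv e2) (nome z) = (E2 z ^ 2 - E4 z) / 12"
    "eval_fps (fps_X * fps_deriv e4) (nome z) = (E2 z * E4 z - E6 z) / 3"
    "eval_fps (fps_X * fps_deriv e6) (nome z) = (E2 z * E6 z - E4 z ^ 2) / 2"
    by (simp_all add: field_simps)
qed

lemma eisenstein_has_field_derivative:
  assumes "z \<in> upper_half_plane"
  shows "(E2 has_field_derivative 2 * of_real pi * \<i> * ((E2 z ^ 2 - E4 z) / 12)) (at z)"
    and "(E4 has_field_derivative 2 * of_real pi * \<i> * ((E2 z * E4 z - E6 z) / 3)) (at z)"
    and "(E6 has_field_derivative 2 * of_real pi * \<i> * ((E2 z * E6 z - E4 z ^ 2) / 2)) (at z)"
proof -
  note D = eval_fps_nome_has_field_derivative[OF assms]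
  show "(E2 has_field_derivative 2 * of_real pi * \<i> * ((E2 z ^ 2 - E4 z) / 12)) (at z)"
    using D[OF fps_conv_radius_eisenstein(1)] by (simp only: ramanujan_eval[OF assms] E2_def[abs_def])
  show "(E4 has_field_derivative 2 * of_real pi * \<i> * ((E2 z * E4 z - E6 z) / 3)) (at z)"
    using D[OF fps_conv_radius_eisenstein(2)] unfolding ramanujan_eval[OF assms]
    by (rule has_field_derivative_transform_within_open[OF _ open_upper_half_plane assms]) (simp add: E4_eq)
  show "(E6 has_field_derivative 2 * of_real pi * \<i> * ((E2 z * E6 z - E4 z ^ 2) / 2)) (at z)"
    using D[OF fps_conv_radius_eisenstein(3)] unfolding ramanujan_eval[OF assms]
    by (rule has_field_derivative_transform_within_open[OF _ open_upper_half_plane assms]) (simp add: E6_eq)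
qed

lemma eisenstein_holomorphic:
  "E2 holomorphic_on upper_half_plane" "E4 holomorphic_on upper_half_plane" "E6 holomorphic_on upper_half_plane"
  using eisenstein_has_field_derivative
  by (auto simp: holomorphic_on_open[OF open_upper_half_plane])

lemma nome_surj:
  assumes "q \<noteq> 0" "norm q < 1"
  obtains z where "z \<in> upper_half_plane" "nome z = q"
proof
  let ?z = "Ln q / (2 * of_real pi * \<i>)"
  have "?z = of_real (1 / (2 * pi)) * (- \<i> * Ln q)"
    by (simp add: field_simps)
  also have "Im \<dots> = - ln (norm q) / (2 * pi)"
    using assms by simp
  also have "\<dots> > 0"
    using assms by (simp add: zero_less_divide_iff ln_less_zero divide_neg_pos)
  finally show "?z \<in> upper_half_plane" by (simp add: upper_half_plane_def)
  show "nome ?z = q" using assms by (simp add: nome_def)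
qed

section \<open>Nonvanishing of the discriminant, and a zero of \<open>E4\<close>\<close>

definition Delta :: "complex \<Rightarrow> complex" where "Delta z = E4 z ^ 3 - E6 z ^ 2"

lemma Delta_has_field_derivative:
  assumes "z \<in> upper_half_plane"
  shows "(Delta has_field_derivative 2 * of_real pi * \<i> * (E2 z * Delta z)) (at z)"
  unfolding Delta_def
  by (rule derivative_eq_intros eisenstein_has_field_derivative[OF assms] refl)+
    (simp add: field_simps power2_eq_square power3_eq_cube)

text \<open>\<open>Delta\<close> is 1728 times the normalised discriminant. If it vanished
  identically, so would its q-series on the unit disc, the centre, which \<open>nome\<close> omits,
  being covered by the constant term. But the coefficient of \<open>q\<close> is
  \<open>3 * 240 + 2 * 504 = 1728\<close>.\<close>

lemma Delta_not_identically_zero: "\<exists>z\<in>upper_half_plane. Delta z \<noteq> 0"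
proof (rule ccontr)
  assume "\<not> (\<exists>z\<in>upper_half_plane. Delta z \<noteq> 0)"
  then have zero: "Delta z = 0" if "z \<in> upper_half_plane" for z
    using that by blast
  let ?d = "e4 * (e4 * e4) - e6 * e6"
  have d0: "fps_nth ?d 0 = 0"
    by (simp add: e4_def e6_def)
  have r: "fps_conv_radius ?d \<ge> 1"
    by (intro fps_conv_radius_ge_1 fps_conv_radius_eisenstein)
  have "eval_fps ?d q = 0" if q: "norm q < 1" for q
  proof (cases "q = 0")
    case False
    then obtain z where z: "z \<in> upper_half_plane" "nome z = q"
      using nome_surj q by blast
    have "eval_fps ?d q = E4 z * (E4 z * E4 z) - E6 z * E6 z"
      by (simp add: eval_fps_unit_disc[OF q] fps_conv_radius_ge_1 fps_conv_radius_eisenstein E4_eq E6_eq z)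
    then show ?thesis using zero[OF z(1)] by (simp add: Delta_def power2_eq_square power3_eq_cube mult_ac)
  next
    case True
    show ?thesis unfolding True using d0 by (simp add: eval_fps_at_0)
  qed
  moreover have "eventually (\<lambda>q. q \<in> ball 0 1) (nhds (0 :: complex))"
    by (rule eventually_nhds_in_open) auto
  ultimately have "eventually (\<lambda>q. eval_fps ?d q = eval_fps 0 q) (nhds 0)"
    by (auto elim!: eventually_mono)
  moreover have "fps_conv_radius ?d > 0"
    using r by (rule less_le_trans[rotated]) simp
  ultimately have "?d = 0"
    by (intro eval_fps_eqD) simp_all
  then have "fps_nth ?d 1 = 0" by simp
  moreover have "fps_nth ?d 1 = 1728"
  proof -
    have "{0..1} = {0, 1 :: nat}" by auto
    moreover have "{d. d dvd 1} = {1 :: nat}" by auto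
    ultimately show ?thesis by (simp add: fps_mult_nth e4_def e6_def sigma_def)
  qed
  ultimately show False by simp
qed

text \<open>The linear equation \<open>Delta' = 2 pi i E2 Delta\<close> makes \<open>Delta\<close> a
  constant times the exponential of a primitive on a convex domain, so a single zero would make it
  vanish everywhere.\<close>

lemma Delta_nonzero:
  assumes "z \<in> upper_half_plane"
  shows "Delta z \<noteq> 0"
proof
  assume "Delta z = 0"
  obtain F where F: "\<And>z. z \<in> upper_half_plane \<Longrightarrow> (F has_field_derivative 2 * of_real pi * \<i> * E2 z) (at z within upper_half_plane)"
  proof (rule holomorphic_convex_primitive'[OF convex_upper_half_plane open_upper_half_plane])
    show "(\<lambda>z. 2 * of_real pi * \<i> * E2 z) holomorphic_on upper_half_plane"
      by (intro holomorphic_intros eisenstein_holomorphic)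
  qed blast
  have "((\<lambda>z. Delta z * exp (- F z)) has_field_derivative 0) (at z within upper_half_plane)"
    if "z \<in> upper_half_plane" for z
    by (rule derivative_eq_intros F[OF that] has_field_derivative_at_within[OF Delta_has_field_derivative[OF that]] refl)+
      (simp add: algebra_simps)
  then have "\<exists>c. \<forall>z\<in>upper_half_plane. Delta z * exp (- F z) = c"
    by (rule has_field_derivative_zero_constant[OF convex_upper_half_plane])
  then obtain c where c: "Delta w * exp (- F w) = c" if "w \<in> upper_half_plane" for w
    by blast
  have "c = 0"
    using c[OF assms] \<open>Delta z = 0\<close> by simp
  then have "Delta w = 0" if "w \<in> upper_half_plane" for w
    using c[OF that] by simp
  with Delta_not_identically_zero show False by blast
qed

lemma E6_nonzero: "z \<in> upper_half_plane \<Longrightarrow> E4 z = 0 \<Longrightarrow> E6 z \<noteq> 0"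
  using Delta_nonzero[of z] by (auto simp: Delta_def)

text \<open>\<open>sigma 3 n\<close> is at most \<open>n^4\<close>, and \<open>(n + 2)^4\<close>
  grows per step by at most \<open>(3/2)^4 = 81/16 < 8\<close>. The factor 384/1000 is
  \<open>240 * 16 / 100^2\<close>.\<close>

lemma e4_tail_bound:
  "norm (fps_nth e4 (n + 2) * of_real (- 1 / 100) ^ (n + 2)) \<le> 384 / 1000 * (8 / 100) ^ n"
proof -
  have "norm (sigma 3 (n + 2)) \<le> real (n + 2) ^ 4"
    using sigma_bound[of "n + 2" 3] by (simp add: numeral_eq_Suc)
  also have "real (n + 2) ^ 4 \<le> 16 * 8 ^ n"
  proof (induction n)
    case (Suc n)
    have "real (Suc n + 2) ^ 4 \<le> (3 / 2 * real (n + 2)) ^ 4"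
      by (intro power_mono) auto
    also have "\<dots> = 81 / 16 * real (n + 2) ^ 4"
      by (simp only: power_mult_distrib) (simp add: power_divide)
    also have "\<dots> \<le> 8 * (16 * 8 ^ n)"
      using Suc zero_le_power[of "8 :: real" n] by linarith
    finally show ?case by simp
  qed simp
  finally have "240 * norm (sigma 3 (n + 2)) * (1 / 100) ^ (n + 2) \<le> 240 * (16 * 8 ^ n) * (1 / 100) ^ (n + 2)"
    by (intro mult_right_mono) auto
  also have "\<dots> = 384 / 1000 * (8 / 100) ^ n"
    by (simp add: power_add flip: power_mult_distrib)
  finally show ?thesis
    by (simp add: e4_def norm_mult norm_power power_divide norm_divide)
qed

text \<open>\<open>E4\<close> is real for real \<open>q\<close>, and changes sign between \<open>q = -1/100\<close> and \<open>q = 0\<close>.\<close>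
lemma E4_has_zero: "\<exists>z\<in>upper_half_plane. E4 z = 0"
proof -
  have Im: "Im (eval_fps e4 (of_real x)) = 0" if "\<bar>x\<bar> < 1" for x :: real
  proof -
    have "(\<lambda>n. fps_nth e4 n * of_real x ^ n) sums eval_fps e4 (of_real x)"
      using that by (intro sums_eval_fps less_fps_conv_radius fps_conv_radius_eisenstein) simp
    then have "(\<lambda>n. Im (fps_nth e4 n * of_real x ^ n)) sums Im (eval_fps e4 (of_real x))"
      by (rule sums_Im)
    moreover have "Im (fps_nth e4 n * of_real x ^ n) = 0" for n
      by (simp add: e4_def sigma_def flip: of_real_power of_nat_power)
    ultimately have "(\<lambda>n. 0) sums Im (eval_fps e4 (of_real x))"
      by (simp only:)
    then show ?thesis using sums_unique2[OF sums_zero] by metis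
  qed
  let ?q = "of_real (- 1 / 100) :: complex"
  \<comment> \<open>At this point \<open>1 + 240 q = - 7/5\<close>, so it is enough to bound the
    tail by 1.\<close>
  have "Re (eval_fps e4 ?q) < 0"
  proof -
    have q: "norm ?q < 1" by simp
    have s: "(\<lambda>n. fps_nth e4 n * ?q ^ n) sums eval_fps e4 ?q"
      by (intro sums_eval_fps less_fps_conv_radius fps_conv_radius_eisenstein q)
    have s2: "(\<lambda>n. fps_nth e4 (n + 2) * ?q ^ (n + 2)) sums (eval_fps e4 ?q - (1 + 240 * ?q))"
    proof -
      have "(\<Sum>n<2. fps_nth e4 n * ?q ^ n) = 1 + 240 * ?q"
        by (simp add: e4_def sigma_def numeral_2_eq_2)
      with sums_iff_shift[of "\<lambda>n. fps_nth e4 n * ?q ^ n" 2] s show ?thesis by simp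
    qed
    have "norm (fps_nth e4 (n + 2) * ?q ^ (n + 2)) \<le> 384 / 1000 * (8 / 100) ^ n" for n
      by (rule e4_tail_bound)
    moreover have "(\<lambda>n. 384 / 1000 * (8 / 100) ^ n) sums (384 / 1000 * (1 / (1 - 8 / 100 :: real)))"
      by (intro sums_mult geometric_sums) simp
    ultimately have "norm (eval_fps e4 ?q - (1 + 240 * ?q)) \<le> 384 / 1000 * (1 / (1 - 8 / 100))"
      using norm_suminf_le[of "\<lambda>n. fps_nth e4 (n + 2) * ?q ^ (n + 2)" "\<lambda>n. 384 / 1000 * (8 / 100) ^ n"]
      unfolding sums_unique[OF s2, symmetric] by (simp only: sums_iff)
    also have "\<dots> \<le> 1" by simp
    finally have "Re (eval_fps e4 ?q - (1 + 240 * ?q)) \<le> 1"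
      using complex_Re_le_cmod order.trans by blast
    then show ?thesis by simp
  qed
  moreover have "Re (eval_fps e4 (of_real 0)) = 1"
    by (simp add: eval_fps_at_0 e4_def)
  moreover have "continuous_on {- 1 / 100..0} (\<lambda>x. Re (eval_fps e4 (of_real x)))"
  proof (intro continuous_intros subsetI)
    fix q :: complex assume "q \<in> of_real ` {- 1 / 100..0}"
    then have "norm q < 1" by auto
    then show "q \<in> eball 0 (fps_conv_radius e4)"
      using less_fps_conv_radius[OF _ fps_conv_radius_eisenstein(2)] by simp
  qed
  ultimately have "\<exists>x\<ge>- 1 / 100. x \<le> 0 \<and> Re (eval_fps e4 (of_real x)) = 0"
    by (intro IVT'[of "\<lambda>x. Re (eval_fps e4 (of_real x))"]) linarith+
  then obtain x where x: "- 1 / 100 \<le> x" "x \<le> 0" "Re (eval_fps e4 (of_real x)) = 0"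
    by blast
  have "x \<noteq> 0"
    using x(3) \<open>Re (eval_fps e4 (of_real 0)) = 1\<close> by force
  then have "of_real x \<noteq> (0 :: complex)" "norm (of_real x :: complex) < 1"
    using x by simp_all
  then obtain z where z: "z \<in> upper_half_plane" "nome z = of_real x"
    by (rule nome_surj)
  have "E4 z = 0"
    unfolding E4_eq[OF z(1)] z(2) complex_eq_iff using x Im[of x] by simp
  with z show ?thesis by blast
qed

section \<open>Logarithms and reduction of order on the slit disc\<close>

lemma slit_disc_alt: "slit_disc z0 \<epsilon> = ball z0 \<epsilon> \<inter> (\<lambda>z. z - z0) -` (- \<real>\<^sub>\<le>\<^sub>0)"
  by (auto simp: slit_disc_def)

lemma open_slit_disc: "open (slit_disc z0 \<epsilon>)"
  unfolding slit_disc_alt by (intro open_Int open_ball continuous_open_vimage continuous_intros) auto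

lemma slit_disc_subset: "slit_disc z0 \<epsilon> \<subseteq> ball z0 \<epsilon>" "\<epsilon> \<le> \<delta> \<Longrightarrow> slit_disc z0 \<epsilon> \<subseteq> slit_disc z0 \<delta>"
  by (auto simp: slit_disc_def)

lemma slit_discD: "z \<in> slit_disc z0 \<epsilon> \<Longrightarrow> z \<in> ball z0 \<epsilon> \<and> z - z0 \<notin> \<real>\<^sub>\<le>\<^sub>0 \<and> z \<noteq> z0"
  by (auto simp: slit_disc_def)

text \<open>Moved to the origin, the slit disc is star-shaped about the positive point
  \<open>\<epsilon> / 2\<close>.\<close>

lemma connected_slit_disc: "connected (slit_disc z0 \<epsilon>)"
proof (cases "\<epsilon> > 0")
  case True
  let ?T = "- complex_of_real ` {..0}"
  have T: "?T = - \<real>\<^sub>\<le>\<^sub>0"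
    by (auto simp: nonpos_Reals_def)
  have "of_real (\<epsilon> / 2) \<in> ball 0 \<epsilon> \<inter> ?T"
    unfolding T using True by (simp add: complex_nonpos_Reals_iff)
  moreover have "closed_segment (of_real (\<epsilon> / 2)) w \<subseteq> ball 0 \<epsilon> \<inter> ?T" if "w \<in> ball 0 \<epsilon> \<inter> ?T" for w
    using starlike_slotted_complex_plane_left_aux[of w 0 "\<epsilon> / 2"] that True
      closed_segment_subset[of "of_real (\<epsilon> / 2)" "ball 0 \<epsilon>" w] by auto
  ultimately have "starlike (ball 0 \<epsilon> \<inter> ?T)"
    unfolding starlike_def by blast
  then have "connected ((+) z0 ` (ball 0 \<epsilon> \<inter> ?T))"
    by (intro connected_continuous_image starlike_imp_connected continuous_intros)
  also have "(+) z0 ` (ball 0 \<epsilon> \<inter> ?T) = slit_disc z0 \<epsilon>"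
    unfolding T
  proof (intro equalityI subsetI)
    fix z assume "z \<in> slit_disc z0 \<epsilon>"
    then show "z \<in> (+) z0 ` (ball 0 \<epsilon> \<inter> - \<real>\<^sub>\<le>\<^sub>0)"
      by (intro image_eqI[of _ _ "z - z0"]) (auto simp: slit_disc_def dist_norm norm_minus_commute)
  qed (auto simp: slit_disc_def dist_norm)
  finally show ?thesis .
next
  case False
  then have "slit_disc z0 \<epsilon> = {}" by (simp add: slit_disc_alt ball_empty)
  then show ?thesis by simp
qed

lemma half_disc_nonempty:
  assumes "\<epsilon> > 0"
  shows "ball z0 \<epsilon> \<inter> {z. Im (z - z0) > 0} \<noteq> {}" "ball z0 \<epsilon> \<inter> {z. Im (z - z0) < 0} \<noteq> {}"
proof -
  have "z0 + of_real (\<epsilon> / 2) * \<i> \<in> ball z0 \<epsilon> \<inter> {z. Im (z - z0) > 0}"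
    "z0 - of_real (\<epsilon> / 2) * \<i> \<in> ball z0 \<epsilon> \<inter> {z. Im (z - z0) < 0}"
    using assms by (auto simp: dist_norm norm_mult)
  then show "ball z0 \<epsilon> \<inter> {z. Im (z - z0) > 0} \<noteq> {}" "ball z0 \<epsilon> \<inter> {z. Im (z - z0) < 0} \<noteq> {}"
    by blast+
qed

lemma open_half_disc: "open (ball z0 \<epsilon> \<inter> {z. Im (z - z0) > 0})" "open (ball z0 \<epsilon> \<inter> {z. Im (z - z0) < 0})"
  by (intro open_Int open_ball open_Collect_less continuous_intros)+

text \<open>Continuation across the slit: \<open>Ln (- w) + \<i> \<pi>\<close> is holomorphic off the positive axis, and equals
  \<open>Ln w\<close> in the upper and \<open>Ln w + 2 \<pi> \<i>\<close> in the lower half plane.\<close>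
lemma monodromy:
  fixes \<Phi> :: "complex \<Rightarrow> complex \<Rightarrow> complex"
  assumes "\<epsilon> > 0"
    and hol: "\<And>S f. S \<subseteq> ball z0 \<epsilon> \<Longrightarrow> f holomorphic_on S \<Longrightarrow> (\<lambda>z. \<Phi> z (f z)) holomorphic_on S"
    and zero: "\<And>z. z \<in> slit_disc z0 \<epsilon> \<Longrightarrow> \<Phi> z (Ln (z - z0)) = 0"
    and z: "z \<in> slit_disc z0 \<epsilon>"
  shows "\<Phi> z (Ln (z - z0) + 2 * of_real pi * \<i>) = 0"
proof -
  let ?U = "ball z0 \<epsilon> \<inter> {z. Im (z - z0) > 0}" and ?L = "ball z0 \<epsilon> \<inter> {z. Im (z - z0) < 0}"
  \<comment> \<open>The reflected slit disc, cut along the positive ray, where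
    \<open>Ln (- w)\<close> is holomorphic. The relation is carried into it from the upper half-disc
    and back into the original slit disc from the lower one, where the shifted branch appears.
    Having the value of the logarithm as a second argument of \<open>\<Phi>\<close> makes the change
    of branch a substitution.\<close>
  let ?R = "(\<lambda>z. 2 * z0 - z) ` slit_disc z0 \<epsilon>"
  have R: "?R = {z \<in> ball z0 \<epsilon>. - (z - z0) \<notin> \<real>\<^sub>\<le>\<^sub>0}"
  proof (intro equalityI subsetI)
    fix z assume "z \<in> {z \<in> ball z0 \<epsilon>. - (z - z0) \<notin> \<real>\<^sub>\<le>\<^sub>0}"
    then show "z \<in> ?R"
      by (intro image_eqI[of _ _ "2 * z0 - z"]) (auto simp: slit_disc_def dist_norm norm_minus_commute)
  qed (auto simp: slit_disc_def dist_norm norm_minus_commute)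
  have "connected ?R"
    by (intro connected_continuous_image connected_slit_disc continuous_intros)
  have "{z \<in> ball z0 \<epsilon>. - (z - z0) \<notin> \<real>\<^sub>\<le>\<^sub>0} = ball z0 \<epsilon> \<inter> (\<lambda>z. - (z - z0)) -` (- \<real>\<^sub>\<le>\<^sub>0)"
    by auto
  then have "open ?R"
    unfolding R by (simp only:) (intro open_Int open_ball continuous_open_vimage continuous_intros, auto)
  have U: "?U \<subseteq> ?R" "?U \<subseteq> slit_disc z0 \<epsilon>" and L: "?L \<subseteq> ?R" "?L \<subseteq> slit_disc z0 \<epsilon>"
    unfolding R by (auto simp: slit_disc_def complex_nonpos_Reals_iff)
  have upper: "\<Phi> w (Ln (- (w - z0)) + of_real pi * \<i>) = 0" if "w \<in> ?R" for w
  proof (rule analytic_continuation_open[of ?U ?R "\<lambda>w. \<Phi> w (Ln (- (w - z0)) + of_real pi * \<i>)" "\<lambda>_. 0"])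
    show "(\<lambda>w. \<Phi> w (Ln (- (w - z0)) + of_real pi * \<i>)) holomorphic_on ?R"
      unfolding R by (intro hol holomorphic_intros) auto
    show "\<Phi> w (Ln (- (w - z0)) + of_real pi * \<i>) = 0" if "w \<in> ?U" for w
    proof -
      have "Ln (- (w - z0)) + of_real pi * \<i> = Ln (w - z0)"
        using that by (subst Ln_minus) auto
      then show ?thesis using zero[of w] U(2) that by auto
    qed
  qed (use U that \<open>connected ?R\<close> \<open>open ?R\<close> open_half_disc half_disc_nonempty[OF \<open>\<epsilon> > 0\<close>] in auto)
  show ?thesis
  proof (rule analytic_continuation_open[of ?L "slit_disc z0 \<epsilon>" "\<lambda>w. \<Phi> w (Ln (w - z0) + 2 * of_real pi * \<i>)" "\<lambda>_. 0"])
    show "(\<lambda>w. \<Phi> w (Ln (w - z0) + 2 * of_real pi * \<i>)) holomorphic_on slit_disc z0 \<epsilon>"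
      using slit_disc_subset(1) by (intro hol holomorphic_intros) (auto simp: slit_disc_def)
    show "\<Phi> w (Ln (w - z0) + 2 * of_real pi * \<i>) = 0" if "w \<in> ?L" for w
    proof -
      have "Ln (- (w - z0)) + of_real pi * \<i> = Ln (w - z0) + 2 * of_real pi * \<i>"
        using that by (subst Ln_minus) auto
      moreover have "\<Phi> w (Ln (- (w - z0)) + of_real pi * \<i>) = 0"
        using L(1) that by (intro upper) blast
      ultimately show ?thesis by (simp only:)
    qed
  qed (use L z connected_slit_disc open_slit_disc open_half_disc half_disc_nonempty[OF \<open>\<epsilon> > 0\<close>] in auto)
qed

text \<open>With \<open>X = w\<^sup>\<alpha> G\<close>, monodromy turns the given equation into \<open>r\<^sup>k X = Y + k Z\<close> for all \<open>k\<close>,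
  where \<open>Z\<close> is a nonzero multiple of \<open>h\<close>; the cases \<open>k = 0, 1, 2\<close> force \<open>Z = 0\<close>.\<close>
lemma no_logarithm:
  assumes "\<epsilon> > 0"
    and hol: "G holomorphic_on ball z0 \<epsilon>" "g holomorphic_on ball z0 \<epsilon>" "h holomorphic_on ball z0 \<epsilon>"
    and eq: "\<And>z. z \<in> slit_disc z0 \<epsilon> \<Longrightarrow>
      (z - z0) powr \<alpha> * G z = (z - z0) powr a * (g z + h z * Ln (z - z0))"
    and z: "z \<in> ball z0 \<epsilon>"
  shows "h z = 0"
proof -
  define c where "c = 2 * of_real pi * \<i>"
  \<comment> \<open>The relation after \<open>k\<close> turns around \<open>z0\<close>. Powers are
    written as exponentials so that a turn only adds \<open>c\<close> to \<open>L\<close>.\<close>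
  define \<Phi> where "\<Phi> k = (\<lambda>z L. exp (\<alpha> * (L + of_nat k * c)) * G z -
    exp (a * (L + of_nat k * c)) * (g z + h z * (L + of_nat k * c)))" for k :: nat
  have \<Phi>: "\<Phi> k z (Ln (z - z0)) = 0" if "z \<in> slit_disc z0 \<epsilon>" for k z
    using that
  proof (induction k arbitrary: z)
    case 0
    then show ?case using eq[OF 0] slit_discD[OF 0] by (simp add: \<Phi>_def powr_def)
  next
    case (Suc k)
    have "\<Phi> k z (Ln (z - z0) + 2 * of_real pi * \<i>) = 0"
    proof (rule monodromy[where \<Phi> = "\<Phi> k", OF \<open>\<epsilon> > 0\<close> _ Suc.IH Suc.prems])
      fix S f assume "S \<subseteq> ball z0 \<epsilon>" "f holomorphic_on S"
      then show "(\<lambda>z. \<Phi> k z (f z)) holomorphic_on S"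
        unfolding \<Phi>_def by (intro holomorphic_intros) (auto intro: holomorphic_on_subset[OF hol(1)]
            holomorphic_on_subset[OF hol(2)] holomorphic_on_subset[OF hol(3)])
    qed
    then show ?case by (simp add: \<Phi>_def c_def algebra_simps)
  qed
  have slit: "h z = 0" if "z \<in> slit_disc z0 \<epsilon>" for z
  proof -
    define L where "L = Ln (z - z0)"
    define X where "X = exp (\<alpha> * L) * G z"
    define Y where "Y = exp (a * L) * (g z + h z * L)"
    define Z where "Z = exp (a * L) * h z * c"
    define r where "r = exp ((\<alpha> - a) * c)"
    have r: "r ^ k * X = Y + of_nat k * Z" for k
    proof -
      have "exp (\<alpha> * (L + of_nat k * c)) * G z = exp (a * (of_nat k * c)) * (r ^ k * X)"
        by (simp add: X_def r_def algebra_simps flip: exp_of_nat_mult exp_add)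
      moreover have "exp (a * (L + of_nat k * c)) * (g z + h z * (L + of_nat k * c)) =
          exp (a * (of_nat k * c)) * (Y + of_nat k * Z)"
        by (simp add: Y_def Z_def algebra_simps flip: exp_add)
      ultimately show ?thesis
        using \<Phi>[OF that, of k] by (simp add: \<Phi>_def L_def)
    qed
    have 0: "X = Y" and 1: "r * X = Y + Z" and 2: "r ^ 2 * X = Y + 2 * Z"
      using r[of 0] r[of 1] r[of 2] by simp_all
    \<comment> \<open>Second difference in \<open>k\<close>: it kills the right side, which is
      affine in \<open>k\<close>, and turns the left side into \<open>(r - 1)^2 X\<close>.\<close>
    have "((r - 1) * X) * (r - 1) = 0"
    proof -
      have "((r - 1) * X) * (r - 1) = r ^ 2 * X - 2 * (r * X) + X"
        by (simp add: algebra_simps power2_eq_square)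
      then show ?thesis unfolding 1 2 by (simp add: 0)
    qed
    then have "r * X = X" by auto
    then have "Y + Z = Y" using 0 1 by metis
    then have "Z = 0" by simp
    then show ?thesis by (simp add: Z_def c_def)
  qed
  show ?thesis
  proof (rule analytic_continuation_open[of "slit_disc z0 \<epsilon>" "ball z0 \<epsilon>" h "\<lambda>_. 0"])
    have "ball z0 \<epsilon> \<inter> {z. Im (z - z0) > 0} \<subseteq> slit_disc z0 \<epsilon>"
      by (auto simp: slit_disc_def complex_nonpos_Reals_iff)
    then show "slit_disc z0 \<epsilon> \<noteq> {}"
      using half_disc_nonempty(1)[OF \<open>\<epsilon> > 0\<close>] by blast
  qed (use slit slit_disc_subset z open_slit_disc hol in auto)
qed

section \<open>Solutions on the slit disc and reduction of order\<close>

lemma solves_onI: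
  assumes "open S"
    and "\<And>z. z \<in> S \<Longrightarrow> (y has_field_derivative y' z) (at z)"
    and "\<And>z. z \<in> S \<Longrightarrow> (y' has_field_derivative Q z * y z) (at z)"
  shows "solves_on Q y S"
  unfolding solves_on_def
proof (intro conjI ballI)
  show "y holomorphic_on S"
    using assms by (auto simp: holomorphic_on_open)
  fix z assume z: "z \<in> S"
  have "(deriv y has_field_derivative Q z * y z) (at z)"
    by (rule has_field_derivative_transform_within_open[OF assms(3)[OF z] \<open>open S\<close> z])
      (simp add: DERIV_imp_deriv[OF assms(2)])
  then show "deriv (deriv y) z = Q z * y z" by (rule DERIV_imp_deriv)
qed

lemma solves_onD:
  assumes "solves_on Q y S" "open S" "z \<in> S"
  shows "(y has_field_derivative deriv y z) (at z)" "(deriv y has_field_derivative Q z * y z) (at z)"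
proof -
  have y: "y holomorphic_on S" and eq: "deriv (deriv y) z = Q z * y z"
    using assms by (auto simp: solves_on_def)
  show "(y has_field_derivative deriv y z) (at z)"
    by (rule holomorphic_derivI[OF y assms(2,3)])
  show "(deriv y has_field_derivative Q z * y z) (at z)"
    using holomorphic_derivI[OF holomorphic_deriv[OF y assms(2)] assms(2,3)] eq by simp
qed

lemma solves_on_subset:
  assumes "solves_on Q y S" "T \<subseteq> S"
  shows "solves_on Q y T"
  using assms by (auto simp: solves_on_def intro: holomorphic_on_subset)

lemma solves_on_cong:
  assumes "open S" "\<And>z. z \<in> S \<Longrightarrow> y z = y' z"
  shows "solves_on Q y S \<longleftrightarrow> solves_on Q y' S"
proof -
  have *: "solves_on Q y2 S" if "solves_on Q y1 S" "\<And>z. z \<in> S \<Longrightarrow> y1 z = y2 z" for y1 y2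
  proof (rule solves_onI[OF \<open>open S\<close>])
    fix z assume z: "z \<in> S"
    note D = solves_onD[OF that(1) \<open>open S\<close> z]
    show "(y2 has_field_derivative deriv y1 z) (at z)"
      by (rule has_field_derivative_transform_within_open[OF D(1) \<open>open S\<close> z that(2)])
    show "(deriv y1 has_field_derivative Q z * y2 z) (at z)"
      using D(2) that(2)[OF z] by simp
  qed
  show ?thesis using *[of y y'] *[of y' y] assms(2) by auto
qed

lemma constant_on_slit_disc:
  assumes "\<And>z. z \<in> slit_disc z0 \<epsilon> \<Longrightarrow> (f has_field_derivative 0) (at z)"
  shows "\<exists>c. \<forall>z\<in>slit_disc z0 \<epsilon>. f z = c"
proof -
  have "continuous_on (slit_disc z0 \<epsilon>) f"
    using assms by (intro DERIV_continuous_on[where D = "\<lambda>_. 0"]) (auto intro: has_field_derivative_at_within)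
  with assms have "f constant_on slit_disc z0 \<epsilon>"
    by (intro DERIV_zero_connected_constant_on[OF connected_slit_disc open_slit_disc finite.emptyI]) auto
  then show ?thesis by (auto simp: constant_on_def)
qed

lemma powr_double_neg_nat:
  fixes w :: complex
  assumes "w \<noteq> 0" "n \<ge> 1"
  shows "1 / (w powr ((1 - of_nat n) / 2)) ^ 2 = w ^ (n - 1)"
proof -
  have "(1 - of_nat n) / 2 + (1 - of_nat n) / 2 = - (of_nat (n - 1) :: complex)"
    using assms by (simp add: of_nat_diff)
  then have "(w powr ((1 - of_nat n) / 2)) ^ 2 = w powr (- of_nat (n - 1))"
    unfolding power2_eq_square powr_add[symmetric] by (simp only:)
  also have "\<dots> = inverse (w ^ (n - 1))"
    unfolding powr_minus using assms by (subst powr_nat') auto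
  finally show ?thesis by (simp add: inverse_eq_divide)
qed

lemma powr_double_nat:
  fixes w :: complex
  assumes "w \<noteq> 0"
  shows "(w powr ((1 + of_nat n) / 2)) ^ 2 = w ^ Suc n"
proof -
  have "(w powr ((1 + of_nat n) / 2)) ^ 2 = w powr of_nat (Suc n)"
    by (simp add: power2_eq_square flip: powr_add)
  then show ?thesis
    using assms by (simp only: powr_nat' simp_thms)
qed

text \<open>Reduction of order: \<open>(y / y2)' = W / y2\<^sup>2\<close> with constant Wronskian \<open>W\<close>, and
  \<open>y2\<^sup>-\<^sup>2 = w\<^sup>n\<^sup>-\<^sup>1 g2\<^sup>-\<^sup>2\<close> has a holomorphic primitive.\<close>
lemma all_solutions_of_lower_solution:
  assumes "n \<ge> 1"
    and g2: "g2 holomorphic_on ball z0 \<epsilon>" "\<And>z. z \<in> ball z0 \<epsilon> \<Longrightarrow> g2 z \<noteq> 0"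
    and y2: "solves_on Q (\<lambda>z. (z - z0) powr ((1 - of_nat n) / 2) * g2 z) (slit_disc z0 \<epsilon>)"
    and y: "solves_on Q y (slit_disc z0 \<epsilon>)"
  shows "\<exists>G. G holomorphic_on ball z0 \<epsilon> \<and>
    (\<forall>z\<in>slit_disc z0 \<epsilon>. y z = (z - z0) powr ((1 - of_nat n) / 2) * G z)"
proof (cases "slit_disc z0 \<epsilon> = {}")
  case False
  define u where "u = (\<lambda>z. (z - z0) powr ((1 - of_nat n) / 2) * g2 z)"
  let ?S = "slit_disc z0 \<epsilon>"
  note Du = solves_onD[OF y2[folded u_def] open_slit_disc] and Dy = solves_onD[OF y open_slit_disc]
  have u0: "u z \<noteq> 0" if "z \<in> ?S" for z
    using g2(2) slit_discD[OF that] by (simp add: u_def)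
  have "\<exists>W. \<forall>z\<in>?S. u z * deriv y z - deriv u z * y z = W"
  proof -
    have "((\<lambda>z. u z * deriv y z - deriv u z * y z) has_field_derivative 0) (at z)" if "z \<in> ?S" for z
      by (rule derivative_eq_intros Du[OF that] Dy[OF that] refl)+ (simp add: algebra_simps)
    then show ?thesis by (rule constant_on_slit_disc)
  qed
  then obtain W where W: "\<And>z. z \<in> ?S \<Longrightarrow> u z * deriv y z - deriv u z * y z = W" by blast
  obtain P where P: "\<And>z. z \<in> ball z0 \<epsilon> \<Longrightarrow>
      (P has_field_derivative W * (z - z0) ^ (n - 1) / g2 z ^ 2) (at z within ball z0 \<epsilon>)"
  proof (rule holomorphic_convex_primitive'[OF convex_ball open_ball])
    show "(\<lambda>z. W * (z - z0) ^ (n - 1) / g2 z ^ 2) holomorphic_on ball z0 \<epsilon>"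
      using g2 by (intro holomorphic_intros) auto
  qed blast
  have P': "(P has_field_derivative W * (z - z0) ^ (n - 1) / g2 z ^ 2) (at z)" if "z \<in> ball z0 \<epsilon>" for z
    using P[OF that] that by (simp add: at_within_open[OF _ open_ball])
  have "\<exists>c. \<forall>z\<in>?S. y z / u z - P z = c"
  proof -
    have "((\<lambda>z. y z / u z - P z) has_field_derivative 0) (at z)" if "z \<in> ?S" for z
    proof -
      have "1 / u z ^ 2 = (z - z0) ^ (n - 1) / g2 z ^ 2"
        using powr_double_neg_nat[of "z - z0" n] slit_discD[OF that] \<open>n \<ge> 1\<close>
        by (simp add: u_def power_mult_distrib divide_simps)
      moreover have "(deriv y z * u z - y z * deriv u z) / (u z * u z) = W * (1 / u z ^ 2)"
        using W[OF that] by (simp add: power2_eq_square mult.commute)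
      ultimately have "(deriv y z * u z - y z * deriv u z) / (u z * u z) - W * (z - z0) ^ (n - 1) / g2 z ^ 2 = 0"
        by simp
      moreover have "((\<lambda>z. y z / u z - P z) has_field_derivative
          (deriv y z * u z - y z * deriv u z) / (u z * u z) - W * (z - z0) ^ (n - 1) / g2 z ^ 2) (at z)"
        using slit_discD[OF that] by (intro DERIV_diff DERIV_divide P' Dy(1) Du(1) that u0) auto
      ultimately show ?thesis by simp
    qed
    then show ?thesis by (rule constant_on_slit_disc)
  qed
  then obtain c where c: "\<And>z. z \<in> ?S \<Longrightarrow> y z / u z - P z = c" by blast
  show ?thesis
  proof (intro exI conjI ballI)
    have "P holomorphic_on ball z0 \<epsilon>"
      using P' by (subst holomorphic_on_open) blast+
    then show "(\<lambda>z. g2 z * (c + P z)) holomorphic_on ball z0 \<epsilon>"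
      using g2 by (intro holomorphic_intros)
    fix z assume "z \<in> ?S"
    then show "y z = (z - z0) powr ((1 - of_nat n) / 2) * (g2 z * (c + P z))"
    proof -
      have "y z / u z = c + P z" using c[OF \<open>z \<in> ?S\<close>] by (simp add: algebra_simps)
      then have "y z = u z * (c + P z)" using u0[OF \<open>z \<in> ?S\<close>] by (simp add: field_simps)
      then show ?thesis by (simp add: u_def)
    qed
  qed
qed (auto intro: holomorphic_on_const)

text \<open>Split \<open>f = f z0 + (z - z0) * q\<close>: for \<open>n > 0\<close> the constant part
  integrates to a pole of order \<open>n\<close> and the rest is the case of lower order, so a
  logarithm can arise only at the end, from a simple pole. The value of \<open>F\<close> at
  \<open>z0\<close> later keeps the second solution exactly at the lower exponent.\<close>

lemma primitive_with_logarithm: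
  assumes "f holomorphic_on ball z0 \<epsilon>"
  shows "\<exists>F c. F holomorphic_on ball z0 \<epsilon> \<and> (n > 0 \<longrightarrow> F z0 = - f z0 / of_nat n) \<and>
    (\<forall>z\<in>slit_disc z0 \<epsilon>. ((\<lambda>z. F z / (z - z0) ^ n + c * Ln (z - z0)) has_field_derivative
      f z / (z - z0) ^ Suc n) (at z))"
  using assms
proof (induction n arbitrary: f)
  case (0 f)
  define q where "q = (\<lambda>z. if z = z0 then deriv f z0 else (f z - f z0) / (z - z0))"
  have "q holomorphic_on ball z0 \<epsilon>"
    unfolding q_def by (rule pole_lemma_open[OF 0 open_ball])
  then obtain F where F: "\<And>z. z \<in> ball z0 \<epsilon> \<Longrightarrow> (F has_field_derivative q z) (at z within ball z0 \<epsilon>)"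
    using holomorphic_convex_primitive'[OF convex_ball open_ball] by metis
  then have F': "(F has_field_derivative q z) (at z)" if "z \<in> ball z0 \<epsilon>" for z
    using that at_within_open[OF that open_ball] by metis
  show ?case
  proof (intro exI conjI ballI impI)
    show "F holomorphic_on ball z0 \<epsilon>"
      using F' by (subst holomorphic_on_open) blast+
    fix z assume z: "z \<in> slit_disc z0 \<epsilon>"
    have "f z = f z0 + (z - z0) * q z"
      using slit_discD[OF z] by (simp add: q_def)
    then show "((\<lambda>z. F z / (z - z0) ^ 0 + f z0 * Ln (z - z0)) has_field_derivative f z / (z - z0) ^ Suc 0) (at z)"
      using slit_discD[OF z] by (auto intro!: derivative_eq_intros F' simp: field_simps)
  qed simp
next
  case (Suc n f)
  define q where "q = (\<lambda>z. if z = z0 then deriv f z0 else (f z - f z0) / (z - z0))"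
  have "q holomorphic_on ball z0 \<epsilon>"
    unfolding q_def by (rule pole_lemma_open[OF Suc.prems open_ball])
  from Suc.IH[OF this] obtain F c where F: "F holomorphic_on ball z0 \<epsilon>"
    and DF: "\<And>z. z \<in> slit_disc z0 \<epsilon> \<Longrightarrow> ((\<lambda>z. F z / (z - z0) ^ n + c * Ln (z - z0)) has_field_derivative
      q z / (z - z0) ^ Suc n) (at z)"
    by blast
  let ?F = "\<lambda>z. - f z0 / of_nat (Suc n) + (z - z0) * F z"
  show ?case
  proof (intro exI conjI ballI impI)
    show "?F holomorphic_on ball z0 \<epsilon>"
      by (intro holomorphic_intros F) simp
    show "?F z0 = - f z0 / of_nat (Suc n)" by simp
    fix z assume z: "z \<in> slit_disc z0 \<epsilon>"
    have w: "z - z0 \<noteq> 0" using slit_discD[OF z] by simp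
    have "((\<lambda>z. inverse ((z - z0) ^ Suc n)) has_field_derivative
        - (inverse ((z - z0) ^ Suc n) * (of_nat (Suc n) * (z - z0) ^ n) * inverse ((z - z0) ^ Suc n))) (at z)"
      by (rule DERIV_inverse') (use w in \<open>auto intro!: derivative_eq_intros simp del: power_Suc\<close>)
    from DERIV_add[OF DERIV_cmult[OF this, of "- f z0 / of_nat (Suc n)"] DF[OF z]]
    have "((\<lambda>z. - f z0 / of_nat (Suc n) * inverse ((z - z0) ^ Suc n) +
        (F z / (z - z0) ^ n + c * Ln (z - z0))) has_field_derivative
        f z / (z - z0) ^ Suc (Suc n)) (at z)"
    proof (rule back_subst[where P = "\<lambda>D. (_ has_field_derivative D) (at z)"])
      have "f z = f z0 + (z - z0) * q z" using w by (simp add: q_def)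
      moreover have "(of_nat (Suc n) :: complex) \<noteq> 0" by (simp del: of_nat_Suc)
      ultimately show "- f z0 / of_nat (Suc n) *
          - (inverse ((z - z0) ^ Suc n) * (of_nat (Suc n) * (z - z0) ^ n) * inverse ((z - z0) ^ Suc n)) +
          q z / (z - z0) ^ Suc n = f z / (z - z0) ^ Suc (Suc n)"
        using w by (simp add: divide_simps del: of_nat_Suc)
    qed
    then show "((\<lambda>z. ?F z / (z - z0) ^ Suc n + c * Ln (z - z0)) has_field_derivative
        f z / (z - z0) ^ Suc (Suc n)) (at z)"
    proof (rule has_field_derivative_transform_within_open[OF _ open_slit_disc z])
      fix x assume "x \<in> slit_disc z0 \<epsilon>"
      then have "x - z0 \<noteq> 0" using slit_discD by fastforce
      then show "- f z0 / of_nat (Suc n) * inverse ((x - z0) ^ Suc n) + (F x / (x - z0) ^ n + c * Ln (x - z0)) =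
          ?F x / (x - z0) ^ Suc n + c * Ln (x - z0)"
        by (simp add: add_divide_distrib diff_divide_distrib inverse_eq_divide del: of_nat_Suc)
    qed
  qed
qed

text \<open>The solution is \<open>y1 \<integral> y1\<^sup>-\<^sup>2\<close>, integrated term by term.\<close>
lemma second_solution:
  assumes "n \<ge> 1" "\<epsilon> > 0"
    and g1: "g1 holomorphic_on ball z0 \<epsilon>" "\<And>z. z \<in> ball z0 \<epsilon> \<Longrightarrow> g1 z \<noteq> 0"
    and y1: "solves_on Q (\<lambda>z. (z - z0) powr ((1 + of_nat n) / 2) * g1 z) (slit_disc z0 \<epsilon>)"
  shows "\<exists>G c. G holomorphic_on ball z0 \<epsilon> \<and> G z0 \<noteq> 0 \<and>
    solves_on Q (\<lambda>z. (z - z0) powr ((1 - of_nat n) / 2) * (G z + c * (z - z0) ^ n * g1 z * Ln (z - z0)))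
      (slit_disc z0 \<epsilon>)"
proof -
  let ?S = "slit_disc z0 \<epsilon>"
  define u where "u = (\<lambda>z. (z - z0) powr ((1 + of_nat n) / 2) * g1 z)"
  note Du = solves_onD[OF y1[folded u_def] open_slit_disc]
  have u0: "u z \<noteq> 0" if "z \<in> ?S" for z
    using g1(2) slit_discD[OF that] by (simp add: u_def)
  have "(\<lambda>z. 1 / g1 z ^ 2) holomorphic_on ball z0 \<epsilon>"
    using g1 by (intro holomorphic_intros) auto
  from primitive_with_logarithm[OF this, of n] \<open>n \<ge> 1\<close> obtain F c where F: "F holomorphic_on ball z0 \<epsilon>"
    "F z0 = - (1 / g1 z0 ^ 2) / of_nat n"
    and DF: "\<And>z. z \<in> ?S \<Longrightarrow> ((\<lambda>z. F z / (z - z0) ^ n + c * Ln (z - z0)) has_field_derivative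
      1 / g1 z ^ 2 / (z - z0) ^ Suc n) (at z)"
    by auto
  define T where "T = (\<lambda>z. F z / (z - z0) ^ n + c * Ln (z - z0))"
  have DT: "(T has_field_derivative 1 / u z ^ 2) (at z)" if "z \<in> ?S" for z
    using DF[OF that] powr_double_nat[of "z - z0" n] slit_discD[OF that]
    by (simp add: T_def u_def power_mult_distrib mult.commute)
  have "solves_on Q (\<lambda>z. u z * T z) ?S"
  proof (rule solves_onI[OF open_slit_disc])
    fix z assume z: "z \<in> ?S"
    show "((\<lambda>z. u z * T z) has_field_derivative deriv u z * T z + 1 / u z) (at z)"
      by (rule derivative_eq_intros Du[OF z] DT[OF z] refl)+ (use u0[OF z] in \<open>simp add: power2_eq_square\<close>)
    have "((\<lambda>z. 1 / u z) has_field_derivative - deriv u z * (1 / u z ^ 2)) (at z)"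
      using DERIV_inverse'[OF Du(1)[OF z] u0[OF z]] by (simp add: inverse_eq_divide power2_eq_square)
    from DERIV_add[OF DERIV_mult[OF Du(2)[OF z] DT[OF z]] this]
    show "((\<lambda>z. deriv u z * T z + 1 / u z) has_field_derivative Q z * (u z * T z)) (at z)"
      by (simp add: algebra_simps)
  qed
  then have *: "solves_on Q (\<lambda>z. (z - z0) powr ((1 - of_nat n) / 2) * (g1 z * F z + c * (z - z0) ^ n * g1 z * Ln (z - z0))) ?S"
  proof (rule solves_on_cong[OF open_slit_disc, THEN iffD1, rotated])
    fix z assume "z \<in> ?S"
    then have w: "z - z0 \<noteq> 0" using slit_discD by fastforce
    have "(z - z0) powr ((1 + of_nat n) / 2) = (z - z0) powr ((1 - of_nat n) / 2 + of_nat n)"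
      by (simp add: field_simps)
    also have "\<dots> = (z - z0) powr ((1 - of_nat n) / 2) * (z - z0) ^ n"
      using w by (simp add: powr_add powr_nat')
    finally show "u z * T z = (z - z0) powr ((1 - of_nat n) / 2) * (g1 z * F z + c * (z - z0) ^ n * g1 z * Ln (z - z0))"
      using w by (simp add: u_def T_def field_simps)
  qed
  show ?thesis
  proof (intro exI conjI)
    show "(\<lambda>z. g1 z * F z) holomorphic_on ball z0 \<epsilon>" by (intro holomorphic_intros g1 F)
    show "g1 z0 * F z0 \<noteq> 0" using F(2) g1(2)[of z0] assms(1,2) by simp
    show "solves_on Q (\<lambda>z. (z - z0) powr ((1 - of_nat n) / 2) * (g1 z * F z + c * (z - z0) ^ n * g1 z * Ln (z - z0))) ?S"
      by (rule *)
  qed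
qed

section \<open>The hypergeometric equation\<close>

lemma fps_nth_X2_deriv2:
  "fps_nth (fps_X ^ 2 * fps_deriv (fps_deriv (f :: complex fps))) j = of_nat j * (of_nat j - 1) * fps_nth f j"
proof (cases "j < 2")
  case True
  then have "j = 0 \<or> j = 1" by auto
  then show ?thesis by (auto simp: fps_X_power_mult_nth)
next
  case False
  then obtain i where "j = Suc (Suc i)" by (metis less_2_cases_iff not0_implies_Suc One_nat_def)
  then show ?thesis
    by (simp add: fps_X_power_mult_nth)
qed

text \<open>The left side acts on the coefficient of index \<open>j\<close> by
  \<open>j * (j - n)\<close>, up to lower coefficients. This is nonzero for
  \<open>0 < j < n\<close>, so these coefficients vanish one after another; at \<open>j = n\<close>
  it is zero, and the equation leaves only \<open>fps_nth R 0 = 0\<close>.\<close>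

lemma fps_indicial_obstruction:
  fixes f A R :: "complex fps"
  assumes eq: "fps_X ^ 2 * fps_deriv (fps_deriv f) + fps_const (1 - of_nat n) * (fps_X * fps_deriv f) +
      fps_const a * f - A * f = fps_X ^ n * R"
    and "fps_nth A 0 = a" "fps_nth f 0 = 0"
  shows "fps_nth R 0 = 0"
proof -
  have coeff: "of_nat j * (of_nat j - of_nat n) * fps_nth f j = fps_nth (fps_X ^ n * R) j"
    if "\<And>i. i < j \<Longrightarrow> fps_nth f i = 0" for j
  proof -
    have "fps_nth (A * f) j = (\<Sum>i\<in>{0..j}. if i = 0 then fps_nth A 0 * fps_nth f j else 0)"
      unfolding fps_mult_nth by (rule sum.cong) (use that in auto)
    then have "fps_nth (A * f) j = a * fps_nth f j"
      using assms(2) by simp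
    then show ?thesis
      unfolding eq[symmetric] fps_sub_nth fps_add_nth fps_mult_left_const_nth fps_nth_X2_deriv2 fps_nth_X_deriv
      by (simp add: algebra_simps)
  qed
  have "fps_nth f j = 0" if "j < n" for j
    using that
  proof (induction j rule: less_induct)
    case (less j)
    show ?case
    proof (cases "j = 0")
      case False
      have "of_nat j * (of_nat j - of_nat n) * fps_nth f j = 0"
        using coeff[of j] less by (simp add: fps_X_power_mult_nth)
      then show ?thesis using False less.prems by auto
    qed (use assms in simp)
  qed
  from coeff[of n, OF this] show ?thesis
    by (simp add: fps_X_power_mult_nth)
qed

text \<open>Since \<open>x / 0 = 0\<close>, all coefficients after index \<open>k\<close> vanish if \<open>d k = 0\<close>.\<close>
fun hyp_coeff :: "(nat \<Rightarrow> complex) \<Rightarrow> (nat \<Rightarrow> complex) \<Rightarrow> nat \<Rightarrow> complex" where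
  "hyp_coeff N d 0 = 1"
| "hyp_coeff N d (Suc k) = hyp_coeff N d k * (N k / d k)"

lemma hyp_coeff_nonzero:
  assumes "\<And>i. i < k \<Longrightarrow> N i \<noteq> 0" "\<And>i. i < k \<Longrightarrow> d i \<noteq> 0"
  shows "hyp_coeff N d k \<noteq> 0"
  using assms by (induction k) auto

lemma hyp_coeff_zero:
  assumes "N i = 0 \<or> d i = 0" "i < k"
  shows "hyp_coeff N d k = 0"
  using assms by (induction k) (auto simp: less_Suc_eq)

lemma fps_conv_radius_hyp_coeff:
  assumes "(\<lambda>k. N k / d k) \<longlonglongrightarrow> 1"
  shows "fps_conv_radius (Abs_fps (hyp_coeff N d)) \<ge> 1"
  unfolding fps_conv_radius_def
proof (rule conv_radius_geI_ex)
  fix r :: real assume "0 < r" "ereal r < 1"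
  then have r: "0 < r" "r < 1" by simp_all
  then obtain c where c: "r < c" "c < 1" using dense by blast
  have "(\<lambda>k. norm (N k / d k) * r) \<longlonglongrightarrow> norm (1 :: complex) * r"
    by (intro tendsto_intros assms)
  then have "eventually (\<lambda>k. norm (N k / d k) * r < c) sequentially"
    using c by (intro order_tendstoD(2)) auto
  then obtain k0 where k0: "\<And>k. k \<ge> k0 \<Longrightarrow> norm (N k / d k) * r < c"
    by (auto simp: eventually_at_top_linorder)
  have "summable (\<lambda>k. hyp_coeff N d k * of_real r ^ k)"
  proof (rule summable_ratio_test[OF \<open>c < 1\<close>])
    fix k assume "k \<ge> k0"
    have "norm (hyp_coeff N d (Suc k) * of_real r ^ Suc k) =
        (norm (N k / d k) * r) * norm (hyp_coeff N d k * of_real r ^ k)"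
      using r by (simp add: norm_mult norm_power norm_divide)
    also have "\<dots> \<le> c * norm (hyp_coeff N d k * of_real r ^ k)"
      using k0[OF \<open>k \<ge> k0\<close>] by (intro mult_right_mono) auto
    finally show "norm (hyp_coeff N d (Suc k) * of_real r ^ Suc k) \<le> c * norm (hyp_coeff N d k * of_real r ^ k)" .
  qed
  with r show "\<exists>z. norm z = r \<and> summable (\<lambda>n. fps_nth (Abs_fps (hyp_coeff N d)) n * z ^ n)"
    by (intro exI[of _ "of_real r"]) simp
qed

text \<open>This is \<open>(k + A) * (k + B)\<close> with \<open>A + B = b - 1/2\<close> and
  \<open>A * B = K\<close>, so the coefficients are those of Gauss's series
  \<open>F(A, B; b; x)\<close>. It stays unfactored because \<open>A\<close> and \<open>B\<close>
  involve a square root.\<close>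

definition hyp_num :: "complex \<Rightarrow> complex \<Rightarrow> nat \<Rightarrow> complex" where
  "hyp_num b K k = of_nat k * (of_nat k - 1) + b * of_nat k + of_nat k / 2 + K"

definition hyp_den :: "complex \<Rightarrow> nat \<Rightarrow> complex" where
  "hyp_den b k = (of_nat k + 1) * (of_nat k + b)"

abbreviation hyp :: "complex \<Rightarrow> complex \<Rightarrow> nat \<Rightarrow> complex" where
  "hyp b K \<equiv> hyp_coeff (hyp_num b K) (hyp_den b)"

lemma hyp_ratio_tendsto: "(\<lambda>k. hyp_num b K k / hyp_den b k) \<longlonglongrightarrow> 1"
proof -
  \<comment> \<open>With \<open>1 / (k + 1)\<close> in place of \<open>1 / k\<close> the rewriting
    also holds at \<open>k = 0\<close>.\<close>
  define t :: "nat \<Rightarrow> complex" where "t = (\<lambda>k. 1 / of_nat (Suc k))"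
  have t: "t \<longlonglongrightarrow> 0"
    using LIMSEQ_Suc[OF lim_const_over_n[of 1]] by (simp add: t_def)
  have "(\<lambda>k. ((1 - t k) * (1 - 2 * t k) + (b + 1 / 2) * t k * (1 - t k) + K * t k * t k) / (1 + (b - 1) * t k))
      \<longlonglongrightarrow> ((1 - 0) * (1 - 2 * 0) + (b + 1 / 2) * 0 * (1 - 0) + K * 0 * 0) / (1 + (b - 1) * 0)"
    by (intro tendsto_intros t) simp
  moreover have "((1 - t k) * (1 - 2 * t k) + (b + 1 / 2) * t k * (1 - t k) + K * t k * t k) / (1 + (b - 1) * t k) =
      hyp_num b K k / hyp_den b k" for k
  proof -
    define x :: complex where "x = of_nat (Suc k)"
    have x: "x \<noteq> 0" unfolding x_def by (rule of_nat_neq_0)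
    have k: "of_nat k = x - 1" and tk: "t k = 1 / x" by (simp_all add: x_def t_def)
    have "hyp_num b K k = x ^ 2 * ((1 - t k) * (1 - 2 * t k) + (b + 1 / 2) * t k * (1 - t k) + K * t k * t k)"
      unfolding hyp_num_def k tk using x by (simp add: field_simps power2_eq_square)
    moreover have "hyp_den b k = x ^ 2 * (1 + (b - 1) * t k)"
      unfolding hyp_den_def k tk using x by (simp add: field_simps power2_eq_square)
    ultimately show ?thesis using x by simp
  qed
  ultimately show ?thesis by simp
qed

text \<open>The right-hand side accounts for the truncation of the series at a zero of the denominator.\<close>
lemma hyp_ode:
  fixes b K x :: complex
  assumes den: "\<And>k. hyp_den b k = 0 \<Longrightarrow> k = k0" and "norm x < 1"
  defines "f \<equiv> Abs_fps (hyp b K)"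
  defines "\<rho> \<equiv> (if hyp_den b k0 = 0 then hyp b K k0 * hyp_num b K k0 else 0)"
  shows "x * (x - 1) * eval_fps (fps_deriv (fps_deriv f)) x + (b * (x - 1) + x / 2) * eval_fps (fps_deriv f) x +
    K * eval_fps f x = \<rho> * x ^ k0"
proof -
  have r: "fps_conv_radius f \<ge> 1"
    unfolding f_def by (rule fps_conv_radius_hyp_coeff) (rule hyp_ratio_tendsto)
  have r': "fps_conv_radius (fps_deriv f) \<ge> 1" using order.trans[OF r fps_conv_radius_deriv] .
  have r'': "fps_conv_radius (fps_deriv (fps_deriv f)) \<ge> 1" using order.trans[OF r' fps_conv_radius_deriv] .
  have const: "fps_conv_radius (fps_const c) \<ge> 1" "fps_conv_radius fps_X \<ge> 1" "fps_conv_radius (fps_X ^ k) \<ge> 1"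
    for c :: complex and k by simp_all
  \<comment> \<open>\<open>?F\<close> preserves the degree of each monomial and \<open>?G\<close>
    lowers it by one, which separates the equation into the factors \<open>hyp_num\<close> and
    \<open>hyp_den\<close> of the recursion.\<close>
  let ?F = "fps_X ^ 2 * fps_deriv (fps_deriv f) + fps_const (b + 1 / 2) * (fps_X * fps_deriv f) + fps_const K * f"
  let ?G = "fps_X * fps_deriv (fps_deriv f) + fps_const b * fps_deriv f"
  have fps: "?F - ?G = fps_const \<rho> * fps_X ^ k0"
  proof (rule fps_ext)
    fix k
    have F: "fps_nth ?F k = hyp_num b K k * hyp b K k"
      unfolding fps_add_nth fps_mult_left_const_nth fps_nth_X2_deriv2 fps_nth_X_deriv
      by (simp add: f_def hyp_num_def algebra_simps)
    have G: "fps_nth ?G k = hyp_den b k * hyp b K (Suc k)"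
      by (cases k) (simp_all add: f_def hyp_den_def algebra_simps del: hyp_coeff.simps(2))
    have "fps_nth (?F - ?G) k = hyp_num b K k * hyp b K k - hyp_den b k * hyp b K (Suc k)"
      unfolding fps_sub_nth F G ..
    also have "\<dots> = (if k = k0 then \<rho> else 0)"
    proof (cases "hyp_den b k = 0")
      case True
      then show ?thesis using den[OF True] by (simp add: \<rho>_def)
    next
      case False
      then have "hyp_den b k * hyp b K (Suc k) = hyp_num b K k * hyp b K k" by simp
      then show ?thesis using False by (auto simp: \<rho>_def simp del: hyp_coeff.simps(2))
    qed
    finally show "fps_nth (?F - ?G) k = fps_nth (fps_const \<rho> * fps_X ^ k0) k"
      unfolding fps_mult_left_const_nth fps_X_power_nth by simp
  qed
  have add: "fps_conv_radius (g + h) \<ge> 1" "eval_fps (g + h) x = eval_fps g x + eval_fps h x"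
    if "fps_conv_radius g \<ge> 1" "fps_conv_radius h \<ge> 1" for g h :: "complex fps"
  proof -
    show "fps_conv_radius (g + h) \<ge> 1"
      by (rule order.trans[OF _ fps_conv_radius_add]) (use that in simp)
    show "eval_fps (g + h) x = eval_fps g x + eval_fps h x"
      by (intro eval_fps_add less_fps_conv_radius \<open>norm x < 1\<close> that)
  qed
  have "eval_fps (?F - ?G) x = x ^ 2 * eval_fps (fps_deriv (fps_deriv f)) x + (b + 1 / 2) * (x * eval_fps (fps_deriv f) x) +
      K * eval_fps f x - (x * eval_fps (fps_deriv (fps_deriv f)) x + b * eval_fps (fps_deriv f) x)"
    by (simp only: eval_fps_unit_disc[OF \<open>norm x < 1\<close>] add fps_conv_radius_ge_1 r r' r'' const eval_fps_X eval_fps_X_power eval_fps_const)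
  moreover have "eval_fps (fps_const \<rho> * fps_X ^ k0) x = \<rho> * x ^ k0"
    by (simp only: eval_fps_unit_disc[OF \<open>norm x < 1\<close>] const eval_fps_X_power eval_fps_const)
  ultimately show ?thesis unfolding fps by (simp add: algebra_simps power2_eq_square)
qed

section \<open>Solutions near a zero of \<open>E4\<close>\<close>

text \<open>\<open>L\<close> and \<open>M\<close> are logarithms of \<open>E4 / (z - z0)\<close> and
  of \<open>Delta\<close>; they provide branches of all complex powers of \<open>E4\<close> and
  \<open>Delta\<close> on the slit disc. The bound in \<open>J_less_1\<close> keeps the variable
  inside the disc of convergence of the hypergeometric series.\<close>

locale E4_zero =
  fixes z0 :: complex and \<epsilon> :: real and L M :: "complex \<Rightarrow> complex"
  assumes radius: "\<epsilon> > 0"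
    and disc: "ball z0 \<epsilon> \<subseteq> upper_half_plane"
    and L: "L holomorphic_on ball z0 \<epsilon>" "\<And>z. z \<in> ball z0 \<epsilon> \<Longrightarrow> E4 z = (z - z0) * exp (L z)"
    and M: "M holomorphic_on ball z0 \<epsilon>" "\<And>z. z \<in> ball z0 \<epsilon> \<Longrightarrow> Delta z = exp (M z)"
    and J_less_1: "\<And>z. z \<in> ball z0 \<epsilon> \<Longrightarrow> norm (E4 z ^ 3 / Delta z) < 1"
begin

text \<open>In the usual normalisation this is \<open>j / 1728\<close>; it has a triple zero at
  \<open>z0\<close>.\<close>

definition J :: "complex \<Rightarrow> complex" where "J z = E4 z ^ 3 / Delta z"

definition T :: "complex \<Rightarrow> complex" where "T z = E6 z / E4 z"

definition unit_part :: "complex \<Rightarrow> complex \<Rightarrow> complex" where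
  "unit_part \<alpha> z = exp (\<alpha> * L z - (1 + 4 * \<alpha>) / 12 * M z)"

text \<open>A branch of \<open>E4\<^sup>\<alpha> \<Delta>\<^sup>\<gamma>\<close> with \<open>\<gamma> = - (1 + 4 \<alpha>) / 12\<close>, formally of weight \<open>-1\<close>.\<close>
definition eta :: "complex \<Rightarrow> complex \<Rightarrow> complex" where
  "eta \<alpha> z = (z - z0) powr \<alpha> * unit_part \<alpha> z"

text \<open>The logarithmic derivative of \<open>eta\<close>, divided by \<open>2 pi i\<close>. The
  \<open>E2\<close> terms with factor \<alpha> coming from \<open>E4\<close> and
  \<open>Delta\<close> cancel, and \<open>- E2 / 12\<close> is what weight -1 leaves.\<close>

definition logderiv :: "complex \<Rightarrow> complex \<Rightarrow> complex" where
  "logderiv \<alpha> z = - E2 z / 12 - \<alpha> / 3 * T z"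

lemma slitD:
  assumes "z \<in> slit_disc z0 \<epsilon>"
  shows "z \<in> ball z0 \<epsilon>" "z \<in> upper_half_plane" "E4 z \<noteq> 0" "Delta z \<noteq> 0" "z - z0 \<noteq> 0" "z - z0 \<notin> \<real>\<^sub>\<le>\<^sub>0"
  using slit_discD[OF assms] disc L(2)[of z] Delta_nonzero[of z] by auto

text \<open>A rewriting of \<open>E6^2 = E4^3 - Delta\<close>. It turns \<open>T^2 * J\<close> into
  \<open>E4\<close> times a function of \<open>J\<close>, so that after removing \<open>E4\<close>
  the equation has coefficients depending on \<open>J\<close> alone.\<close>

lemma T_square_J:
  assumes "z \<in> slit_disc z0 \<epsilon>"
  shows "T z ^ 2 * J z = E4 z * (J z - 1)"
proof -
  have "E4 z * (J z - 1) = E4 z * (E4 z ^ 3 - Delta z) / Delta z"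
    using slitD(4)[OF assms] by (simp add: J_def field_simps)
  also have "\<dots> = E4 z * E6 z ^ 2 / Delta z"
    by (simp add: Delta_def)
  also have "\<dots> = T z ^ 2 * J z"
    using slitD(3)[OF assms] by (simp add: T_def J_def power_divide field_simps power2_eq_square power3_eq_cube)
  finally show ?thesis ..
qed

lemma J_has_field_derivative:
  assumes "z \<in> slit_disc z0 \<epsilon>"
  shows "(J has_field_derivative 2 * of_real pi * \<i> * (- J z * T z)) (at z)"
proof -
  note D = eisenstein_has_field_derivative(2)[OF slitD(2)[OF assms]] Delta_has_field_derivative[OF slitD(2)[OF assms]]
  have "(J has_field_derivative
      (3 * E4 z ^ 2 * (2 * of_real pi * \<i> * ((E2 z * E4 z - E6 z) / 3)) * Delta z -
        E4 z ^ 3 * (2 * of_real pi * \<i> * (E2 z * Delta z))) / (Delta z * Delta z)) (at z)"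
    unfolding J_def by (rule derivative_eq_intros D refl)+ (use slitD(4)[OF assms] in \<open>simp_all add: power2_eq_square\<close>)
  then show ?thesis
    by (rule back_subst[where P = "\<lambda>D. (J has_field_derivative D) (at z)"])
      (use slitD(3,4)[OF assms] in \<open>simp add: J_def T_def field_simps power2_eq_square power3_eq_cube\<close>)
qed

lemma T_has_field_derivative:
  assumes "z \<in> slit_disc z0 \<epsilon>"
  shows "(T has_field_derivative 2 * of_real pi * \<i> * (E2 z * T z / 6 - E4 z / 2 + T z ^ 2 / 3)) (at z)"
proof -
  note D = eisenstein_has_field_derivative(2,3)[OF slitD(2)[OF assms]]
  have "(T has_field_derivative
      ((2 * of_real pi * \<i> * ((E2 z * E6 z - E4 z ^ 2) / 2)) * E4 z -
        E6 z * (2 * of_real pi * \<i> * ((E2 z * E4 z - E6 z) / 3))) / (E4 z * E4 z)) (at z)"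
    unfolding T_def by (intro DERIV_divide D slitD(3)[OF assms])
  then show ?thesis
    by (rule back_subst[where P = "\<lambda>D. (T has_field_derivative D) (at z)"])
      (use slitD(3)[OF assms] in \<open>simp add: T_def field_simps power2_eq_square\<close>)
qed

lemma L_has_field_derivative:
  assumes "z \<in> slit_disc z0 \<epsilon>"
  shows "(L has_field_derivative 2 * of_real pi * \<i> * ((E2 z - T z) / 3) - 1 / (z - z0)) (at z)"
proof -
  note z = slitD[OF assms]
  have DL: "(L has_field_derivative deriv L z) (at z)"
    by (rule holomorphic_derivI[OF L(1) open_ball z(1)])
  have "((\<lambda>z. (z - z0) * exp (L z)) has_field_derivative exp (L z) + (z - z0) * (exp (L z) * deriv L z)) (at z)"
    by (rule derivative_eq_intros DL refl)+ simp
  then have "(E4 has_field_derivative exp (L z) + (z - z0) * (exp (L z) * deriv L z)) (at z)"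
    by (rule has_field_derivative_transform_within_open[OF _ open_ball z(1)]) (simp add: L(2))
  from DERIV_unique[OF this eisenstein_has_field_derivative(2)[OF z(2)]]
  have "exp (L z) * (1 + (z - z0) * deriv L z) = 2 * of_real pi * \<i> * ((E2 z - T z) / 3) * E4 z"
    using z(3) by (simp add: T_def left_diff_distrib) (simp add: algebra_simps)
  then have "exp (L z) * (1 + (z - z0) * deriv L z) = exp (L z) * (2 * of_real pi * \<i> * ((E2 z - T z) / 3) * (z - z0))"
    unfolding L(2)[OF z(1)] by (simp only: mult_ac)
  then have "1 + (z - z0) * deriv L z = 2 * of_real pi * \<i> * ((E2 z - T z) / 3) * (z - z0)"
    by simp
  then have "deriv L z = 2 * of_real pi * \<i> * ((E2 z - T z) / 3) - 1 / (z - z0)"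
    using z(5) by (simp add: field_simps)
  with DL show ?thesis by simp
qed

lemma M_has_field_derivative:
  assumes "z \<in> slit_disc z0 \<epsilon>"
  shows "(M has_field_derivative 2 * of_real pi * \<i> * E2 z) (at z)"
proof -
  note z = slitD[OF assms]
  have DM: "(M has_field_derivative deriv M z) (at z)"
    by (rule holomorphic_derivI[OF M(1) open_ball z(1)])
  have "((\<lambda>z. exp (M z)) has_field_derivative exp (M z) * deriv M z) (at z)"
    by (rule derivative_eq_intros DM refl)+
  then have "(Delta has_field_derivative exp (M z) * deriv M z) (at z)"
    by (rule has_field_derivative_transform_within_open[OF _ open_ball z(1)]) (simp add: M(2))
  from DERIV_unique[OF this Delta_has_field_derivative[OF z(2)]]
  have "exp (M z) * deriv M z = exp (M z) * (2 * of_real pi * \<i> * E2 z)"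
    by (simp add: M(2)[OF z(1)])
  with DM show ?thesis by simp
qed

lemma eta_has_field_derivative:
  assumes "z \<in> slit_disc z0 \<epsilon>"
  shows "(eta \<alpha> has_field_derivative 2 * of_real pi * \<i> * (eta \<alpha> z * logderiv \<alpha> z)) (at z)"
proof -
  note z = slitD[OF assms]
  have eta: "eta \<alpha> x = exp (\<alpha> * Ln (x - z0) + (\<alpha> * L x - (1 + 4 * \<alpha>) / 12 * M x))"
    if "x \<in> slit_disc z0 \<epsilon>" for x
    using slitD[OF that] by (simp add: eta_def unit_part_def powr_def exp_add)
  have "((\<lambda>x. exp (\<alpha> * Ln (x - z0) + (\<alpha> * L x - (1 + 4 * \<alpha>) / 12 * M x))) has_field_derivative
      exp (\<alpha> * Ln (z - z0) + (\<alpha> * L z - (1 + 4 * \<alpha>) / 12 * M z)) *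
      (\<alpha> * (1 / (z - z0)) + (\<alpha> * (2 * of_real pi * \<i> * ((E2 z - T z) / 3) - 1 / (z - z0)) -
        (1 + 4 * \<alpha>) / 12 * (2 * of_real pi * \<i> * E2 z)))) (at z)"
    by (rule derivative_eq_intros L_has_field_derivative[OF assms] M_has_field_derivative[OF assms] refl z)+
      (simp add: field_simps)
  also have "\<alpha> * (1 / (z - z0)) + (\<alpha> * (2 * of_real pi * \<i> * ((E2 z - T z) / 3) - 1 / (z - z0)) -
        (1 + 4 * \<alpha>) / 12 * (2 * of_real pi * \<i> * E2 z)) = 2 * of_real pi * \<i> * logderiv \<alpha> z"
    by (simp add: logderiv_def field_simps)
  also have "exp (\<alpha> * Ln (z - z0) + (\<alpha> * L z - (1 + 4 * \<alpha>) / 12 * M z)) * (2 * of_real pi * \<i> * logderiv \<alpha> z) =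
      2 * of_real pi * \<i> * (eta \<alpha> z * logderiv \<alpha> z)"
    unfolding eta[OF assms] by simp
  finally show ?thesis
    by (rule has_field_derivative_transform_within_open[OF _ open_slit_disc assms]) (simp add: eta)
qed

text \<open>In the variable \<open>J\<close> and after splitting off \<open>eta\<close>, the equation \<open>y'' = Q1 y\<close> becomes
  hypergeometric; all terms with \<open>E2\<close> cancel.\<close>
lemma eta_times_series:
  fixes f :: "complex fps" and \<alpha> r s :: complex
  assumes f: "fps_conv_radius f \<ge> 1"
    and s: "s = - 4 / 9 * (\<alpha> * (\<alpha> - 1))"
    and ode: "\<And>x. norm x < 1 \<Longrightarrow> x * (x - 1) * eval_fps (fps_deriv (fps_deriv f)) x +
      (2 / 3 * (\<alpha> + 1) * (x - 1) + x / 2) * eval_fps (fps_deriv f) x + (1 / 144 + \<alpha> / 6 + r / 4) * eval_fps f x = R x"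
  shows "\<exists>y'. \<forall>z\<in>slit_disc z0 \<epsilon>.
    ((\<lambda>z. eta \<alpha> z * eval_fps f (J z)) has_field_derivative y' z) (at z) \<and>
    (y' has_field_derivative Q1 r s z * (eta \<alpha> z * eval_fps f (J z)) +
      (2 * of_real pi * \<i>) ^ 2 * (eta \<alpha> z * E4 z * R (J z))) (at z)"
proof -
  define c where "c = 2 * of_real pi * \<i>"
  have f': "fps_conv_radius (fps_deriv f) \<ge> 1" using order.trans[OF f fps_conv_radius_deriv] .
  have chain: "((\<lambda>z. eval_fps g (J z)) has_field_derivative eval_fps (fps_deriv g) (J z) * (c * (- J z * T z))) (at z)"
    if "fps_conv_radius g \<ge> 1" "z \<in> slit_disc z0 \<epsilon>" for g z
  proof -
    have "ereal (norm (J z)) < fps_conv_radius g"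
      unfolding J_def by (rule less_fps_conv_radius[OF J_less_1[OF slitD(1)[OF that(2)]] that(1)])
    from DERIV_chain2[OF has_field_derivative_eval_fps[OF this, of UNIV] J_has_field_derivative[OF that(2)]]
    show ?thesis by (simp only: c_def)
  qed
  let ?P = "\<lambda>z. eval_fps f (J z)" and ?P' = "\<lambda>z. eval_fps (fps_deriv f) (J z)"
    and ?P'' = "\<lambda>z. eval_fps (fps_deriv (fps_deriv f)) (J z)"
  define y' where "y' = (\<lambda>z. c * (eta \<alpha> z * (logderiv \<alpha> z * ?P z - J z * T z * ?P' z)))"
  show ?thesis
  proof (intro exI[of _ y'] ballI conjI)
    fix z assume z: "z \<in> slit_disc z0 \<epsilon>"
    note D = eta_has_field_derivative[OF z, folded c_def] J_has_field_derivative[OF z, folded c_def]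
      T_has_field_derivative[OF z, folded c_def] eisenstein_has_field_derivative(1)[OF slitD(2)[OF z], folded c_def]
    have "((\<lambda>z. eta \<alpha> z * ?P z) has_field_derivative
        c * (eta \<alpha> z * logderiv \<alpha> z) * ?P z + ?P' z * (c * (- J z * T z)) * eta \<alpha> z) (at z)"
      by (rule DERIV_mult[OF D(1) chain[OF f z]])
    then show "((\<lambda>z. eta \<alpha> z * ?P z) has_field_derivative y' z) (at z)"
      by (rule back_subst[where P = "\<lambda>D. (_ has_field_derivative D) (at z)"])
        (simp add: y'_def algebra_simps)
    define a where "a = E2 z"
    define b where "b = E4 z"
    define t where "t = T z"
    define j where "j = J z"
    define l where "l = logderiv \<alpha> z"
    define dt where "dt = a * t / 6 - b / 2 + t ^ 2 / 3"
    define dl where "dl = - ((a ^ 2 - b) / 12) / 12 - \<alpha> / 3 * dt"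
    from DERIV_diff[OF DERIV_cdivide[OF DERIV_minus[OF D(4)], of 12] DERIV_cmult[OF D(3), of "\<alpha> / 3"]]
    have Dl: "(logderiv \<alpha> has_field_derivative c * dl) (at z)"
      by (rule back_subst[where P = "\<lambda>D. D", OF _ arg_cong2[where f = "\<lambda>f D. (f has_field_derivative D) (at z)"]])
        (auto simp: logderiv_def[abs_def] dl_def dt_def a_def b_def t_def algebra_simps)
    have D2: "(y' has_field_derivative c * (c * (eta \<alpha> z * l) * (l * ?P z - j * t * ?P' z) +
        eta \<alpha> z * (c * dl * ?P z + l * (?P' z * (c * (- j * t))) -
          ((c * (- j * t) * t + j * (c * dt)) * ?P' z + j * t * (?P'' z * (c * (- j * t))))))) (at z)"
      unfolding y'_def
      by (rule derivative_eq_intros D Dl chain[OF f z] chain[OF f' z] refl)+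
        (simp add: a_def b_def t_def j_def l_def dt_def algebra_simps)
    have e1: "c * (c * (eta \<alpha> z * l) * (l * ?P z - j * t * ?P' z) +
        eta \<alpha> z * (c * dl * ?P z + l * (?P' z * (c * (- j * t))) -
          ((c * (- j * t) * t + j * (c * dt)) * ?P' z + j * t * (?P'' z * (c * (- j * t)))))) =
        c ^ 2 * eta \<alpha> z * ((l ^ 2 + dl) * ?P z + (- 2 * l * j * t + j * t ^ 2 - j * dt) * ?P' z + j ^ 2 * t ^ 2 * ?P'' z)"
      by (simp add: algebra_simps power2_eq_square)
    have rel: "t ^ 2 * j = b * (j - 1)"
      unfolding t_def j_def b_def by (rule T_square_J[OF z])
    \<comment> \<open>The terms in \<open>a^2\<close> and \<open>a * t\<close> cancel,
      \<open>s\<close> is such that \<open>t^2\<close> occurs exactly as in \<open>Q1\<close>, and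
      what remains is a multiple of \<open>E4\<close>. This is the origin of the constant
      \<open>1 / 144 + \<alpha> / 6 + r / 4\<close>.\<close>
    have e2: "l ^ 2 + dl = - (r * b + s * t ^ 2) / 4 + b * (1 / 144 + \<alpha> / 6 + r / 4)"
      unfolding s l_def logderiv_def dl_def dt_def a_def[symmetric] t_def[symmetric]
      by (simp add: field_simps power2_eq_square)
    have e3: "- 2 * l * j * t + j * t ^ 2 - j * dt = 2 / 3 * (\<alpha> + 1) * (t ^ 2 * j) + j * b / 2"
      unfolding l_def logderiv_def dt_def a_def[symmetric] t_def[symmetric]
      by (simp add: field_simps power2_eq_square)
    have e4: "j ^ 2 * t ^ 2 = j * (t ^ 2 * j)"
      by (simp add: power2_eq_square)
    have e5: "- (r * b + s * t ^ 2) / 4 * c ^ 2 = Q1 r s z"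
      by (simp add: Q1_def c_def b_def t_def T_def power_divide field_simps)
    have e6: "R j = j * (j - 1) * ?P'' z + (2 / 3 * (\<alpha> + 1) * (j - 1) + j / 2) * ?P' z + (1 / 144 + \<alpha> / 6 + r / 4) * ?P z"
      unfolding j_def using ode[of "J z"] J_less_1[OF slitD(1)[OF z]] by (simp add: J_def)
    have "c ^ 2 * eta \<alpha> z * ((- (r * b + s * t ^ 2) / 4 + b * (1 / 144 + \<alpha> / 6 + r / 4)) * ?P z +
        (2 / 3 * (\<alpha> + 1) * (b * (j - 1)) + j * b / 2) * ?P' z + j * (b * (j - 1)) * ?P'' z) =
        - (r * b + s * t ^ 2) / 4 * c ^ 2 * (eta \<alpha> z * ?P z) + c ^ 2 * (eta \<alpha> z * b * R j)"
      unfolding e6 by (simp add: field_simps)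
    from D2[unfolded e1 e2 e3 e4 rel, unfolded this e5]
    show "(y' has_field_derivative Q1 r s z * (eta \<alpha> z * ?P z) +
        (2 * of_real pi * \<i>) ^ 2 * (eta \<alpha> z * E4 z * R (J z))) (at z)"
      by (simp only: c_def b_def j_def)
  qed
qed

definition local_part :: "complex \<Rightarrow> complex fps \<Rightarrow> complex \<Rightarrow> complex" where
  "local_part \<alpha> f z = unit_part \<alpha> z * eval_fps f (J z)"

lemma J_holomorphic: "J holomorphic_on ball z0 \<epsilon>"
proof -
  have "(\<lambda>z. ((z - z0) * exp (L z)) ^ 3 / exp (M z)) holomorphic_on ball z0 \<epsilon>"
    by (intro holomorphic_intros L M) simp
  then show ?thesis
    by (rule holomorphic_transform) (simp add: J_def L(2) M(2))
qed

lemma J_z0: "J z0 = 0"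
  using L(2)[of z0] radius by (simp add: J_def)

lemma local_part_holomorphic:
  assumes "fps_conv_radius f \<ge> 1"
  shows "local_part \<alpha> f holomorphic_on ball z0 \<epsilon>"
proof -
  have "eval_fps f \<circ> J holomorphic_on ball z0 \<epsilon>"
  proof (rule holomorphic_on_compose_gen[OF J_holomorphic])
    show "eval_fps f holomorphic_on ball 0 1"
      using less_fps_conv_radius[OF _ assms] by (intro holomorphic_on_eval_fps) auto
    show "J ` ball z0 \<epsilon> \<subseteq> ball 0 1"
      using J_less_1 by (auto simp: J_def)
  qed
  then show ?thesis
    unfolding local_part_def unit_part_def o_def by (intro holomorphic_intros L M)
qed

lemma local_part_z0: "fps_nth f 0 \<noteq> 0 \<Longrightarrow> local_part \<alpha> f z0 \<noteq> 0"
  by (simp add: local_part_def unit_part_def J_z0 eval_fps_at_0)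

text \<open>A solution with exponent \<alpha>, up to an error that is present only when the series
  is cut off at a resonance where the next numerator does not vanish.\<close>

lemma hyp_solution:
  fixes \<alpha> r s :: complex
  assumes s: "s = - 4 / 9 * (\<alpha> * (\<alpha> - 1))"
    and den: "\<And>k. hyp_den (2 / 3 * (\<alpha> + 1)) k = 0 \<Longrightarrow> k = k0"
  defines "b \<equiv> 2 / 3 * (\<alpha> + 1)" and "K \<equiv> 1 / 144 + \<alpha> / 6 + r / 4"
  defines "\<rho> \<equiv> (if hyp_den b k0 = 0 then hyp b K k0 * hyp_num b K k0 else 0)"
  shows "\<exists>y'. \<forall>z\<in>slit_disc z0 \<epsilon>.
    ((\<lambda>z. (z - z0) powr \<alpha> * local_part \<alpha> (Abs_fps (hyp b K)) z) has_field_derivative y' z) (at z) \<and>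
    (y' has_field_derivative Q1 r s z * ((z - z0) powr \<alpha> * local_part \<alpha> (Abs_fps (hyp b K)) z) +
      (2 * of_real pi * \<i>) ^ 2 * (eta \<alpha> z * E4 z * (\<rho> * J z ^ k0))) (at z)"
proof -
  have "\<exists>y'. \<forall>z\<in>slit_disc z0 \<epsilon>.
    ((\<lambda>z. eta \<alpha> z * eval_fps (Abs_fps (hyp b K)) (J z)) has_field_derivative y' z) (at z) \<and>
    (y' has_field_derivative Q1 r s z * (eta \<alpha> z * eval_fps (Abs_fps (hyp b K)) (J z)) +
      (2 * of_real pi * \<i>) ^ 2 * (eta \<alpha> z * E4 z * (\<rho> * J z ^ k0))) (at z)"
  proof (rule eta_times_series[OF _ s])
    show "fps_conv_radius (Abs_fps (hyp b K)) \<ge> 1"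
      by (rule fps_conv_radius_hyp_coeff) (rule hyp_ratio_tendsto)
    fix x :: complex assume "norm x < 1"
    from hyp_ode[where K = K, OF den this]
    show "x * (x - 1) * eval_fps (fps_deriv (fps_deriv (Abs_fps (hyp b K)))) x +
        (2 / 3 * (\<alpha> + 1) * (x - 1) + x / 2) * eval_fps (fps_deriv (Abs_fps (hyp b K))) x +
        (1 / 144 + \<alpha> / 6 + r / 4) * eval_fps (Abs_fps (hyp b K)) x = \<rho> * x ^ k0"
      unfolding \<rho>_def b_def K_def .
  qed
  then show ?thesis
    by (simp only: eta_def local_part_def mult.assoc)
qed

end

text \<open>At a zero of \<open>E4\<close>, Ramanujan's equation gives
  \<open>E4' = - (2 pi i / 3) E6\<close>, which is nonzero since \<open>Delta\<close> is. The zero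
  is therefore simple, and the quotient by \<open>z - z0\<close> has a logarithm on a small
  disc.\<close>

lemma E4_zero_exists:
  assumes "z0 \<in> upper_half_plane" "E4 z0 = 0"
  shows "\<exists>\<epsilon> L M. E4_zero z0 \<epsilon> L M"
proof -
  define e where "e = (\<lambda>z. if z = z0 then deriv E4 z0 else (E4 z - E4 z0) / (z - z0))"
  have hol_e: "e holomorphic_on upper_half_plane"
    unfolding e_def by (rule pole_lemma_open[OF eisenstein_holomorphic(2) open_upper_half_plane])
  have e: "E4 z = (z - z0) * e z" for z
    using assms(2) by (simp add: e_def)
  have hol_Delta: "Delta holomorphic_on upper_half_plane"
    unfolding Delta_def by (intro holomorphic_intros eisenstein_holomorphic)
  have "e z0 \<noteq> 0"
    using DERIV_imp_deriv[OF eisenstein_has_field_derivative(2)[OF assms(1)]] E6_nonzero[OF assms] assms(2)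
    by (simp add: e_def)
  moreover have at: "continuous (at z0) f" if "f holomorphic_on upper_half_plane" for f
    using holomorphic_on_imp_continuous_on[OF that] assms(1)
    by (simp add: continuous_on_eq_continuous_at[OF open_upper_half_plane])
  ultimately have "eventually (\<lambda>z. e z \<noteq> 0) (at z0)"
    using hol_e by (intro tendsto_imp_eventually_ne[of e "e z0"]) (auto simp: isCont_def)
  moreover have "((\<lambda>z. norm (E4 z ^ 3 / Delta z)) \<longlongrightarrow> norm (E4 z0 ^ 3 / Delta z0)) (at z0)"
    using at[OF eisenstein_holomorphic(2)] at[OF hol_Delta] Delta_nonzero[OF assms(1)]
    by (intro tendsto_intros) (auto simp: isCont_def)
  then have "eventually (\<lambda>z. norm (E4 z ^ 3 / Delta z) < 1) (at z0)"
    using assms(2) by (intro order_tendstoD(2)) auto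
  moreover have "eventually (\<lambda>z. z \<in> upper_half_plane) (at z0)"
    by (rule eventually_at_in_open'[OF open_upper_half_plane assms(1)])
  ultimately have "eventually (\<lambda>z. e z \<noteq> 0 \<and> norm (E4 z ^ 3 / Delta z) < 1 \<and> z \<in> upper_half_plane) (at z0)"
    by eventually_elim simp
  then obtain \<epsilon> where \<epsilon>: "\<epsilon> > 0" "\<And>z. z \<noteq> z0 \<Longrightarrow> dist z z0 < \<epsilon> \<Longrightarrow>
      e z \<noteq> 0 \<and> norm (E4 z ^ 3 / Delta z) < 1 \<and> z \<in> upper_half_plane"
    unfolding eventually_at by blast
  have ball: "e z \<noteq> 0" "norm (E4 z ^ 3 / Delta z) < 1" "z \<in> upper_half_plane" if "z \<in> ball z0 \<epsilon>" for z
    using \<epsilon>(2)[of z] that assms \<open>e z0 \<noteq> 0\<close> by (cases "z = z0"; auto simp: dist_commute)+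
  then have sub: "ball z0 \<epsilon> \<subseteq> upper_half_plane" by blast
  obtain L where L: "L holomorphic_on ball z0 \<epsilon>" "\<And>z. z \<in> ball z0 \<epsilon> \<Longrightarrow> e z = exp (L z)"
    using contractible_imp_holomorphic_log[OF holomorphic_on_subset[OF hol_e sub] convex_imp_contractible[OF convex_ball]] ball(1)
    by metis
  obtain M where M: "M holomorphic_on ball z0 \<epsilon>" "\<And>z. z \<in> ball z0 \<epsilon> \<Longrightarrow> Delta z = exp (M z)"
    using contractible_imp_holomorphic_log[OF holomorphic_on_subset[OF hol_Delta sub] convex_imp_contractible[OF convex_ball]]
      Delta_nonzero[OF ball(3)]
    by metis
  have "E4_zero z0 \<epsilon> L M"
    by unfold_locales (use \<epsilon>(1) sub L M ball(2) e in auto)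
  then show ?thesis by blast
qed

section \<open>The obstruction at the larger exponent, and the absence of logarithms\<close>

lemma has_fps_expansion_shift_deriv:
  assumes "\<epsilon> > 0" "f holomorphic_on ball z0 \<epsilon>" "(\<lambda>w. f (z0 + w)) has_fps_expansion F"
  shows "(\<lambda>w. deriv f (z0 + w)) has_fps_expansion fps_deriv F"
proof -
  have "deriv (\<lambda>w. f (z0 + w)) has_fps_expansion fps_deriv F"
    by (rule has_fps_expansion_deriv[OF assms(3)])
  moreover have "eventually (\<lambda>w. w \<in> ball 0 \<epsilon>) (nhds (0 :: complex))"
    using assms(1) by (intro eventually_nhds_in_open) auto
  then have "eventually (\<lambda>w. deriv (\<lambda>w. f (z0 + w)) w = deriv f (z0 + w)) (nhds 0)"
  proof eventually_elim
    case (elim w)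
    have "(f has_field_derivative deriv f (z0 + w)) (at (z0 + w))"
      by (rule holomorphic_derivI[OF assms(2) open_ball]) (use elim in \<open>simp add: dist_norm\<close>)
    moreover have "((\<lambda>w. z0 + w) has_field_derivative 1) (at w)"
      by (auto intro!: derivative_eq_intros)
    ultimately have "((\<lambda>w. f (z0 + w)) has_field_derivative deriv f (z0 + w) * 1) (at w)"
      by (rule DERIV_chain2)
    then show ?case by (simp add: DERIV_imp_deriv)
  qed
  ultimately show ?thesis
    by (simp cong: has_fps_expansion_cong)
qed

text \<open>At the larger exponent, the recursion of Frobenius' method has no solution unless the
  inhomogeneity vanishes to higher order.\<close>
lemma frobenius_obstruction:
  fixes n :: nat and f R A y' y'' :: "complex \<Rightarrow> complex"
  defines "a \<equiv> (1 - of_nat n) / 2"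
  assumes "\<epsilon> > 0"
    and hol: "f holomorphic_on ball z0 \<epsilon>" "R holomorphic_on ball z0 \<epsilon>" "A holomorphic_on ball z0 \<epsilon>"
    and "A z0 = a * (a - 1)" "f z0 = 0"
    and D: "\<And>z. z \<in> slit_disc z0 \<epsilon> \<Longrightarrow> ((\<lambda>z. (z - z0) powr a * f z) has_field_derivative y' z) (at z)"
      "\<And>z. z \<in> slit_disc z0 \<epsilon> \<Longrightarrow> (y' has_field_derivative y'' z) (at z)"
    and eq: "\<And>z. z \<in> slit_disc z0 \<epsilon> \<Longrightarrow> (z - z0) ^ 2 * y'' z =
      A z * ((z - z0) powr a * f z) + (z - z0) powr a * ((z - z0) ^ n * R z)"
  shows "R z0 = 0"
proof -
  let ?l = "\<lambda>z. (z - z0) ^ 2 * deriv (deriv f) z + (1 - of_nat n) * ((z - z0) * deriv f z) + a * (a - 1) * f z - A z * f z"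
  have hol': "deriv f holomorphic_on ball z0 \<epsilon>" "deriv (deriv f) holomorphic_on ball z0 \<epsilon>"
    using hol(1) by (intro holomorphic_deriv open_ball; assumption)+
  have slit: "?l z = (z - z0) ^ n * R z" if z: "z \<in> slit_disc z0 \<epsilon>" for z
  proof -
    have w: "x - z0 \<noteq> 0" "x - z0 \<notin> \<real>\<^sub>\<le>\<^sub>0" "x \<in> ball z0 \<epsilon>" if "x \<in> slit_disc z0 \<epsilon>" for x
      using slit_discD[OF that] by auto
    have Df: "(f has_field_derivative deriv f x) (at x)" "(deriv f has_field_derivative deriv (deriv f) x) (at x)"
      if "x \<in> slit_disc z0 \<epsilon>" for x
      by (rule holomorphic_derivI[OF hol(1) open_ball w(3)[OF that]],
          rule holomorphic_derivI[OF hol'(1) open_ball w(3)[OF that]])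
    have Dp: "((\<lambda>z. (z - z0) powr a) has_field_derivative (x - z0) powr a * (a / (x - z0))) (at x)"
      if "x \<in> slit_disc z0 \<epsilon>" for x
      using w[OF that] by (auto intro!: derivative_eq_intros simp: powr_diff)
    have y': "y' x = (x - z0) powr a * (a / (x - z0) * f x + deriv f x)" if "x \<in> slit_disc z0 \<epsilon>" for x
      using DERIV_unique[OF D(1)[OF that] DERIV_mult[OF Dp[OF that] Df(1)[OF that]]] by (simp add: algebra_simps)
    have "((\<lambda>x. a / (x - z0)) has_field_derivative - a / (z - z0) ^ 2) (at z)"
      by (rule derivative_eq_intros refl)+ (use w[OF z] in \<open>simp_all add: power2_eq_square\<close>)
    from DERIV_mult[OF Dp[OF z] DERIV_add[OF DERIV_mult[OF this Df(1)[OF z]] Df(2)[OF z]]]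
    have "(y' has_field_derivative (z - z0) powr a * (a / (z - z0)) * (a / (z - z0) * f z + deriv f z) +
        (- a / (z - z0) ^ 2 * f z + deriv f z * (a / (z - z0)) + deriv (deriv f) z) * (z - z0) powr a) (at z)"
      by (rule has_field_derivative_transform_within_open[OF _ open_slit_disc z]) (simp add: y')
    note y'' = DERIV_unique[OF D(2)[OF z] this]
    have "w ^ 2 * (p * (a / w) * (a / w * f0 + f1) + (- a / w ^ 2 * f0 + f1 * (a / w) + f2) * p) =
        p * (w ^ 2 * f2 + 2 * a * (w * f1) + a * (a - 1) * f0)" if "w \<noteq> 0" for w p f0 f1 f2 :: complex
      using that by (simp add: field_simps power2_eq_square)
    then have e: "(z - z0) ^ 2 * y'' z = (z - z0) powr a * ((z - z0) ^ 2 * deriv (deriv f) z +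
        2 * a * ((z - z0) * deriv f z) + a * (a - 1) * f z)"
      unfolding y'' using w(1)[OF z] by blast
    have "2 * a = 1 - of_nat n" by (simp add: a_def)
    from e[unfolded this] eq[OF z]
    have "(z - z0) powr a * ((z - z0) ^ 2 * deriv (deriv f) z + (1 - of_nat n) * ((z - z0) * deriv f z) +
        a * (a - 1) * f z) = A z * ((z - z0) powr a * f z) + (z - z0) powr a * ((z - z0) ^ n * R z)"
      by (simp only:)
    also have "\<dots> = (z - z0) powr a * (A z * f z + (z - z0) ^ n * R z)"
      by (simp add: algebra_simps)
    finally show ?thesis using w[OF z] by simp
  qed
  \<comment> \<open>With the power divided out, both sides are holomorphic across the slit, so the
    identity extends to the whole disc and can be compared coefficientwise at
    \<open>z0\<close>.\<close>
  have eq': "?l z = (z - z0) ^ n * R z" if "z \<in> ball z0 \<epsilon>" for z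
  proof (rule analytic_continuation_open[OF open_slit_disc open_ball _ connected_ball slit_disc_subset(1) _ _ slit that])
    have "z0 + of_real (\<epsilon> / 2) \<in> slit_disc z0 \<epsilon>"
      using \<open>\<epsilon> > 0\<close> by (simp add: slit_disc_def dist_norm complex_nonpos_Reals_iff)
    then show "slit_disc z0 \<epsilon> \<noteq> {}" by blast
  qed (intro holomorphic_intros hol hol')+
  have expansion: "\<exists>G. (\<lambda>w. g (z0 + w)) has_fps_expansion G" if "g holomorphic_on ball z0 \<epsilon>" for g
  proof -
    have "g analytic_on {z0}"
      using that \<open>\<epsilon> > 0\<close> by (metis analytic_at centre_in_ball open_ball)
    then show ?thesis using analytic_at_imp_has_fps_expansion by blast
  qed
  obtain F where F: "(\<lambda>w. f (z0 + w)) has_fps_expansion F" using expansion[OF hol(1)] by blast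
  obtain G where G: "(\<lambda>w. R (z0 + w)) has_fps_expansion G" using expansion[OF hol(2)] by blast
  obtain B where B: "(\<lambda>w. A (z0 + w)) has_fps_expansion B" using expansion[OF hol(3)] by blast
  have F': "(\<lambda>w. deriv f (z0 + w)) has_fps_expansion fps_deriv F"
    by (rule has_fps_expansion_shift_deriv[OF \<open>\<epsilon> > 0\<close> hol(1) F])
  have F'': "(\<lambda>w. deriv (deriv f) (z0 + w)) has_fps_expansion fps_deriv (fps_deriv F)"
    by (rule has_fps_expansion_shift_deriv[OF \<open>\<epsilon> > 0\<close> hol'(1) F'])
  have "eventually (\<lambda>w. w \<in> ball 0 \<epsilon>) (nhds (0 :: complex))"
    using \<open>\<epsilon> > 0\<close> by (intro eventually_nhds_in_open) auto
  then have ev: "eventually (\<lambda>w. w ^ 2 * deriv (deriv f) (z0 + w) + (1 - of_nat n) * (w * deriv f (z0 + w)) +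
      a * (a - 1) * f (z0 + w) - A (z0 + w) * f (z0 + w) = w ^ n * R (z0 + w)) (nhds 0)"
  proof eventually_elim
    case (elim w)
    then show ?case using eq'[of "z0 + w"] by (simp add: dist_norm)
  qed
  have l: "(\<lambda>w. w ^ 2 * deriv (deriv f) (z0 + w) + (1 - of_nat n) * (w * deriv f (z0 + w)) +
      a * (a - 1) * f (z0 + w) - A (z0 + w) * f (z0 + w)) has_fps_expansion
      (fps_X ^ 2 * fps_deriv (fps_deriv F) + fps_const (1 - of_nat n) * (fps_X * fps_deriv F) +
      fps_const (a * (a - 1)) * F - B * F)"
    by (intro has_fps_expansion_diff has_fps_expansion_add has_fps_expansion_mult has_fps_expansion_fps_X
        has_fps_expansion_fps_X_power has_fps_expansion_const F F' F'' B)
  have r: "(\<lambda>w. w ^ n * R (z0 + w)) has_fps_expansion (fps_X ^ n * G)"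
    by (intro has_fps_expansion_mult has_fps_expansion_fps_X_power G)
  have eqs: "fps_X ^ 2 * fps_deriv (fps_deriv F) + fps_const (1 - of_nat n) * (fps_X * fps_deriv F) +
      fps_const (a * (a - 1)) * F - B * F = fps_X ^ n * G"
    by (rule fps_expansion_unique_complex[OF l]) (use r has_fps_expansion_cong[OF ev refl] in blast)
  have "fps_nth G 0 = 0"
    by (rule fps_indicial_obstruction[OF eqs])
      (use has_fps_expansion_imp_0_eq_fps_nth_0[OF B] has_fps_expansion_imp_0_eq_fps_nth_0[OF F] assms in simp_all)
  then show ?thesis
    using has_fps_expansion_imp_0_eq_fps_nth_0[OF G] by simp
qed

lemma nonzero_on_smaller_ball:
  fixes g :: "complex \<Rightarrow> complex"
  assumes "g holomorphic_on ball z0 \<epsilon>" "g z0 \<noteq> 0" "\<epsilon> > 0"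
  shows "\<exists>\<delta>>0. \<delta> \<le> \<epsilon> \<and> (\<forall>z\<in>ball z0 \<delta>. g z \<noteq> 0)"
proof -
  have "continuous (at z0) g"
    using holomorphic_on_imp_continuous_on[OF assms(1)] assms(3)
    by (simp add: continuous_on_eq_continuous_at[OF open_ball])
  then obtain \<delta> where "\<delta> > 0" "\<forall>y. dist z0 y < \<delta> \<longrightarrow> g y \<noteq> 0"
    using continuous_at_avoid[of z0 g 0] assms(2) by blast
  then show ?thesis using assms(3) by (intro exI[of _ "min \<delta> \<epsilon>"]) auto
qed

text \<open>Reduction of order gives every solution the form \<open>w^a G\<close>, and
  \<open>no_logarithm\<close> compares this with any representation involving \<open>Ln\<close>.
  Both happen on the smallest of the discs at hand; the identity theorem then spreads
  \<open>h = 0\<close> to the disc of the representation.\<close>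

lemma lower_solution_imp_no_logarithm:
  assumes "n \<ge> 1" "\<epsilon> > 0" "g2 holomorphic_on ball z0 \<epsilon>" "g2 z0 \<noteq> 0"
    and y2: "solves_on Q (\<lambda>z. (z - z0) powr ((1 - of_nat n) / 2) * g2 z) (slit_disc z0 \<epsilon>)"
    and "\<epsilon>' > 0" and y: "solves_on Q y (slit_disc z0 \<epsilon>')"
  shows "\<not> has_log_singularity y z0"
proof
  assume "has_log_singularity y z0"
  then obtain \<epsilon>'' a g h where log: "\<epsilon>'' > 0" "g holomorphic_on ball z0 \<epsilon>''" "h holomorphic_on ball z0 \<epsilon>''"
    "\<exists>z\<in>ball z0 \<epsilon>''. h z \<noteq> 0"
    "\<And>z. z \<in> slit_disc z0 \<epsilon>'' \<Longrightarrow> y z = (z - z0) powr a * (g z + h z * Ln (z - z0))"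
    unfolding has_log_singularity_def by blast
  obtain \<delta>0 where \<delta>0: "\<delta>0 > 0" "\<delta>0 \<le> \<epsilon>" "\<And>z. z \<in> ball z0 \<delta>0 \<Longrightarrow> g2 z \<noteq> 0"
    using nonzero_on_smaller_ball[OF assms(3,4,2)] by blast
  define \<delta> where "\<delta> = min \<delta>0 (min \<epsilon>' \<epsilon>'')"
  have \<delta>: "\<delta> > 0" "\<delta> \<le> \<delta>0" "\<delta> \<le> \<epsilon>" "\<delta> \<le> \<epsilon>'" "\<delta> \<le> \<epsilon>''"
    using \<delta>0 assms(2,6) log(1) by (auto simp: \<delta>_def)
  obtain G where G: "G holomorphic_on ball z0 \<delta>"
    "\<And>z. z \<in> slit_disc z0 \<delta> \<Longrightarrow> y z = (z - z0) powr ((1 - of_nat n) / 2) * G z"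
  proof -
    have "g2 holomorphic_on ball z0 \<delta>"
      using assms(3) by (rule holomorphic_on_subset) (use \<delta> in auto)
    moreover have "g2 z \<noteq> 0" if "z \<in> ball z0 \<delta>" for z
      using \<delta>0(3)[of z] that \<delta> by auto
    ultimately show ?thesis
      using all_solutions_of_lower_solution[OF assms(1) _ _ solves_on_subset[OF y2 slit_disc_subset(2)]
        solves_on_subset[OF y slit_disc_subset(2)]] \<delta> that by metis
  qed
  have h: "h z = 0" if "z \<in> ball z0 \<delta>" for z
  proof (rule no_logarithm[OF \<delta>(1) G(1) _ _ _ that])
    show "g holomorphic_on ball z0 \<delta>" "h holomorphic_on ball z0 \<delta>"
      using log(2,3) \<delta>(5) by (auto intro: holomorphic_on_subset)
    show "(z - z0) powr ((1 - of_nat n) / 2) * G z = (z - z0) powr a * (g z + h z * Ln (z - z0))"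
      if "z \<in> slit_disc z0 \<delta>" for z
      using G(2)[OF that] log(5)[of z] that slit_disc_subset(2)[OF \<delta>(5)] by auto
  qed
  have "h z = 0" if "z \<in> ball z0 \<epsilon>''" for z
    by (rule analytic_continuation_open[of "ball z0 \<delta>" "ball z0 \<epsilon>''" h "\<lambda>_. 0"])
      (use \<delta> log(3) h that in auto)
  with log(4) show False by blast
qed

context E4_zero begin

text \<open>The holomorphic extension of \<open>(z - z0)^2 * Q1 r s z\<close> to
  \<open>z0\<close>.\<close>

definition double_pole_part :: "complex \<Rightarrow> complex \<Rightarrow> complex \<Rightarrow> complex" where
  "double_pole_part r s z = of_real pi ^ 2 * (r * ((z - z0) ^ 2 * E4 z) + s * (E6 z ^ 2 / exp (L z) ^ 2))"

lemma z0_in: "z0 \<in> ball z0 \<epsilon>" "z0 \<in> upper_half_plane" "E4 z0 = 0"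
  using radius disc L(2)[of z0] by auto

lemma double_pole_part_holomorphic: "double_pole_part r s holomorphic_on ball z0 \<epsilon>"
  unfolding double_pole_part_def
  by (intro holomorphic_intros holomorphic_on_subset[OF eisenstein_holomorphic(2) disc]
      holomorphic_on_subset[OF eisenstein_holomorphic(3) disc] L) auto

lemma double_pole_part_eq:
  assumes "z \<in> ball z0 \<epsilon>" "z \<noteq> z0"
  shows "(z - z0) ^ 2 * Q1 r s z = double_pole_part r s z"
proof -
  have "w ^ 2 * (p * (r * b + s * (c / (w * e) ^ 2))) = p * (r * (w ^ 2 * b) + s * (c / e ^ 2))"
    if "w \<noteq> 0" "e \<noteq> 0" for w p b c e :: complex
    using that by (simp add: field_simps power2_eq_square)
  from this[of "z - z0" "exp (L z)" "of_real pi ^ 2" "E4 z" "E6 z ^ 2"] assms(2) show ?thesis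
    unfolding Q1_def double_pole_part_def L(2)[OF assms(1), symmetric] by simp
qed

text \<open>Ramanujan's equation at \<open>z0\<close> gives
  \<open>E4'^2 = - (4 pi^2 / 9) E6^2\<close>, so the leading coefficient of \<open>Q1\<close>
  depends on \<open>s\<close> alone and is the same at every zero of \<open>E4\<close>. Equating it
  with \<open>\<alpha> (\<alpha> - 1)\<close> for \<open>\<alpha> = (1 \<plusminus> n) / 2\<close>
  gives \<open>s = (1 - n^2) / 9\<close>.\<close>

lemma double_pole_part_z0: "double_pole_part r s z0 = - 9 / 4 * s"
proof -
  have DL: "(L has_field_derivative deriv L z0) (at z0)"
    by (rule holomorphic_derivI[OF L(1) open_ball z0_in(1)])
  have "((\<lambda>z. (z - z0) * exp (L z)) has_field_derivative exp (L z0)) (at z0)"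
    by (rule derivative_eq_intros DL refl)+ simp
  then have "(E4 has_field_derivative exp (L z0)) (at z0)"
    by (rule has_field_derivative_transform_within_open[OF _ open_ball z0_in(1)]) (simp add: L(2))
  from DERIV_unique[OF this eisenstein_has_field_derivative(2)[OF z0_in(2)]]
  have "exp (L z0) = - (2 * of_real pi * \<i> / 3) * E6 z0"
    by (simp add: z0_in(3))
  then have "exp (L z0) ^ 2 = - (4 * of_real pi ^ 2 / 9) * E6 z0 ^ 2"
    by (simp add: power_mult_distrib power_divide)
  then show ?thesis
    using E6_nonzero[OF z0_in(2,3)] by (simp add: double_pole_part_def)
qed

lemma double_pole_part_tendsto: "((\<lambda>z. (z - z0) ^ 2 * Q1 r s z) \<longlongrightarrow> - 9 / 4 * s) (at z0)"
proof -
  have "continuous (at z0) (double_pole_part r s)"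
    using holomorphic_on_imp_continuous_on[OF double_pole_part_holomorphic] z0_in(1)
    by (simp add: continuous_on_eq_continuous_at[OF open_ball])
  then have "(double_pole_part r s \<longlongrightarrow> - 9 / 4 * s) (at z0)"
    by (simp add: isCont_def double_pole_part_z0)
  moreover have "eventually (\<lambda>z. z \<in> ball z0 \<epsilon> - {z0}) (at z0)"
    by (rule eventually_at_in_open[OF open_ball z0_in(1)])
  then have "eventually (\<lambda>z. double_pole_part r s z = (z - z0) ^ 2 * Q1 r s z) (at z0)"
    by eventually_elim (simp add: double_pole_part_eq)
  ultimately show ?thesis by (rule Lim_transform_eventually)
qed

lemma local_exponents:
  assumes "s = (1 - of_nat n ^ 2) / 9"
  shows "has_local_exponents (Q1 r s) z0 (1 / 2 + of_nat n / 2) (1 / 2 - of_nat n / 2)"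
  unfolding has_local_exponents_def
  by (rule exI[of _ "- 9 / 4 * s"], rule conjI[OF double_pole_part_tendsto])
    (simp add: assms field_simps power2_eq_square)

lemma is_pole_Q1:
  assumes "s \<noteq> 0"
  shows "is_pole (Q1 r s) z0"
proof -
  have "filterlim (\<lambda>z. double_pole_part r s z / (z - z0) ^ 2) at_infinity (at z0)"
  proof (rule filterlim_divide_at_infinity)
    have "continuous (at z0) (double_pole_part r s)"
      using holomorphic_on_imp_continuous_on[OF double_pole_part_holomorphic] z0_in(1)
      by (simp add: continuous_on_eq_continuous_at[OF open_ball])
    then show "(double_pole_part r s \<longlongrightarrow> - 9 / 4 * s) (at z0)"
      by (simp add: isCont_def double_pole_part_z0)
    have "eventually (\<lambda>z. (z - z0) ^ 2 \<noteq> 0) (at z0)"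
      using eventually_neq_at_within[of z0 z0 UNIV] by (auto elim!: eventually_mono)
    moreover have "((\<lambda>z. (z - z0) ^ 2) \<longlongrightarrow> (z0 - z0) ^ 2) (at z0)"
      by (intro tendsto_intros)
    ultimately show "filterlim (\<lambda>z. (z - z0) ^ 2) (at 0) (at z0)"
      by (simp add: filterlim_at)
  qed (use assms in simp)
  moreover have "eventually (\<lambda>z. z \<in> ball z0 \<epsilon> - {z0}) (at z0)"
    by (rule eventually_at_in_open[OF open_ball z0_in(1)])
  then have ev: "eventually (\<lambda>z. double_pole_part r s z / (z - z0) ^ 2 = Q1 r s z) (at z0)"
  proof eventually_elim
    case (elim z)
    then show ?case using double_pole_part_eq[of z r s, symmetric] by simp
  qed
  ultimately show ?thesis
    unfolding is_pole_def by (simp only: filterlim_cong[OF refl refl ev])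
qed

end

text \<open>In the variable \<open>J\<close> the exponents of this hypergeometric equation are 0 and
  \<open>n / 3\<close>; a resonance occurs only if the second is a positive integer, in the step
  from \<open>k\<close> to \<open>k + 1 = n / 3\<close>.\<close>

lemma hyp_den_lower: "hyp_den (1 - of_nat n / 3) k = 0 \<longleftrightarrow> n = 3 * (k + 1)"
proof -
  have eq: "hyp_den (1 - of_nat n / 3) k = of_nat (k + 1) * (of_nat (3 * (k + 1)) - of_nat n) / 3"
    by (simp add: hyp_den_def field_simps)
  show ?thesis
    unfolding eq divide_eq_0_iff mult_eq_0_iff right_minus_eq of_nat_eq_iff of_nat_eq_0_iff by auto
qed

text \<open>Here the other exponent in \<open>J\<close> is \<open>- n / 3\<close>, which is at most
  0, so the series never meets a resonance.\<close>

lemma hyp_den_upper: "hyp_den (1 + of_nat n / 3) k \<noteq> 0"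
proof -
  have eq: "hyp_den (1 + of_nat n / 3) k = of_nat (k + 1) * of_nat (3 * (k + 1) + n) / 3"
    by (simp add: hyp_den_def field_simps)
  show ?thesis
    unfolding eq divide_eq_0_iff mult_eq_0_iff of_nat_eq_0_iff by auto
qed

text \<open>The constant \<open>K\<close> of \<open>hyp_solution\<close> at
  \<open>\<alpha> = (1 - n) / 2\<close>.\<close>

definition lower_const :: "complex \<Rightarrow> nat \<Rightarrow> complex" where
  "lower_const r n = 1 / 144 + (1 - of_nat n) / 12 + r / 4"

text \<open>Complete the square in \<open>k^2 + (1/2 - m) k + K\<close>. The terms linear in
  \<open>m\<close> cancel, and four times the remaining constant is
  \<open>r + 1/9 - m^2 = r + s\<close>; this is how the sum \<open>r + s\<close> arises.\<close>

lemma hyp_num_lower: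
  assumes "s = (1 - of_nat (3 * m) ^ 2) / 9"
  shows "hyp_num (1 - of_nat (3 * m) / 3) (lower_const r (3 * m)) k = ((2 * of_nat k + 1 / 2 - of_nat m) ^ 2 + (r + s)) / 4"
  unfolding hyp_num_def lower_const_def assms by (simp add: field_simps power2_eq_square)

text \<open>For \<open>k < m\<close> the numbers \<open>2 k + 1/2 - m\<close> increase in steps of
  2. The positive ones are \<open>l + 1/2\<close> with \<open>l = 2 k - m\<close>, the negative ones
  \<open>- (l + 1/2)\<close> with \<open>l = m - 2 k - 1\<close>. The two families have opposite
  parities of \<open>l\<close> and together exhaust \<open>l < m\<close>.\<close>

lemma half_integer_parity:
  fixes x :: complex
  shows "(\<exists>k<m. (2 * of_nat k + 1 / 2 - of_nat m) ^ 2 + x = 0) \<longleftrightarrow> (\<exists>l<m. x = - (of_nat l + 1 / 2)\<^sup>2)"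
proof
  assume "\<exists>k<m. (2 * of_nat k + 1 / 2 - of_nat m) ^ 2 + x = 0"
  then obtain k where k: "k < m" "x = - (2 * of_nat k + 1 / 2 - of_nat m)\<^sup>2"
    by (auto simp: add_eq_0_iff)
  show "\<exists>l<m. x = - (of_nat l + 1 / 2)\<^sup>2"
  proof (cases "m \<le> 2 * k")
    case True
    then have "(of_nat (2 * k - m) :: complex) = 2 * of_nat k - of_nat m" by (simp add: of_nat_diff)
    then have "x = - (of_nat (2 * k - m) + 1 / 2)\<^sup>2" unfolding k(2) by (simp only:) (simp add: algebra_simps)
    then show ?thesis using k(1) by (intro exI[of _ "2 * k - m"]) auto
  next
    case False
    then have "(of_nat (m - 2 * k - 1) :: complex) = of_nat m - 2 * of_nat k - 1" by (simp add: of_nat_diff)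
    then have "of_nat (m - 2 * k - 1) + 1 / 2 = - (2 * of_nat k + 1 / 2 - of_nat m :: complex)" by simp
    then have "x = - (of_nat (m - 2 * k - 1) + 1 / 2)\<^sup>2" unfolding k(2) by (simp only: power2_minus)
    then show ?thesis using False by (intro exI[of _ "m - 2 * k - 1"]) auto
  qed
next
  assume "\<exists>l<m. x = - (of_nat l + 1 / 2)\<^sup>2"
  then obtain l where l: "l < m" "x = - (of_nat l + 1 / 2)\<^sup>2" by blast
  show "\<exists>k<m. (2 * of_nat k + 1 / 2 - of_nat m) ^ 2 + x = 0"
  proof (cases "even (m + l)")
    case True
    then obtain k where k: "m + l = 2 * k" by blast
    then have "of_nat m + of_nat l = (2 * of_nat k :: complex)" by (metis of_nat_add of_nat_mult of_nat_numeral)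
    then have "2 * of_nat k + 1 / 2 - of_nat m = (of_nat l + 1 / 2 :: complex)" by (simp flip: \<open>_ = 2 * of_nat k\<close>)
    then have "(2 * of_nat k + 1 / 2 - of_nat m) ^ 2 + x = 0" unfolding l(2) by (simp only: right_minus)
    then show ?thesis using k l(1) by (intro exI[of _ k]) auto
  next
    case False
    then obtain k where k: "m = 2 * k + 1 + l"
      using l(1) by (metis add.commute add.left_commute even_add less_imp_add_positive oddE odd_add)
    then have "2 * of_nat k + 1 / 2 - of_nat m = - (of_nat l + 1 / 2 :: complex)" by simp
    then have "(2 * of_nat k + 1 / 2 - of_nat m) ^ 2 + x = 0" unfolding l(2) by (simp only: power2_minus right_minus)
    then show ?thesis using k l(1) by (intro exI[of _ k]) auto
  qed
qed

text \<open>The coefficient of index \<open>m - 1\<close> is a product of quotients whose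
  denominators are nonzero below the resonance, so together with the numerator at
  \<open>m - 1\<close> it vanishes exactly when one of the first \<open>m\<close> numerators
  does.\<close>

lemma truncation_iff:
  assumes "m \<ge> 1" "s = (1 - of_nat (3 * m) ^ 2) / 9"
  shows "hyp (1 - of_nat (3 * m) / 3) (lower_const r (3 * m)) (m - 1) * hyp_num (1 - of_nat (3 * m) / 3) (lower_const r (3 * m)) (m - 1) = 0
    \<longleftrightarrow> (\<exists>l<m. r + s = - (of_nat l + 1 / 2)\<^sup>2)" (is "?h * ?n (m - 1) = 0 \<longleftrightarrow> _")
proof -
  have den: "hyp_den (1 - of_nat (3 * m) / 3) k \<noteq> 0" if "k < m - 1" for k
    using that unfolding hyp_den_lower by simp
  have "?h * ?n (m - 1) = 0 \<longleftrightarrow> (\<exists>k<m. ?n k = 0)"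
  proof
    assume *: "?h * ?n (m - 1) = 0"
    show "\<exists>k<m. ?n k = 0"
    proof (rule ccontr)
      assume none: "\<not> (\<exists>k<m. ?n k = 0)"
      then have "?h \<noteq> 0" using den by (intro hyp_coeff_nonzero) auto
      with * none assms(1) show False by auto
    qed
  next
    assume "\<exists>k<m. ?n k = 0"
    then obtain k where k: "k < m" "?n k = 0" by blast
    show "?h * ?n (m - 1) = 0"
    proof (cases "k = m - 1")
      case False
      then have "?h = 0" using k by (intro hyp_coeff_zero[of _ k]) auto
      then show ?thesis by simp
    qed (use k in simp)
  qed
  also have "\<dots> \<longleftrightarrow> (\<exists>k<m. (2 * of_nat k + 1 / 2 - of_nat m) ^ 2 + (r + s) = 0)"
    unfolding hyp_num_lower[OF assms(2)] by simp
  finally show ?thesis unfolding half_integer_parity .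
qed

context E4_zero begin

text \<open>If 3 divides \<open>n\<close>, then \<open>k0\<close> is the resonant index
  \<open>n / 3 - 1\<close>. For other \<open>n\<close> the denominator has no zero, and
  \<open>\<rho>\<close> is 0.\<close>

lemma lower_solution:
  fixes r s :: complex and n :: nat
  assumes s: "s = (1 - of_nat n ^ 2) / 9"
  defines "a \<equiv> (1 - of_nat n) / 2" and "b \<equiv> 1 - of_nat n / 3" and "k0 \<equiv> n div 3 - 1"
  defines "\<rho> \<equiv> (if hyp_den b k0 = 0 then hyp b (lower_const r n) k0 * hyp_num b (lower_const r n) k0 else 0)"
  shows "\<exists>y'. \<forall>z\<in>slit_disc z0 \<epsilon>.
    ((\<lambda>z. (z - z0) powr a * local_part a (Abs_fps (hyp b (lower_const r n))) z) has_field_derivative y' z) (at z) \<and>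
    (y' has_field_derivative Q1 r s z * ((z - z0) powr a * local_part a (Abs_fps (hyp b (lower_const r n))) z) +
      (2 * of_real pi * \<i>) ^ 2 * (eta a z * E4 z * (\<rho> * J z ^ k0))) (at z)"
proof -
  have b: "2 / 3 * (a + 1) = b" and K: "1 / 144 + a / 6 + r / 4 = lower_const r n"
    by (simp_all add: a_def b_def lower_const_def field_simps)
  have s': "s = - 4 / 9 * (a * (a - 1))"
    by (simp add: s a_def field_simps power2_eq_square)
  have "k = k0" if "hyp_den (2 / 3 * (a + 1)) k = 0" for k
    using that unfolding b by (simp add: b_def hyp_den_lower k0_def)
  from hyp_solution[OF s' this, of r] show ?thesis
    unfolding b K \<rho>_def .
qed

lemma upper_solution:
  fixes r s :: complex and n :: nat
  assumes s: "s = (1 - of_nat n ^ 2) / 9"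
  shows "\<exists>g1. g1 holomorphic_on ball z0 \<epsilon> \<and> g1 z0 \<noteq> 0 \<and>
    solves_on (Q1 r s) (\<lambda>z. (z - z0) powr ((1 + of_nat n) / 2) * g1 z) (slit_disc z0 \<epsilon>)"
proof -
  define a :: complex where "a = (1 + of_nat n) / 2"
  define b :: complex where "b = 1 + of_nat n / 3"
  define K where "K = 1 / 144 + a / 6 + r / 4"
  have b: "2 / 3 * (a + 1) = b" by (simp add: a_def b_def field_simps)
  have s': "s = - 4 / 9 * (a * (a - 1))"
    by (simp add: s a_def field_simps power2_eq_square)
  have den: "hyp_den b k \<noteq> 0" for k unfolding b_def by (rule hyp_den_upper)
  then have "hyp_den (2 / 3 * (a + 1)) k = 0 \<Longrightarrow> k = 0" for k unfolding b by simp
  from hyp_solution[OF s' this, of r] obtain y' where y':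
    "\<And>z. z \<in> slit_disc z0 \<epsilon> \<Longrightarrow> ((\<lambda>z. (z - z0) powr a * local_part a (Abs_fps (hyp b K)) z) has_field_derivative y' z) (at z)"
    "\<And>z. z \<in> slit_disc z0 \<epsilon> \<Longrightarrow> (y' has_field_derivative Q1 r s z * ((z - z0) powr a * local_part a (Abs_fps (hyp b K)) z)) (at z)"
    unfolding b K_def[symmetric] using den by auto
  have "solves_on (Q1 r s) (\<lambda>z. (z - z0) powr a * local_part a (Abs_fps (hyp b K)) z) (slit_disc z0 \<epsilon>)"
    by (rule solves_onI[OF open_slit_disc y'])
  moreover have "local_part a (Abs_fps (hyp b K)) holomorphic_on ball z0 \<epsilon>"
    by (intro local_part_holomorphic fps_conv_radius_hyp_coeff hyp_ratio_tendsto)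
  moreover have "local_part a (Abs_fps (hyp b K)) z0 \<noteq> 0"
    by (rule local_part_z0) simp
  ultimately show ?thesis unfolding a_def by blast
qed

text \<open>The third hypothesis makes the error term vanish, so the series at the smaller exponent
  is an exact solution with nonzero leading coefficient.\<close>

lemma no_logarithm_if_truncated:
  assumes "n \<ge> 1" "s = (1 - of_nat n ^ 2) / 9"
    and "3 dvd n \<Longrightarrow> hyp (1 - of_nat n / 3) (lower_const r n) (n div 3 - 1) *
      hyp_num (1 - of_nat n / 3) (lower_const r n) (n div 3 - 1) = 0"
    and "\<epsilon>' > 0" "solves_on (Q1 r s) y (slit_disc z0 \<epsilon>')"
  shows "\<not> has_log_singularity y z0"
proof -
  define a :: complex where "a = (1 - of_nat n) / 2"
  define f where "f = Abs_fps (hyp (1 - of_nat n / 3) (lower_const r n))"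
  have "3 dvd n" if "hyp_den (1 - of_nat n / 3) (n div 3 - 1) = 0"
    using that unfolding hyp_den_lower by (metis dvd_triv_left)
  then have 0: "(if hyp_den (1 - of_nat n / 3) (n div 3 - 1) = 0
      then hyp (1 - of_nat n / 3) (lower_const r n) (n div 3 - 1) *
        hyp_num (1 - of_nat n / 3) (lower_const r n) (n div 3 - 1) else 0) = 0"
    using assms(3) by presburger
  from lower_solution[OF assms(2), of r] obtain y' where y':
    "\<And>z. z \<in> slit_disc z0 \<epsilon> \<Longrightarrow> ((\<lambda>z. (z - z0) powr a * local_part a f z) has_field_derivative y' z) (at z)"
    "\<And>z. z \<in> slit_disc z0 \<epsilon> \<Longrightarrow> (y' has_field_derivative Q1 r s z * ((z - z0) powr a * local_part a f z)) (at z)"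
    unfolding 0 a_def[symmetric] f_def[symmetric] by auto
  have "solves_on (Q1 r s) (\<lambda>z. (z - z0) powr ((1 - of_nat n) / 2) * local_part a f z) (slit_disc z0 \<epsilon>)"
    using solves_onI[OF open_slit_disc y'] by (simp only: a_def)
  moreover have "local_part a f holomorphic_on ball z0 \<epsilon>"
    unfolding f_def by (intro local_part_holomorphic fps_conv_radius_hyp_coeff hyp_ratio_tendsto)
  moreover have "local_part a f z0 \<noteq> 0"
    by (rule local_part_z0) (simp add: f_def)
  ultimately show ?thesis
    using lower_solution_imp_no_logarithm[OF assms(1) radius] assms(4,5) by blast
qed

text \<open>If the second solution has no logarithm, then it and the truncated hypergeometric
  solution, which satisfies the equation up to a term of order exactly \<open>n\<close>, contradict
  the obstruction at the larger exponent.\<close>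
lemma truncated_if_no_logarithm:
  assumes "m \<ge> 1" and n: "n = 3 * m" and s: "s = (1 - of_nat n ^ 2) / 9"
    and nolog: "\<And>\<epsilon>' y. \<epsilon>' > 0 \<Longrightarrow> solves_on (Q1 r s) y (slit_disc z0 \<epsilon>') \<Longrightarrow> \<not> has_log_singularity y z0"
  shows "hyp (1 - of_nat n / 3) (lower_const r n) (m - 1) * hyp_num (1 - of_nat n / 3) (lower_const r n) (m - 1) = 0"
proof -
  have "n \<ge> 1" using assms by simp
  define a :: complex where "a = (1 - of_nat n) / 2"
  define p where "p = local_part a (Abs_fps (hyp (1 - of_nat n / 3) (lower_const r n)))"
  define \<rho> where "\<rho> = hyp (1 - of_nat n / 3) (lower_const r n) (m - 1) * hyp_num (1 - of_nat n / 3) (lower_const r n) (m - 1)"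
  obtain g1 where g1: "g1 holomorphic_on ball z0 \<epsilon>" "g1 z0 \<noteq> 0"
    "solves_on (Q1 r s) (\<lambda>z. (z - z0) powr ((1 + of_nat n) / 2) * g1 z) (slit_disc z0 \<epsilon>)"
    using upper_solution[OF s] by blast
  obtain \<delta> where \<delta>: "\<delta> > 0" "\<delta> \<le> \<epsilon>" "\<And>z. z \<in> ball z0 \<delta> \<Longrightarrow> g1 z \<noteq> 0"
    using nonzero_on_smaller_ball[OF g1(1,2) radius] by blast
  have sub: "ball z0 \<delta> \<subseteq> ball z0 \<epsilon>" "slit_disc z0 \<delta> \<subseteq> slit_disc z0 \<epsilon>"
    using \<delta>(2) slit_disc_subset(2) by auto
  have g1': "g1 holomorphic_on ball z0 \<delta>"
    using g1(1) sub(1) by (rule holomorphic_on_subset)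
  from second_solution[OF \<open>n \<ge> 1\<close> \<delta>(1) g1' \<delta>(3) solves_on_subset[OF g1(3) sub(2)]]
  obtain G c where G: "G holomorphic_on ball z0 \<delta>" "G z0 \<noteq> 0"
    and y2: "solves_on (Q1 r s) (\<lambda>z. (z - z0) powr a * (G z + c * (z - z0) ^ n * g1 z * Ln (z - z0))) (slit_disc z0 \<delta>)"
    unfolding a_def[symmetric] by blast
  have "c = 0"
  proof (rule ccontr)
    assume "c \<noteq> 0"
    have "has_log_singularity (\<lambda>z. (z - z0) powr a * (G z + c * (z - z0) ^ n * g1 z * Ln (z - z0))) z0"
      unfolding has_log_singularity_def
    proof (intro exI conjI)
      show "\<delta> > 0" "G holomorphic_on ball z0 \<delta>" by fact+
      show "(\<lambda>z. c * (z - z0) ^ n * g1 z) holomorphic_on ball z0 \<delta>"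
        by (intro holomorphic_intros g1')
      have "z0 + of_real (\<delta> / 2) \<in> ball z0 \<delta>" using \<delta>(1) by (simp add: dist_norm)
      moreover from this have "c * (z0 + of_real (\<delta> / 2) - z0) ^ n * g1 (z0 + of_real (\<delta> / 2)) \<noteq> 0"
        using \<delta>(1) \<delta>(3) \<open>c \<noteq> 0\<close> by auto
      ultimately show "\<exists>z\<in>ball z0 \<delta>. c * (z - z0) ^ n * g1 z \<noteq> 0" by blast
      show "\<forall>z\<in>slit_disc z0 \<delta>. (z - z0) powr a * (G z + c * (z - z0) ^ n * g1 z * Ln (z - z0)) =
          (z - z0) powr a * (G z + c * (z - z0) ^ n * g1 z * Ln (z - z0))"
        by simp
    qed
    with nolog[OF \<delta>(1) y2] show False by blast
  qed
  define u where "u = (\<lambda>z. (z - z0) powr a * G z)"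
  have u: "solves_on (Q1 r s) u (slit_disc z0 \<delta>)"
    using y2 by (simp add: u_def \<open>c = 0\<close>)
  have "hyp_den (1 - of_nat n / 3) (m - 1) = 0"
    unfolding hyp_den_lower using assms(1) n by simp
  with lower_solution[OF s, of r] obtain y' where y':
    "\<And>z. z \<in> slit_disc z0 \<epsilon> \<Longrightarrow> ((\<lambda>z. (z - z0) powr a * p z) has_field_derivative y' z) (at z)"
    "\<And>z. z \<in> slit_disc z0 \<epsilon> \<Longrightarrow> (y' has_field_derivative Q1 r s z * ((z - z0) powr a * p z) +
      (2 * of_real pi * \<i>) ^ 2 * (eta a z * E4 z * (\<rho> * J z ^ (m - 1)))) (at z)"
    unfolding a_def[symmetric] p_def[symmetric] \<rho>_def by (auto simp: n)
  have hol_p: "p holomorphic_on ball z0 \<epsilon>"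
    unfolding p_def by (intro local_part_holomorphic fps_conv_radius_hyp_coeff hyp_ratio_tendsto)
  have "p z0 \<noteq> 0"
    unfolding p_def by (rule local_part_z0) simp
  \<comment> \<open>Multiplied by \<open>(z - z0)^2\<close>, the error term has order
    \<open>2 + 1 + 3 (m - 1) = n\<close> relative to the power of exponent \<open>a\<close>, exactly
    the resonant one. \<open>R\<close> is the resulting cofactor, and \<open>R z0\<close> is a
    nonzero multiple of \<open>\<rho>\<close>.\<close>
  define R where "R = (\<lambda>z. - G z0 * (2 * of_real pi * \<i>) ^ 2 * \<rho> * unit_part a z * exp (L z) * (exp (L z) ^ 3 / exp (M z)) ^ (m - 1))"
  \<comment> \<open>The exact solution and the truncated one both have the smaller exponent. The
    combination used here cancels their leading coefficients, while the error of the truncated one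
    survives.\<close>
  have "R z0 = 0"
  proof (rule frobenius_obstruction[OF \<delta>(1), where n = n and f = "\<lambda>z. p z0 * G z - G z0 * p z" and R = R
        and A = "double_pole_part r s", folded a_def])
    show "(\<lambda>z. p z0 * G z - G z0 * p z) holomorphic_on ball z0 \<delta>"
      by (intro holomorphic_intros G holomorphic_on_subset[OF hol_p sub(1)])
    show "R holomorphic_on ball z0 \<delta>"
      unfolding R_def unit_part_def
      by (intro holomorphic_intros holomorphic_on_subset[OF L(1) sub(1)] holomorphic_on_subset[OF M(1) sub(1)]) auto
    show "double_pole_part r s holomorphic_on ball z0 \<delta>"
      by (rule holomorphic_on_subset[OF double_pole_part_holomorphic sub(1)])
    show "double_pole_part r s z0 = a * (a - 1)"
      by (simp add: double_pole_part_z0 s a_def field_simps power2_eq_square)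
    show "p z0 * G z0 - G z0 * p z0 = 0" by simp
    fix z assume z: "z \<in> slit_disc z0 \<delta>"
    then have z': "z \<in> slit_disc z0 \<epsilon>" using sub by blast
    note Du = solves_onD[OF u open_slit_disc z]
    have "((\<lambda>z. p z0 * u z - G z0 * ((z - z0) powr a * p z)) has_field_derivative p z0 * deriv u z - G z0 * y' z) (at z)"
      by (intro DERIV_diff DERIV_cmult Du(1) y'(1) z')
    then show "((\<lambda>z. (z - z0) powr a * (p z0 * G z - G z0 * p z)) has_field_derivative p z0 * deriv u z - G z0 * y' z) (at z)"
      by (simp add: u_def algebra_simps)
    let ?y'' = "\<lambda>z. p z0 * (Q1 r s z * u z) - G z0 * (Q1 r s z * ((z - z0) powr a * p z) +
      (2 * of_real pi * \<i>) ^ 2 * (eta a z * E4 z * (\<rho> * J z ^ (m - 1))))"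
    show "((\<lambda>z. p z0 * deriv u z - G z0 * y' z) has_field_derivative ?y'' z) (at z)"
      by (intro DERIV_diff DERIV_cmult Du(2) y'(2) z')
    have w: "(z - z0) ^ 2 * ((z - z0) * (((z - z0) ^ 3) ^ (m - 1))) = (z - z0) ^ n"
    proof -
      have "n = 2 + (1 + 3 * (m - 1))" using n assms(1) by simp
      then show ?thesis by (simp only: power_add power_mult power_one_right)
    qed
    have J: "J z ^ (m - 1) = ((z - z0) ^ 3) ^ (m - 1) * (exp (L z) ^ 3 / exp (M z)) ^ (m - 1)"
      using slitD(1)[OF z'] by (simp add: J_def L(2) M(2) power_mult_distrib power_divide)
    have "(z - z0) ^ 2 * ?y'' z = ((z - z0) ^ 2 * Q1 r s z) * (p z0 * u z - G z0 * ((z - z0) powr a * p z)) -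
        G z0 * (2 * of_real pi * \<i>) ^ 2 * ((z - z0) ^ 2 * (eta a z * E4 z * (\<rho> * J z ^ (m - 1))))"
      by (simp add: algebra_simps)
    also have "(z - z0) ^ 2 * (eta a z * E4 z * (\<rho> * J z ^ (m - 1))) =
        (z - z0) powr a * (((z - z0) ^ 2 * ((z - z0) * (((z - z0) ^ 3) ^ (m - 1)))) *
          (\<rho> * unit_part a z * exp (L z) * (exp (L z) ^ 3 / exp (M z)) ^ (m - 1)))"
      unfolding J eta_def L(2)[OF slitD(1)[OF z']] by (simp only: mult_ac)
    also have "(z - z0) ^ 2 * Q1 r s z = double_pole_part r s z"
      using slitD(1,5)[OF z'] by (intro double_pole_part_eq) auto
    finally show "(z - z0) ^ 2 * ?y'' z = double_pole_part r s z * ((z - z0) powr a * (p z0 * G z - G z0 * p z)) +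
        (z - z0) powr a * ((z - z0) ^ n * R z)"
      unfolding w R_def u_def by (simp add: algebra_simps)
  qed
  then show ?thesis
    using \<open>G z0 \<noteq> 0\<close> by (simp add: R_def unit_part_def \<rho>_def)
qed

end

section \<open>Apparentness\<close>

lemma Q1_meromorphic: "Q1 r s meromorphic_on upper_half_plane"
proof -
  have "E4 meromorphic_on upper_half_plane" "E6 meromorphic_on upper_half_plane"
    using eisenstein_holomorphic
    by (auto intro!: analytic_on_imp_meromorphic_on simp: analytic_on_open[OF open_upper_half_plane])
  then show ?thesis
    unfolding Q1_def by (intro meromorphic_intros)
qed

lemma Q1_pole_imp_E4_zero:
  assumes "z0 \<in> upper_half_plane" "is_pole (Q1 r s) z0"
  shows "E4 z0 = 0"
proof (rule ccontr)
  assume "E4 z0 \<noteq> 0"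
  have "isCont E4 z0" "isCont E6 z0"
    using eisenstein_has_field_derivative(2,3)[OF assms(1)] DERIV_isCont by blast+
  then have "isCont (Q1 r s) z0"
    unfolding Q1_def using \<open>E4 z0 \<noteq> 0\<close> by (intro continuous_intros) auto
  then have "(Q1 r s \<longlongrightarrow> Q1 r s z0) (at z0)" by (simp add: isCont_def)
  moreover have "filterlim (Q1 r s) at_infinity (at z0)" using assms(2) by (simp add: is_pole_def)
  ultimately show False using not_tendsto_and_filterlim_at_infinity[OF at_neq_bot] by blast
qed

lemma Q1_apparentI:
  assumes "n \<ge> 1" "s = (1 - of_nat n ^ 2) / 9"
    and "3 dvd n \<Longrightarrow> hyp (1 - of_nat n / 3) (lower_const r n) (n div 3 - 1) *
      hyp_num (1 - of_nat n / 3) (lower_const r n) (n div 3 - 1) = 0"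
  shows "apparent (Q1 r s)"
  unfolding apparent_def
proof (intro conjI ballI impI allI)
  fix z0 assume z0: "z0 \<in> upper_half_plane" "is_pole (Q1 r s) z0"
  obtain \<epsilon> L M where "E4_zero z0 \<epsilon> L M"
    using E4_zero_exists[OF z0(1) Q1_pole_imp_E4_zero[OF z0]] by blast
  then interpret E4_zero z0 \<epsilon> L M .
  show "\<exists>k::nat. has_local_exponents (Q1 r s) z0 (1 / 2 + of_nat k / 2) (1 / 2 - of_nat k / 2)"
    using local_exponents[OF assms(2)] by blast
  show "\<not> has_log_singularity y z0" if "\<epsilon>' > 0" "solves_on (Q1 r s) y (slit_disc z0 \<epsilon>')" for \<epsilon>' y
    by (rule no_logarithm_if_truncated[OF assms that])
qed (rule Q1_meromorphic)

text \<open>Apparentness constrains only actual poles. \<open>E4\<close> has a zero, and it is a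
  pole of \<open>Q1\<close> because \<open>s\<close> vanishes only for \<open>n = 1\<close>, which
  \<open>n = 3 * m\<close> excludes.\<close>

lemma Q1_apparentD:
  assumes "m \<ge> 1" "n = 3 * m" "s = (1 - of_nat n ^ 2) / 9" "apparent (Q1 r s)"
  shows "hyp (1 - of_nat n / 3) (lower_const r n) (m - 1) * hyp_num (1 - of_nat n / 3) (lower_const r n) (m - 1) = 0"
proof -
  obtain z0 where z0: "z0 \<in> upper_half_plane" "E4 z0 = 0" using E4_has_zero by blast
  obtain \<epsilon> L M where "E4_zero z0 \<epsilon> L M"
    using E4_zero_exists[OF z0] by blast
  then interpret E4_zero z0 \<epsilon> L M .
  have "n ^ 2 \<noteq> 1" using assms(1,2) by (simp add: power2_eq_square)
  then have "(of_nat (n ^ 2) :: complex) \<noteq> of_nat 1" unfolding of_nat_eq_iff .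
  then have "1 - of_nat n ^ 2 \<noteq> (0 :: complex)" by simp
  then have "s \<noteq> 0" unfolding assms(3) by simp
  then have "is_pole (Q1 r s) z0" by (rule is_pole_Q1)
  with assms(4) z0(1) have "\<not> has_log_singularity y z0"
    if "\<epsilon>' > 0" "solves_on (Q1 r s) y (slit_disc z0 \<epsilon>')" for \<epsilon>' y
    using that unfolding apparent_def by blast
  then show ?thesis by (rule truncated_if_no_logarithm[OF assms(1-3)])
qed

lemma poly_map_of_rat_linear_factor:
  "poly (map_poly of_rat ([:c, 1:] * p)) (x :: complex) = (of_rat c + x) * poly (map_poly of_rat p) x"
proof -
  have "map_poly of_rat ([:c, 1:] * p) = smult (of_rat c) (map_poly of_rat p) + pCons 0 (map_poly of_rat p :: complex poly)"
  proof (rule poly_eqI)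
    fix i show "coeff (map_poly of_rat ([:c, 1:] * p)) i =
        coeff (smult (of_rat c) (map_poly of_rat p) + pCons 0 (map_poly of_rat p :: complex poly)) i"
      by (cases i) (simp_all add: coeff_map_poly of_rat_add of_rat_mult)
  qed
  then show ?thesis by (simp add: algebra_simps)
qed

lemma poly_map_of_rat_prod:
  fixes c :: "nat \<Rightarrow> rat"
  shows
  "poly (map_poly of_rat (\<Prod>l<m. [:c l, 1:])) (x :: complex) = (\<Prod>l<m. of_rat (c l) + x)"
proof (induction m)
  case (Suc m)
  have "(\<Prod>l<Suc m. [:c l, 1:]) = [:c m, 1:] * (\<Prod>l<m. [:c l, 1:])"
    by (simp only: prod.lessThan_Suc mult.commute)
  then show ?case by (simp only: poly_map_of_rat_linear_factor Suc.IH prod.lessThan_Suc mult.commute)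
qed simp

theorem theorem1p7:
  fixes \<kappa> :: real and n :: nat
  assumes "n \<ge> 1" and "\<kappa> = real n / 2"
  shows
    "(\<not> 3 dvd n \<longrightarrow> (\<forall>r s. s = s_exp \<kappa> \<longrightarrow> apparent (Q1 r s))) \<and>
     (3 dvd n \<longrightarrow>
       (\<exists>P :: rat poly. degree P = n div 3 \<and>
          (\<forall>r s. s = s_exp \<kappa> \<longrightarrow>
             (apparent (Q1 r s) \<longleftrightarrow> poly (map_poly of_rat P) r = 0)) \<and>
          (\<forall>r. poly (map_poly of_rat P) r = 0 \<longleftrightarrow>
             (\<exists>l::nat. l \<le> n div 3 - 1 \<and> r + s_exp \<kappa> = - (of_nat l + 1/2)\<^sup>2))))"
proof (intro conjI impI)
  have s: "s_exp \<kappa> = (1 - of_nat n ^ 2) / 9"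
    by (simp add: s_exp_def assms(2) power_divide)
  show "\<forall>r s. s = s_exp \<kappa> \<longrightarrow> apparent (Q1 r s)" if "\<not> 3 dvd n"
    using Q1_apparentI[OF assms(1)] that s by blast
  assume "3 dvd n"
  then obtain m where n: "n = 3 * m" by blast
  then have m: "m \<ge> 1" "n div 3 = m" using assms(1) by auto
  \<comment> \<open>\<open>c l\<close> is \<open>s + (l + 1/2)^2\<close>, so that the factor
    \<open>x + c l\<close> vanishes exactly at the prescribed value of \<open>r\<close>; it is
    rational because \<open>s\<close> is.\<close>
  define c :: "nat \<Rightarrow> rat" where "c = (\<lambda>l. (1 - of_nat n ^ 2) / 9 + (of_nat l + 1 / 2) ^ 2)"
  define P where "P = (\<Prod>l<m. [:c l, 1:])"
  have c: "of_rat (c l) = s_exp \<kappa> + (of_nat l + 1 / 2) ^ 2" for l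
    by (simp add: c_def s of_rat_add of_rat_diff of_rat_divide of_rat_power)
  have root: "poly (map_poly of_rat P) r = 0 \<longleftrightarrow> (\<exists>l<m. r + s_exp \<kappa> = - (of_nat l + 1 / 2)\<^sup>2)" for r
    unfolding P_def poly_map_of_rat_prod c by (auto simp: add_eq_0_iff2 add_ac eq_neg_iff_add_eq_0)
  have "degree P = m"
    unfolding P_def by (subst degree_prod_sum_eq) auto
  moreover have "apparent (Q1 r (s_exp \<kappa>)) \<longleftrightarrow> poly (map_poly of_rat P) r = 0" for r
    using Q1_apparentI[OF assms(1) s, of r] Q1_apparentD[OF m(1) n s, of r] truncation_iff[OF m(1) s[unfolded n], of r]
    unfolding root n[symmetric] m(2) by blast
  moreover have "l \<le> n div 3 - 1 \<longleftrightarrow> l < m" for l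
    using m by auto
  ultimately show "\<exists>P :: rat poly. degree P = n div 3 \<and>
          (\<forall>r s. s = s_exp \<kappa> \<longrightarrow>
             (apparent (Q1 r s) \<longleftrightarrow> poly (map_poly of_rat P) r = 0)) \<and>
          (\<forall>r. poly (map_poly of_rat P) r = 0 \<longleftrightarrow>
             (\<exists>l::nat. l \<le> n div 3 - 1 \<and> r + s_exp \<kappa> = - (of_nat l + 1/2)\<^sup>2))"
    using root m(2) by (intro exI[of _ P]) auto
qed

end
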